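(* Let $f(x,u)=b(u)$ with $b(0)=0$, $b=B'$ continuous, where $B$ is an N-function with $G\ll B\ll G_{n/s}$ and $p_B^-\le\frac{t b(t)}{B(t)}\le p_B^+$ for all $t>0$, for some $1<p_B^-\le p_B^+<\infty$. Assume that $p^--1\le\frac{t g'(t)}{g(t)}\le p^+-1$ for all $t>0$ with $p^->2$, and that $g=G'$ is convex in $(0,\infty)$. Let $(\underline{u},\overline{u})$ be a sub-supersolution pair of the problem $$(-\Delta_g)^s u=b(u)\ \text{ in }\Omega,\qquad u=0\ \text{ in }\Omega^c,$$ and assume that $\int_\Omega G(u(x))\,dx>0$ for every weak solution $u\in S(\underline{u},\overline{u})$. Then $S(\underline{u},\overline{u})$ contains a smallest and a biggest element with respect to the pointwise (a.e.) ordering.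
   Context: Let $n\ge1$, $s\in(0,1)$, $\Omega\subset\mathbb{R}^n$ a smooth bounded domain, $\Omega^c=\mathbb{R}^n\setminus\Omega$. N-functions: $G:[0,\infty)\to[0,\infty)$ is an N-function if $G(t)=\int_0^t g(\tau)\,d\tau$ with $g$ right-continuous on $[0,\infty)$, positive on $(0,\infty)$, non-decreasing, $g(0)=0$, $\lim_{t\to\infty}g(t)=\infty$. $G$ is extended to $\mathbb{R}$ as an even function and $g=G'$ as an odd function (same convention for every N-function). Standing assumptions on $G$: there are constants $1<p^-\le p^+<\infty$ with $p^-\le \frac{t g(t)}{G(t)}\le p^+$ for all $t>0$; $g$ is differentiable and $g'$ is non-decreasing on $(0,\infty)$; $\int_M^\infty (t/G(t))^{s/(n-s)}dt=\infty$ for some $M>0$ and $\int_0^\delta (t/G(t))^{s/(n-s)}dt<\infty$ for some $\delta>0$. The Orlicz-Sobolev conjugate is $G_{n/s}=G\circ H^{-1}$ with $H(t)=\big(\int_0^t(\tau/G(\tau))^{s/(n-s)}d\tau\big)^{(n-s)/n}$. For N-functions $A,B$, write $A\ll B$ if $\lim_{t\to\infty}A(ct)/B(t)=0$ for every $c>0$. Spaces: $d\mu=\frac{dx\,dy}{|x-y|^n}$; $\rho_G(u)=\int_{\mathbb{R}^n}G(|u|)\,dx$, $\rho_{s,G}(u)=\iint_{\mathbb{R}^{2n}}G\big(\frac{|u(x)-u(y)|}{|x-y|^s}\big)d\mu$; $W^{s,G}(\mathbb{R}^n)$ is the set of measurable $u$ with $\rho_G(u)<\infty$, $\rho_{s,G}(u)<\infty$,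 with norm $\|u\|_{s,G}=\inf\{\lambda>0:\rho_G(u/\lambda)\le1\}+\inf\{\lambda>0:\rho_{s,G}(u/\lambda)\le1\}$. $W^{s,G}_0(\Omega)=\{u\in W^{s,G}(\mathbb{R}^n):u=0\text{ in }\Omega^c\}$. $E$ is the closure of $C_c^\infty(\Omega)$ in $W^{s,G}(\mathbb{R}^n)$, and $E_+=\{v\in E: v\ge0\}$. All (in)equalities between functions are a.e. Operator: for $u,v\in W^{s,G}(\mathbb{R}^n)$, $\langle(-\Delta_g)^su,v\rangle=\iint_{\mathbb{R}^{2n}}g\big(\frac{u(x)-u(y)}{|x-y|^s}\big)\frac{v(x)-v(y)}{|x-y|^s}\,d\mu$. Solutions: $u\in W^{s,G}(\mathbb{R}^n)$ is a supersolution of the problem if $\langle(-\Delta_g)^su,v\rangle\ge\int_\Omega b(u)v\,dx$ for all $v\in E_+$ and $u\ge0$ in $\Omega^c$; it is a subsolution if $\langle(-\Delta_g)^su,v\rangle\le\int_\Omega b(u)v\,dx$ for all $v\in E_+$ and $u\le0$ in $\Omega^c$. $(\underline{u},\overline{u})\in W^{s,G}(\mathbb{R}^n)^2$ is a sub-supersolution pair if $\underline{u}$ is a subsolution, $\overline{u}$ is a supersolution and $\underline{u}\le\overline{u}$ in $\Omega$. $u\in W_0^{s,G}(\Omega)$ is a weak solution if $\langle(-\Delta_g)^su,v\rangle=\int_\Omega b(u)v\,dx$ for all $v\in E$. $S(\underline{u},\overline{u})=\{u\in W_0^{s,G}(\Omega): u\text{ is a weak solution},\ \underline{u}\le u\le\overline{u}\}$.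 *)

theory Defs
  imports "HOL-Analysis.Analysis"
begin

section \<open>Smooth functions and smooth domains\<close>

primrec Ck :: "nat \<Rightarrow> ('a::euclidean_space \<Rightarrow> real) \<Rightarrow> bool" where
  "Ck 0 f \<longleftrightarrow> continuous_on UNIV f"
| "Ck (Suc k) f \<longleftrightarrow> (\<forall>x. f differentiable (at x)) \<and>
     (\<forall>h. Ck k (\<lambda>x. frechet_derivative f (at x) h))"

definition smooth :: "('a::euclidean_space \<Rightarrow> real) \<Rightarrow> bool" where
  "smooth f \<longleftrightarrow> (\<forall>k. Ck k f)"

text \<open>
  The domain lies locally strictly above the graph of a smooth function, in the
  direction of some unit vector \<open>e\<close>. The function \<open>\<gamma>\<close> of the remaining \<open>n - 1\<close>
  variables is represented as a function on the whole space that is constant in direction \<open>e\<close>.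
\<close>

definition smooth_bounded_domain :: "'a::euclidean_space set \<Rightarrow> bool" where
  "smooth_bounded_domain \<Omega> \<longleftrightarrow>
     open \<Omega> \<and> connected \<Omega> \<and> \<Omega> \<noteq> {} \<and> bounded \<Omega> \<and>
     (\<forall>p\<in>frontier \<Omega>. \<exists>r>0. \<exists>e \<gamma>. norm e = 1 \<and> smooth \<gamma> \<and>
        (\<forall>x t. \<gamma> (x + t *\<^sub>R e) = \<gamma> x) \<and>
        \<Omega> \<inter> ball p r = {x \<in> ball p r. x \<bullet> e > \<gamma> x})"

definition Cc_infinity :: "'a::euclidean_space set \<Rightarrow> ('a \<Rightarrow> real) set" where
  "Cc_infinity \<Omega> = {\<phi>. smooth \<phi> \<and>
     compact (closure {x. \<phi> x \<noteq> 0}) \<and> closure {x. \<phi> x \<noteq> 0} \<subseteq> \<Omega>}"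


section \<open>N-functions\<close>

text \<open>
  \<open>N_function G g\<close>: \<open>G\<close> is the even extension of an N-function and \<open>g\<close> is the
  odd extension of its density.
\<close>

definition N_function :: "(real \<Rightarrow> real) \<Rightarrow> (real \<Rightarrow> real) \<Rightarrow> bool" where
  "N_function G g \<longleftrightarrow>
     (\<forall>t\<ge>0. continuous (at_right t) g) \<and>
     (\<forall>t>0. g t > 0) \<and>
     mono_on {0..} g \<and>
     g 0 = 0 \<and>
     filterlim g at_top at_top \<and>
     (\<forall>t\<ge>0. G t = integral {0..t} g) \<and>
     (\<forall>t. G (- t) = G t) \<and>
     (\<forall>t. g (- t) = - g t)"

definition ess_slower :: "(real \<Rightarrow> real) \<Rightarrow> (real \<Rightarrow> real) \<Rightarrow> bool"  (infix "\<lless>" 50) where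
  "A \<lless> B \<longleftrightarrow> (\<forall>c>0. ((\<lambda>t. A (c * t) / B t) \<longlongrightarrow> 0) at_top)"

definition conj_integrand :: "nat \<Rightarrow> real \<Rightarrow> (real \<Rightarrow> real) \<Rightarrow> real \<Rightarrow> real" where
  "conj_integrand n s G t = (t / G t) powr (s / (real n - s))"

definition conj_H :: "nat \<Rightarrow> real \<Rightarrow> (real \<Rightarrow> real) \<Rightarrow> real \<Rightarrow> real" where
  "conj_H n s G t =
     (LINT \<tau>:{0..t}|lborel. conj_integrand n s G \<tau>) powr ((real n - s) / real n)"

definition sobolev_conj :: "nat \<Rightarrow> real \<Rightarrow> (real \<Rightarrow> real) \<Rightarrow> real \<Rightarrow> real" where
  "sobolev_conj n s G t = G (inv_into {0..} (conj_H n s G) \<bar>t\<bar>)"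


section \<open>Fractional Orlicz-Sobolev spaces\<close>

text \<open>The density is \<open>0\<close> instead of \<open>\<infinity>\<close> on the diagonal, which is a null set.\<close>

definition mu :: "('a::euclidean_space \<times> 'a) measure" where
  "mu = density lebesgue (\<lambda>(x, y). ennreal (1 / dist x y ^ DIM('a)))"

definition rho_G :: "(real \<Rightarrow> real) \<Rightarrow> ('a::euclidean_space \<Rightarrow> real) \<Rightarrow> ennreal" where
  "rho_G G u = (\<integral>\<^sup>+ x. ennreal (G \<bar>u x\<bar>) \<partial>lebesgue)"

definition rho_sG :: "real \<Rightarrow> (real \<Rightarrow> real) \<Rightarrow> ('a::euclidean_space \<Rightarrow> real) \<Rightarrow> ennreal" where
  "rho_sG s G u = (\<integral>\<^sup>+ (x, y). ennreal (G (\<bar>u x - u y\<bar> / dist x y powr s)) \<partial>mu)"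

definition W_space :: "real \<Rightarrow> (real \<Rightarrow> real) \<Rightarrow> ('a::euclidean_space \<Rightarrow> real) set" where
  "W_space s G = {u \<in> borel_measurable lebesgue. rho_G G u < \<infinity> \<and> rho_sG s G u < \<infinity>}"

definition W_norm :: "real \<Rightarrow> (real \<Rightarrow> real) \<Rightarrow> ('a::euclidean_space \<Rightarrow> real) \<Rightarrow> real" where
  "W_norm s G u =
     Inf {l. l > 0 \<and> rho_G G (\<lambda>x. u x / l) \<le> 1} +
     Inf {l. l > 0 \<and> rho_sG s G (\<lambda>x. u x / l) \<le> 1}"

definition W0_space ::
  "real \<Rightarrow> (real \<Rightarrow> real) \<Rightarrow> 'a::euclidean_space set \<Rightarrow> ('a \<Rightarrow> real) set" where
  "W0_space s G \<Omega> = {u \<in> W_space s G. AE x in lebesgue. x \<notin> \<Omega> \<longrightarrow> u x = 0}"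

definition E_space ::
  "real \<Rightarrow> (real \<Rightarrow> real) \<Rightarrow> 'a::euclidean_space set \<Rightarrow> ('a \<Rightarrow> real) set" where
  "E_space s G \<Omega> = {v \<in> W_space s G.
     \<forall>\<epsilon>>0. \<exists>\<phi>\<in>Cc_infinity \<Omega>. W_norm s G (\<lambda>x. v x - \<phi> x) < \<epsilon>}"

definition E_plus ::
  "real \<Rightarrow> (real \<Rightarrow> real) \<Rightarrow> 'a::euclidean_space set \<Rightarrow> ('a \<Rightarrow> real) set" where
  "E_plus s G \<Omega> = {v \<in> E_space s G \<Omega>. AE x in lebesgue. v x \<ge> 0}"


section \<open>The operator and its solutions\<close>

definition frac_g_Laplacian ::
  "real \<Rightarrow> (real \<Rightarrow> real) \<Rightarrow> ('a::euclidean_space \<Rightarrow> real) \<Rightarrow> ('a \<Rightarrow> real) \<Rightarrow> real" where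
  "frac_g_Laplacian s g u v =
     (LINT (x, y)|mu. g ((u x - u y) / dist x y powr s) * ((v x - v y) / dist x y powr s))"

definition supersolution ::
  "real \<Rightarrow> (real \<Rightarrow> real) \<Rightarrow> (real \<Rightarrow> real) \<Rightarrow> (real \<Rightarrow> real) \<Rightarrow> 'a::euclidean_space set \<Rightarrow>
    ('a \<Rightarrow> real) \<Rightarrow> bool" where
  "supersolution s G g b \<Omega> u \<longleftrightarrow>
     u \<in> W_space s G \<and>
     (\<forall>v\<in>E_plus s G \<Omega>.
        frac_g_Laplacian s g u v \<ge> (LINT x:\<Omega>|lebesgue. b (u x) * v x)) \<and>
     (AE x in lebesgue. x \<notin> \<Omega> \<longrightarrow> u x \<ge> 0)"

definition subsolution ::
  "real \<Rightarrow> (real \<Rightarrow> real) \<Rightarrow> (real \<Rightarrow> real) \<Rightarrow> (real \<Rightarrow> real) \<Rightarrow> 'a::euclidean_space set \<Rightarrow>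
    ('a \<Rightarrow> real) \<Rightarrow> bool" where
  "subsolution s G g b \<Omega> u \<longleftrightarrow>
     u \<in> W_space s G \<and>
     (\<forall>v\<in>E_plus s G \<Omega>.
        frac_g_Laplacian s g u v \<le> (LINT x:\<Omega>|lebesgue. b (u x) * v x)) \<and>
     (AE x in lebesgue. x \<notin> \<Omega> \<longrightarrow> u x \<le> 0)"

definition sub_super_pair ::
  "real \<Rightarrow> (real \<Rightarrow> real) \<Rightarrow> (real \<Rightarrow> real) \<Rightarrow> (real \<Rightarrow> real) \<Rightarrow> 'a::euclidean_space set \<Rightarrow>
    ('a \<Rightarrow> real) \<Rightarrow> ('a \<Rightarrow> real) \<Rightarrow> bool" where
  "sub_super_pair s G g b \<Omega> ul uu \<longleftrightarrow>
     subsolution s G g b \<Omega> ul \<and> supersolution s G g b \<Omega> uu \<and>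
     (AE x in lebesgue. x \<in> \<Omega> \<longrightarrow> ul x \<le> uu x)"

definition weak_solution ::
  "real \<Rightarrow> (real \<Rightarrow> real) \<Rightarrow> (real \<Rightarrow> real) \<Rightarrow> (real \<Rightarrow> real) \<Rightarrow> 'a::euclidean_space set \<Rightarrow>
    ('a \<Rightarrow> real) \<Rightarrow> bool" where
  "weak_solution s G g b \<Omega> u \<longleftrightarrow>
     u \<in> W0_space s G \<Omega> \<and>
     (\<forall>v\<in>E_space s G \<Omega>.
        frac_g_Laplacian s g u v = (LINT x:\<Omega>|lebesgue. b (u x) * v x))"

definition solution_set ::
  "real \<Rightarrow> (real \<Rightarrow> real) \<Rightarrow> (real \<Rightarrow> real) \<Rightarrow> (real \<Rightarrow> real) \<Rightarrow> 'a::euclidean_space set \<Rightarrow>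
    ('a \<Rightarrow> real) \<Rightarrow> ('a \<Rightarrow> real) \<Rightarrow> ('a \<Rightarrow> real) set" where
  "solution_set s G g b \<Omega> ul uu =
     {u. weak_solution s G g b \<Omega> u \<and> (AE x in lebesgue. ul x \<le> u x \<and> u x \<le> uu x)}"

end

theory Submission
  imports Defs "HOL-Real_Asymp.Real_Asymp"
begin

text \<open>
  Since \<open>b\<close> is non-decreasing, the map sending \<open>w\<close> to the solution \<open>u\<close> of \<open>(-\<Delta>\<^sub>g)\<^sup>s u = b w\<close> is
  order preserving on the functions between \<open>ul\<close> and \<open>uu\<close>, by the comparison principle. As in
  Tarski's theorem, the least \<open>w\<close> that lies above its image is a fixed point and lies below every solution;
  it is found by minimising the integral of \<open>arctan w\<close>. The biggest solution follows by the
  symmetry \<open>u \<mapsto> - u\<close>, because \<open>g\<close> and \<open>b\<close> are odd.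

  The equation with right-hand side \<open>b w\<close> is solved by minimising a convex functional. As \<open>g\<close> is
  convex, \<open>G\<close> satisfies Clarkson's inequality, so minimising sequences are Cauchy in
  modular. The functional is bounded below because testing the inequalities for \<open>ul\<close> and \<open>uu\<close>
  bounds the source term by the energy; the integrals involved are finite by an Orlicz-Sobolev
  embedding, proved by estimating the energy of the level sets. The comparison
  principle needs test functions that vanish outside the domain to be limits of functions in
  \<open>Cc_infinity\<close>: cut off, push into the domain, mollify.
\<close>

section \<open>N-functions of controlled growth\<close>

text \<open>The order is only almost everywhere, so the infimum of all \<open>w\<close> above their
  image cannot be formed pointwise; a bounded, strictly increasing functional reduces it to
  countably many \<open>w\<close>. These \<open>w\<close> are merely measurable between
  \<open>ul\<close> and \<open>uu\<close>, so the source term has to be controlled without any norm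
  of \<open>w\<close>: monotonicity of \<open>b\<close> traps it between the source terms of
  \<open>ul\<close> and \<open>uu\<close>. The embedding is therefore asked only for finite
  integrals, and a constant depending on the function does no harm. Subcriticality of
  \<open>B\<close> enters it as the implicit inequality
  \<open>B t \<le> G (\<epsilon> * t * B t powr (s / real n))\<close>, in which the inverse of
  \<open>conj_H\<close> has disappeared. Convexity of \<open>g\<close> together with
  \<open>g 0 = 0\<close> acts twice: \<open>g t / t\<close> is nondecreasing, which feeds Clarkson's
  inequality, and \<open>g\<close> is strictly increasing, so that equality in the comparison test
  leaves the positive part without jumps. Approximation by test functions is carried out for
  modulars, where Fatou and Jensen apply directly; the norm returns only when membership in
  \<open>E_space\<close> is verified.\<close>

locale N_growth =
  fixes G g :: "real \<Rightarrow> real" and p q :: real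
  assumes N_function: "N_function G g"
    and cont_g: "continuous_on UNIV g"
    and p_gt_1: "1 < p"
    and growth: "t > 0 \<Longrightarrow> p * G t \<le> t * g t \<and> t * g t \<le> q * G t"
begin

lemma g_odd: "g (- t) = - g t"
  and G_even: "G (- t) = G t"
  and g_0 [simp]: "g 0 = 0"
  and g_pos: "t > 0 \<Longrightarrow> g t > 0"
  and g_mono_nonneg: "0 \<le> a \<Longrightarrow> a \<le> b \<Longrightarrow> g a \<le> g b"
  and G_integral: "t \<ge> 0 \<Longrightarrow> G t = integral {0..t} g"
  using N_function by (auto simp: N_function_def mono_on_def)

lemma g_nonneg: "t \<ge> 0 \<Longrightarrow> g t \<ge> 0"
  using g_mono_nonneg[of 0 t] by simp

lemma g_mono: "a \<le> b \<Longrightarrow> g a \<le> g b"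
proof -
  assume ab: "a \<le> b"
  consider "0 \<le> a" | "a < 0" "b < 0" | "a < 0" "0 \<le> b" by linarith
  then show "g a \<le> g b"
  proof cases
    case 1 then show ?thesis using g_mono_nonneg ab by simp
  next
    case 2 then show ?thesis using g_mono_nonneg[of "-b" "-a"] ab by (simp add: g_odd)
  next
    case 3 then show ?thesis using g_nonneg[of "-a"] g_nonneg[of b] by (simp add: g_odd)
  qed
qed

lemma measurable_g [measurable]: "g \<in> borel_measurable borel"
  using cont_g by (rule borel_measurable_continuous_onI)

lemma G_0 [simp]: "G 0 = 0"
  using G_integral[of 0] by simp

lemma abs_g: "\<bar>g t\<bar> = g \<bar>t\<bar>"
  using g_nonneg[of t] g_nonneg[of "-t"] by (cases "t \<ge> 0") (auto simp: g_odd abs_if)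

lemma G_abs [simp]: "G \<bar>t\<bar> = G t"
  by (simp add: abs_if G_even)

lemma g_integrable: "g integrable_on {a..b}"
  using cont_g by (intro integrable_continuous_real continuous_on_subset[OF cont_g]) auto

lemma G_diff: "0 \<le> a \<Longrightarrow> a \<le> b \<Longrightarrow> G b - G a = integral {a..b} g"
  using Henstock_Kurzweil_Integration.integral_combine[of 0 a b g] g_integrable by (simp add: G_integral)

text \<open>Monotonicity of \<open>g\<close> compares its integral between \<open>a\<close> and
  \<open>b\<close> with that of the constant \<open>g a\<close>; the sign comes out right for either
  order of \<open>a\<close> and \<open>b\<close>.\<close>

lemma tangent_nonneg:
  assumes "0 \<le> a" "0 \<le> b"
  shows "G a + g a * (b - a) \<le> G b"
proof (cases "a \<le> b")
  case True
  have "integral {a..b} (\<lambda>_. g a) \<le> integral {a..b} g"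
    by (rule integral_le) (use g_integrable g_mono in auto)
  then show ?thesis using G_diff[of a b] assms True by (simp add: mult.commute)
next
  case False
  have "integral {b..a} g \<le> integral {b..a} (\<lambda>_. g a)"
    by (rule integral_le) (use g_integrable g_mono in auto)
  then show ?thesis using G_diff[of b a] assms False by (simp add: algebra_simps)
qed

text \<open>Reduces to nonnegative arguments: for \<open>a \<ge> 0\<close>, reflecting a negative
  \<open>b\<close> only increases the linear term, and a negative \<open>a\<close> is treated by
  reflecting both. This subgradient inequality later yields convexity, Jensen's inequality and the
  Euler-Lagrange equation.\<close>

lemma tangent: "G a + g a * (b - a) \<le> G b"
proof -
  have *: "G a + g a * (b - a) \<le> G b" if "0 \<le> a" for a b
  proof (cases "0 \<le> b")
    case True then show ?thesis using tangent_nonneg that by simp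
  next
    case False
    have "G a + g a * (- b - a) \<le> G (- b)" using False that by (intro tangent_nonneg) auto
    moreover have "g a * (b - a) \<le> g a * (- b - a)"
      using False g_nonneg[OF that] by (intro mult_left_mono) auto
    ultimately show ?thesis by (simp add: G_even)
  qed
  show ?thesis
  proof (cases "0 \<le> a")
    case False
    then have "G (-a) + g (-a) * (-b - (-a)) \<le> G (-b)" by (intro *) auto
    moreover have "g (-a) * (-b - (-a)) = g a * (b - a)" by (simp add: g_odd algebra_simps)
    ultimately show ?thesis by (simp add: G_even)
  qed (rule *)
qed

lemma G_mono: "\<bar>a\<bar> \<le> \<bar>b\<bar> \<Longrightarrow> G a \<le> G b"
  using tangent[of "\<bar>a\<bar>" "\<bar>b\<bar>"] g_nonneg[of "\<bar>a\<bar>"]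
  by simp (smt (verit) mult_nonneg_nonneg)

lemma G_nonneg: "0 \<le> G t"
  using G_mono[of 0 t] by simp

lemma G_pos: "t \<noteq> 0 \<Longrightarrow> 0 < G t"
proof -
  assume "t \<noteq> 0"
  then have "0 < g (\<bar>t\<bar>/2) * (\<bar>t\<bar> - \<bar>t\<bar>/2)" by (intro mult_pos_pos g_pos) auto
  also have "\<dots> \<le> G t" using tangent[of "\<bar>t\<bar>/2" "\<bar>t\<bar>"] G_nonneg[of "\<bar>t\<bar>/2"] by (simp del: mult_pos_pos)
  finally show ?thesis .
qed

lemma G_eq_0_iff [simp]: "G t = 0 \<longleftrightarrow> t = 0"
  using G_pos[of t] by (cases "t = 0") auto

lemma convex_G: "convex_on UNIV G"
proof (rule convex_onI)
  fix t x y :: real assume t: "0 < t" "t < 1"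
  let ?z = "(1 - t) *\<^sub>R x + t *\<^sub>R y"
  have "(1 - t) * (G ?z + g ?z * (x - ?z)) + t * (G ?z + g ?z * (y - ?z)) \<le> (1 - t) * G x + t * G y"
    using t by (intro add_mono mult_left_mono tangent) auto
  moreover have "(1 - t) * (G ?z + g ?z * (x - ?z)) + t * (G ?z + g ?z * (y - ?z)) = G ?z"
    by (simp add: algebra_simps)
  ultimately show "G ?z \<le> (1 - t) * G x + t * G y" by simp
qed simp

lemma cont_G: "continuous_on UNIV G"
  by (rule convex_on_continuous[OF _ convex_G]) auto

lemma measurable_G [measurable]: "G \<in> borel_measurable borel"
  using cont_G by (rule borel_measurable_continuous_onI)

lemma G_scale_le: "0 \<le> c \<Longrightarrow> c \<le> 1 \<Longrightarrow> G (c * t) \<le> c * G t"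
  using convex_onD[OF convex_G, of c 0 t] by simp

lemma DERIV_G: "t > 0 \<Longrightarrow> (G has_real_derivative g t) (at t)"
proof -
  assume t: "t > 0"
  have "((\<lambda>u. integral {0..u} g) has_real_derivative g t) (at t within {0..t+1})"
    by (rule integral_has_real_derivative) (use t continuous_on_subset[OF cont_g] in auto)
  then have "((\<lambda>u. integral {0..u} g) has_real_derivative g t) (at t)"
    using t by (subst (asm) at_within_interior) (auto simp: interior_atLeastAtMost_real)
  then show ?thesis
    by (rule has_field_derivative_transform_within_open[where S = "{0<..}"]) (use t G_integral in auto)
qed

text \<open>The sign of the derivative is that of \<open>t * g t - r * G t\<close>. By the growth
  bounds the quotient of \<open>G t\<close> by \<open>t powr r\<close> is nondecreasing for
  \<open>r = p\<close> and nonincreasing for \<open>r = q\<close>, which gives the two scaling laws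
  below.\<close>

lemma G_powr_deriv:
  assumes "t > 0"
  shows "((\<lambda>t. G t * t powr (- r)) has_real_derivative (t * g t - r * G t) * t powr (- r - 1)) (at t)"
proof -
  have e: "t powr (- r) = t * t powr (- r - 1)" using assms by (simp add: powr_mult_base)
  have "((\<lambda>t. G t * t powr (- r)) has_real_derivative
      g t * t powr (- r) + G t * ((- r) * t powr (- r - 1))) (at t)"
    using assms by (auto intro!: derivative_eq_intros DERIV_G)
  then show ?thesis unfolding e by (simp add: algebra_simps)
qed

lemma G_scale_powr_small:
  assumes "0 < c" "c \<le> 1" shows "G (c * t) \<le> c powr p * G t"
proof (cases "t = 0")
  case False
  define r where "r = \<bar>t\<bar>"
  have r: "r > 0" using False by (simp add: r_def)
  have "G (c * r) * (c * r) powr (- p) \<le> G r * r powr (- p)"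
  proof (rule DERIV_nonneg_imp_nondecreasing[where f = "\<lambda>t. G t * t powr (- p)"])
    fix t assume "c * r \<le> t" "t \<le> r"
    moreover have "0 < c * r" using assms r by simp
    ultimately have "0 < t" by linarith
    then show "\<exists>y. ((\<lambda>t. G t * t powr (- p)) has_real_derivative y) (at t) \<and> 0 \<le> y"
      using G_powr_deriv[of t p] growth[of t] by (auto intro!: exI mult_nonneg_nonneg)
  qed (use assms r in simp)
  moreover have "(c * r) powr (- p) = c powr (- p) * r powr (- p)" using assms r by (simp add: powr_mult)
  ultimately have "G (c * r) * c powr (- p) \<le> G r" using r by simp
  then have "G (c * r) \<le> c powr p * G r" using assms by (simp add: powr_minus field_simps)
  moreover have "G (c * r) = G (c * t)" using assms G_abs[of "c * t"] by (simp add: r_def abs_mult)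
  ultimately show ?thesis by (simp add: r_def)
qed simp

lemma G_scale_powr_large:
  assumes "1 \<le> c" shows "G (c * t) \<le> c powr q * G t"
proof (cases "t = 0")
  case False
  define r where "r = \<bar>t\<bar>"
  have r: "r > 0" using False by (simp add: r_def)
  have "G (c * r) * (c * r) powr (- q) \<le> G r * r powr (- q)"
  proof (rule DERIV_nonpos_imp_nonincreasing[where f = "\<lambda>t. G t * t powr (- q)"])
    fix t assume "r \<le> t" "t \<le> c * r"
    then have "0 < t" using r by linarith
    then show "\<exists>y. ((\<lambda>t. G t * t powr (- q)) has_real_derivative y) (at t) \<and> y \<le> 0"
      using G_powr_deriv[of t q] growth[of t] by (auto intro!: exI mult_nonpos_nonneg)
  qed (use assms r in simp)
  moreover have "(c * r) powr (- q) = c powr (- q) * r powr (- q)" using assms r by (simp add: powr_mult)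
  ultimately have "G (c * r) * c powr (- q) \<le> G r" using r by simp
  then have "G (c * r) \<le> c powr q * G r" using assms by (simp add: powr_minus field_simps)
  moreover have "G (c * r) = G (c * t)" using assms G_abs[of "c * t"] by (simp add: r_def abs_mult)
  ultimately show ?thesis by (simp add: r_def)
qed simp

lemma p_le_q: "p \<le> q"
proof -
  have "p * G 1 \<le> q * G 1" using growth[of 1] by simp
  then show ?thesis using G_pos[of 1] by simp
qed

lemma q_gt_1: "q > 1"
  using p_le_q p_gt_1 by simp

lemma G_double: "G (2 * t) \<le> 2 powr q * G t"
  by (rule G_scale_powr_large) simp

lemma G_add: "G (a + b) \<le> 2 powr q * (G a + G b)"
proof -
  have "G (a + b) \<le> G (2 * max \<bar>a\<bar> \<bar>b\<bar>)" by (rule G_mono) auto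
  also have "\<dots> \<le> 2 powr q * G (max \<bar>a\<bar> \<bar>b\<bar>)" by (rule G_double)
  also have "\<dots> \<le> 2 powr q * (G a + G b)"
    using G_nonneg[of a] G_nonneg[of b] by (intro mult_left_mono) (auto simp: max_def)
  finally show ?thesis .
qed

lemma G_diff_le: "G (a - b) \<le> 2 powr q * (G a + G b)"
  using G_add[of a "- b"] by (simp add: G_even)

text \<open>The factor \<open>1 + \<bar>c\<bar>\<close> is at least 1, so the scaling law for large
  factors covers every \<open>c\<close> at once.\<close>

lemma G_scale_bound: "G (c * t) \<le> (1 + \<bar>c\<bar>) powr q * G t"
proof -
  have "G (c * t) \<le> G ((1 + \<bar>c\<bar>) * t)"
    by (rule G_mono) (auto simp: abs_mult intro!: mult_right_mono)
  also have "\<dots> \<le> (1 + \<bar>c\<bar>) powr q * G t" by (rule G_scale_powr_large) simp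
  finally show ?thesis .
qed

text \<open>A Young inequality without the conjugate N-function: the larger of
  \<open>\<bar>a\<bar>\<close> and \<open>\<bar>b\<bar>\<close> may replace the other one in the
  product, and \<open>t * g t\<close> is at most \<open>q * G t\<close>.\<close>

lemma young: "\<bar>g a * b\<bar> \<le> q * (G a + G b)"
proof -
  have *: "g a * a \<le> q * G a" if "a \<ge> 0" for a
    using growth[of a] that by (cases "a = 0") (auto simp: mult.commute)
  have "\<bar>g a * b\<bar> = g \<bar>a\<bar> * \<bar>b\<bar>" by (simp add: abs_mult abs_g)
  also have "\<dots> \<le> g \<bar>a\<bar> * \<bar>a\<bar> + g \<bar>b\<bar> * \<bar>b\<bar>"
  proof (cases "\<bar>b\<bar> \<le> \<bar>a\<bar>")
    case True
    then have "g \<bar>a\<bar> * \<bar>b\<bar> \<le> g \<bar>a\<bar> * \<bar>a\<bar>" by (intro mult_left_mono g_nonneg) auto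
    moreover have "0 \<le> g \<bar>b\<bar> * \<bar>b\<bar>" by (intro mult_nonneg_nonneg g_nonneg) auto
    ultimately show ?thesis by linarith
  next
    case False
    then have "g \<bar>a\<bar> * \<bar>b\<bar> \<le> g \<bar>b\<bar> * \<bar>b\<bar>" by (intro mult_right_mono g_mono) auto
    moreover have "0 \<le> g \<bar>a\<bar> * \<bar>a\<bar>" by (intro mult_nonneg_nonneg g_nonneg) auto
    ultimately show ?thesis by linarith
  qed
  also have "\<dots> \<le> q * G \<bar>a\<bar> + q * G \<bar>b\<bar>" by (intro add_mono *) auto
  finally show ?thesis by (simp add: algebra_simps)
qed

lemma G_at_top: "filterlim G at_top at_top"
proof (rule filterlim_at_top_mono)
  show "filterlim (\<lambda>t. G 1 + g 1 * (t - 1)) at_top at_top"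
    using g_pos[of 1] by real_asymp
  show "eventually (\<lambda>t. G 1 + g 1 * (t - 1) \<le> G t) at_top" using tangent by auto
qed

lemma G_surj_nonneg:
  assumes "y \<ge> 0" obtains t where "t \<ge> 0" "G t = y"
proof -
  obtain t where t: "t \<ge> 0" "G t \<ge> y"
    using G_at_top eventually_ge_at_top[of "0::real"]
    by (metis (mono_tags, lifting) eventually_at_top_linorder filterlim_at_top linorder_le_cases)
  then show ?thesis using IVT'[of G 0 y t] assms that continuous_on_subset[OF cont_G] by auto
qed

end

section \<open>Clarkson's inequality from convexity of the density\<close>

locale Clarkson_N_growth = N_growth +
  assumes two_lt_p: "2 < p" and convex_g: "convex_on {0<..} g"
begin

text \<open>Convexity between 0 and \<open>t\<close> with \<open>g 0 = 0\<close>. Since convexity is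
  given on the open half-line only, the left end point is some \<open>e > 0\<close>, which then
  tends to 0. In other words, \<open>g t / t\<close> is nondecreasing.\<close>

lemma g_scale_le:
  assumes c: "0 < c" "c < 1" and t: "0 < t" shows "g (c * t) \<le> c * g t"
proof -
  have g0: "isCont g x" for x
    using cont_g by (simp add: continuous_on_eq_continuous_at)
  then have "(g \<longlongrightarrow> g 0) (at_right 0)"
    by (metis isCont_def filterlim_at_split)
  then have "((\<lambda>e. c * g t + (1 - c) * g e) \<longlongrightarrow> c * g t + (1 - c) * g 0) (at_right 0)"
    by (intro tendsto_intros)
  moreover have "((\<lambda>e. g (c * t + (1 - c) * e)) \<longlongrightarrow> g (c * t + (1 - c) * 0)) (at_right 0)"
  proof -
    have "isCont (\<lambda>e. g (c * t + (1 - c) * e)) 0"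
      by (rule isCont_o2[OF _ g0]) (intro continuous_intros)
    then show ?thesis
      unfolding isCont_def by (rule tendsto_within_subset) simp
  qed
  moreover have "eventually (\<lambda>e. g (c * t + (1 - c) * e) \<le> c * g t + (1 - c) * g e) (at_right 0)"
    using eventually_at_right_less[of 0]
  proof eventually_elim
    case (elim e)
    then show ?case using convex_onD[OF convex_g, of "1 - c" t e] c t by simp
  qed
  ultimately have "g (c * t + (1 - c) * 0) \<le> c * g t + (1 - c) * g 0"
    by (rule tendsto_le[rotated 1]) simp
  then show ?thesis by simp
qed

text \<open>Strictness comes from \<open>g_scale_le\<close> with the factor
  \<open>a / b < 1\<close>. It makes the operator strictly monotone, which the comparison principle
  relies on.\<close>

lemma g_strict_mono_pos: "0 \<le> a \<Longrightarrow> a < b \<Longrightarrow> g a < g b"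
proof (cases "a = 0")
  case False
  assume "0 \<le> a" "a < b"
  then have "g (a / b * b) \<le> a / b * g b" using False by (intro g_scale_le) auto
  also have "\<dots> < 1 * g b" using \<open>0 \<le> a\<close> \<open>a < b\<close> g_pos[of b] by (intro mult_strict_right_mono) auto
  finally show ?thesis using \<open>0 \<le> a\<close> \<open>a < b\<close> by simp
qed (use g_pos in simp)

lemma g_strict_mono: "a < b \<Longrightarrow> g a < g b"
  using g_strict_mono_pos[of a b] g_strict_mono_pos[of "-b" "-a"] g_pos[of b] g_pos[of "-a"]
  by (cases "0 \<le> a"; cases "b \<le> 0") (simp_all add: g_odd)

text \<open>As \<open>g t / t\<close> is nondecreasing, \<open>g\<close> lies above the line through
  the origin and \<open>(a, g a)\<close> beyond \<open>a\<close>, and below it before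
  \<open>a\<close>; integrating from \<open>a\<close> to \<open>b\<close> gives the claim.\<close>

lemma quadratic_tangent:
  assumes a: "0 < a" and b: "0 \<le> b" shows "G a + g a / (2 * a) * (b\<^sup>2 - a\<^sup>2) \<le> G b"
proof -
  have int: "((\<lambda>t. g a / a * t) has_integral g a / (2 * a) * (y\<^sup>2 - x\<^sup>2)) {x..y}" if "x \<le> y" for x y
  proof -
    have "((\<lambda>t. g a / a * t) has_integral (g a / (2 * a) * y\<^sup>2 - g a / (2 * a) * x\<^sup>2)) {x..y}"
      using a by (intro fundamental_theorem_of_calculus that)
         (auto intro!: derivative_eq_intros simp: has_real_derivative_iff_has_vector_derivative[symmetric] field_simps)
    then show ?thesis by (simp add: algebra_simps)
  qed
  show ?thesis
  proof (cases "a \<le> b")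
    case True
    have "g a / (2 * a) * (b\<^sup>2 - a\<^sup>2) \<le> integral {a..b} g"
    proof (rule has_integral_le[OF int integrable_integral])
      fix t assume "t \<in> {a..b}"
      then show "g a / a * t \<le> g t"
        using g_scale_le[of "a / t" t] a by (cases "t = a") (auto simp: field_simps)
    qed (use True g_integrable in auto)
    then show ?thesis using G_diff[of a b] a True by simp
  next
    case False
    have "integral {b..a} g \<le> g a / (2 * a) * (a\<^sup>2 - b\<^sup>2)"
    proof (rule has_integral_le[OF integrable_integral int])
      fix t assume "t \<in> {b..a}"
      then show "g t \<le> g a / a * t"
        using g_scale_le[of "t / a" a] a b by (cases "t = a"; cases "t = 0") (auto simp: field_simps)
    qed (use False g_integrable in auto)
    then show ?thesis using G_diff[of b a] b False by (simp add: algebra_simps)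
  qed
qed

text \<open>Both halves express that \<open>t \<mapsto> G (sqrt t)\<close> is convex and vanishes at \<open>0\<close>.\<close>

lemma Clarkson: "G ((a + b) / 2) + G ((a - b) / 2) \<le> (G a + G b) / 2"
proof -
  \<comment> \<open>The quadratic mean of \<open>a\<close> and \<open>b\<close>. By the
    parallelogram identity \<open>m\<^sup>2\<close> is also the sum of the squares of the half sum
    and the half difference, so \<open>m\<close> links the two sides.\<close>
  define m where "m = sqrt ((a\<^sup>2 + b\<^sup>2) / 2)"
  have m2: "m\<^sup>2 = (a\<^sup>2 + b\<^sup>2) / 2" by (simp add: m_def)
  show ?thesis
  proof (cases "m = 0")
    case True
    then have "a\<^sup>2 + b\<^sup>2 = 0" using m2 by simp
    then have "a = 0" "b = 0" by (auto simp: sum_power2_eq_zero_iff)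
    then show ?thesis by simp
  next
    case False
    then have m: "m > 0" by (simp add: m_def order_less_le)
    \<comment> \<open>Here \<open>p > 2\<close> enters: a ratio at most 1 raised to the power
      \<open>p\<close> is at most its square.\<close>
    have part: "G x \<le> x\<^sup>2 / m\<^sup>2 * G m" if "\<bar>x\<bar> \<le> m" for x
    proof (cases "x = 0")
      case False
      have "G (\<bar>x\<bar> / m * m) \<le> (\<bar>x\<bar> / m) powr p * G m"
        using that m False by (intro G_scale_powr_small) auto
      also have "\<dots> \<le> (\<bar>x\<bar> / m) powr 2 * G m"
        using that m False two_lt_p by (intro mult_right_mono powr_mono' G_nonneg) auto
      also have "(\<bar>x\<bar> / m) powr 2 = x\<^sup>2 / m\<^sup>2" using m False by (simp add: powr_numeral power_divide)
      finally show ?thesis using m by simp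
    qed (use G_nonneg in simp)
    have s: "((a + b) / 2)\<^sup>2 + ((a - b) / 2)\<^sup>2 = m\<^sup>2"
      unfolding m2 by (simp add: power2_eq_square field_simps)
    have "((a + b) / 2)\<^sup>2 \<le> m\<^sup>2" "((a - b) / 2)\<^sup>2 \<le> m\<^sup>2"
      using s zero_le_power2[of "(a - b) / 2"] zero_le_power2[of "(a + b) / 2"] by linarith+
    then have le: "\<bar>(a + b) / 2\<bar> \<le> m" "\<bar>(a - b) / 2\<bar> \<le> m"
      using m abs_le_square_iff[of "(a + b) / 2" m] abs_le_square_iff[of "(a - b) / 2" m] by simp_all
    have "G ((a + b) / 2) + G ((a - b) / 2) \<le> (((a + b) / 2)\<^sup>2 + ((a - b) / 2)\<^sup>2) / m\<^sup>2 * G m"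
      using part[OF le(1)] part[OF le(2)] by (simp add: add_divide_distrib distrib_right)
    also have "\<dots> = G m" using s m by simp
    also have "G m \<le> (G a + G b) / 2"
    proof -
      have "2 * G m + g m / (2 * m) * (a\<^sup>2 + b\<^sup>2 - 2 * m\<^sup>2) \<le> G a + G b"
        using add_mono[OF quadratic_tangent[OF m abs_ge_zero, of a] quadratic_tangent[OF m abs_ge_zero, of b]]
        by (simp add: algebra_simps)
      moreover have "a\<^sup>2 + b\<^sup>2 - 2 * m\<^sup>2 = 0" unfolding m2 by simp
      ultimately have "2 * G m \<le> G a + G b" by simp
      then show ?thesis by simp
    qed
    finally show ?thesis .
  qed
qed

end

section \<open>The measure on pairs and difference quotients\<close>

lemma null_sets_lborel_Times:
  fixes N :: "'a::euclidean_space set"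
  assumes "N \<in> null_sets lborel"
  shows "N \<times> (UNIV :: 'b::euclidean_space set) \<in> null_sets lborel"
    and "(UNIV :: 'b set) \<times> N \<in> null_sets lborel"
proof -
  have [measurable]: "N \<in> sets borel" using assms by auto
  have "emeasure (lborel \<Otimes>\<^sub>M lborel) (N \<times> (UNIV :: 'b set)) = 0"
    using assms by (subst lborel.emeasure_pair_measure_Times) auto
  moreover have "emeasure (lborel \<Otimes>\<^sub>M lborel) ((UNIV :: 'b set) \<times> N) = 0"
    using assms by (subst lborel.emeasure_pair_measure_Times) auto
  ultimately show "N \<times> (UNIV :: 'b set) \<in> null_sets lborel" "(UNIV :: 'b set) \<times> N \<in> null_sets lborel"
    unfolding lborel_prod[symmetric] by (auto intro!: null_setsI)
qed

text \<open>Between completed measures, preimages of null sets must be measurable too; a projection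
  has this property because the cylinder over a null set is a null set.\<close>

lemma measurable_fst_lebesgue [measurable]:
  "(fst :: 'a::euclidean_space \<times> 'b::euclidean_space \<Rightarrow> 'a) \<in> lebesgue \<rightarrow>\<^sub>M lebesgue"
  and measurable_snd_lebesgue [measurable]:
  "(snd :: 'a::euclidean_space \<times> 'b::euclidean_space \<Rightarrow> 'b) \<in> lebesgue \<rightarrow>\<^sub>M lebesgue"
proof -
  have C: "complete_measure (lebesgue :: ('a \<times> 'b) measure)" ..
  have f: "(fst :: 'a \<times> 'b \<Rightarrow> 'a) \<in> lebesgue \<rightarrow>\<^sub>M lborel" "(snd :: 'a \<times> 'b \<Rightarrow> 'b) \<in> lebesgue \<rightarrow>\<^sub>M lborel"
    by (auto intro!: measurable_completion borel_measurable_continuous_onI continuous_intros simp: measurable_lborel1)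
  have "fst -` N \<inter> space lebesgue \<in> null_sets (lebesgue :: ('a \<times> 'b) measure)" if "N \<in> null_sets lborel" for N :: "'a set"
  proof -
    have "fst -` N = N \<times> (UNIV :: 'b set)" by auto
    then show ?thesis using null_sets_lborel_Times(1)[OF that, where 'b = 'b] by (simp add: null_sets_completionI)
  qed
  then have "null_sets lborel \<subseteq> null_sets (distr (lebesgue :: ('a \<times> 'b) measure) lborel fst)"
    using null_setsD2[of _ lborel] by (auto simp: null_sets_distr_iff[OF f(1)])
  then show "(fst :: 'a \<times> 'b \<Rightarrow> 'a) \<in> lebesgue \<rightarrow>\<^sub>M lebesgue" by (rule complete_measure.measurable_completion2[OF C f(1)])
  have "snd -` N \<inter> space lebesgue \<in> null_sets (lebesgue :: ('a \<times> 'b) measure)" if "N \<in> null_sets lborel" for N :: "'b set"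
  proof -
    have "snd -` N = (UNIV :: 'a set) \<times> N" by auto
    then show ?thesis using null_sets_lborel_Times(2)[OF that, where 'b = 'a] by (simp add: null_sets_completionI)
  qed
  then have "null_sets lborel \<subseteq> null_sets (distr (lebesgue :: ('a \<times> 'b) measure) lborel snd)"
    using null_setsD2[of _ lborel] by (auto simp: null_sets_distr_iff[OF f(2)])
  then show "(snd :: 'a \<times> 'b \<Rightarrow> 'b) \<in> lebesgue \<rightarrow>\<^sub>M lebesgue" by (rule complete_measure.measurable_completion2[OF C f(2)])
qed

lemma AE_lebesgue_Times:
  fixes P :: "'a::euclidean_space \<Rightarrow> bool"
  assumes "AE x in lebesgue. P x"
  shows "AE z in (lebesgue :: ('a \<times> 'b::euclidean_space) measure). P (fst z)"
    and "AE z in (lebesgue :: ('b \<times> 'a) measure). P (snd z)"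
proof -
  obtain N where N: "N \<in> null_sets lborel" "{x. \<not> P x} \<subseteq> N"
    using assms unfolding AE_completion_iff by (auto simp: eventually_ae_filter)
  show "AE z in (lebesgue :: ('a \<times> 'b) measure). P (fst z)"
    using N null_sets_lborel_Times(1)[OF N(1), where 'b = 'b] unfolding AE_completion_iff
    by (intro AE_I'[of "N \<times> UNIV"]) auto
  show "AE z in (lebesgue :: ('b \<times> 'a) measure). P (snd z)"
    using N null_sets_lborel_Times(2)[OF N(1), where 'b = 'b] unfolding AE_completion_iff
    by (intro AE_I'[of "UNIV \<times> N"]) auto
qed

lemma sets_mu [simp, measurable_cong]: "sets mu = sets lebesgue"
  and space_mu [simp]: "space mu = UNIV"
  by (auto simp: mu_def)

lemma measurable_mu [simp]: "measurable mu N = measurable lebesgue N"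
  by (intro measurable_cong_sets) auto

lemma measurable_lebesgueI: "f \<in> measurable borel N \<Longrightarrow> f \<in> measurable lebesgue N"
  by (rule measurable_completion) simp

lemma measurable_kernel [measurable]:
  "(\<lambda>(x :: 'a::euclidean_space, y). ennreal (1 / dist x y ^ n)) \<in> borel_measurable borel"
  unfolding split_beta by (intro measurable_compose[OF _ measurable_ennreal] borel_measurable_divide
      borel_measurable_power borel_measurable_continuous_onI continuous_intros)

lemma measurable_kernel_lebesgue [measurable]:
  "(\<lambda>(x :: 'a::euclidean_space, y). ennreal (1 / dist x y ^ n)) \<in> borel_measurable lebesgue"
  by (rule measurable_lebesgueI[OF measurable_kernel])

text \<open>The density is positive off the diagonal, and on it \<open>1 / 0 = 0\<close> makes it
  vanish.\<close>

lemma AE_mu_iff: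
  "(AE z in mu. P z) \<longleftrightarrow> (AE z :: 'a::euclidean_space \<times> 'a in lebesgue. fst z \<noteq> snd z \<longrightarrow> P z)"
  unfolding mu_def by (subst AE_density) (auto simp: split_beta zero_power intro!: AE_cong)

lemma AE_mu_I: "(AE z in lebesgue. P z) \<Longrightarrow> (AE z in mu. P z)"
  unfolding AE_mu_iff by auto

lemma AE_mu_pair:
  assumes "AE x in lebesgue. P x"
  shows "AE z in mu. P (fst z) \<and> P (snd z)"
  using AE_lebesgue_Times[OF assms] by (intro AE_mu_I) auto

lemma nn_integral_mu:
  fixes F :: "'a::euclidean_space \<times> 'a \<Rightarrow> ennreal"
  assumes [measurable]: "F \<in> borel_measurable borel"
  shows "(\<integral>\<^sup>+ z. F z \<partial>mu) = (\<integral>\<^sup>+ x. \<integral>\<^sup>+ y. ennreal (1 / dist x y ^ DIM('a)) * F (x, y) \<partial>lborel \<partial>lborel)"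
proof -
  have F: "F \<in> borel_measurable lebesgue" by (rule measurable_lebesgueI) simp
  have "(\<integral>\<^sup>+ z. F z \<partial>mu) = (\<integral>\<^sup>+ z. (case z of (x, y) \<Rightarrow> ennreal (1 / dist x y ^ DIM('a))) * F z \<partial>lebesgue)"
    unfolding mu_def using F by (subst nn_integral_density) auto
  also have "\<dots> = (\<integral>\<^sup>+ z. (case z of (x, y) \<Rightarrow> ennreal (1 / dist x y ^ DIM('a))) * F z \<partial>(lborel \<Otimes>\<^sub>M lborel))"
    unfolding lborel_prod by (simp add: nn_integral_completion)
  also have "\<dots> = (\<integral>\<^sup>+ x. \<integral>\<^sup>+ y. (case (x, y) of (x, y) \<Rightarrow> ennreal (1 / dist x y ^ DIM('a))) * F (x, y) \<partial>lborel \<partial>lborel)"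
    by (rule lborel.nn_integral_fst[symmetric]) (simp add: lborel_prod)
  finally show ?thesis by simp
qed

lemma nn_integral_mu_swap:
  fixes F :: "'a::euclidean_space \<times> 'a \<Rightarrow> ennreal"
  assumes [measurable]: "F \<in> borel_measurable borel"
  shows "(\<integral>\<^sup>+ z. F z \<partial>mu) = (\<integral>\<^sup>+ y. \<integral>\<^sup>+ x. ennreal (1 / dist x y ^ DIM('a)) * F (x, y) \<partial>lborel \<partial>lborel)"
  unfolding nn_integral_mu[OF assms]
proof (rule lborel_pair.Fubini'[symmetric])
  have "(\<lambda>z. (case z of (x, y) \<Rightarrow> ennreal (1 / dist x y ^ DIM('a))) * F z) \<in> borel_measurable borel"
    by measurable
  then show "(\<lambda>(x, y). ennreal (1 / dist x y ^ DIM('a)) * F (x, y)) \<in> borel_measurable (lborel \<Otimes>\<^sub>M lborel)"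
    by (simp add: lborel_prod split_beta')
qed

lemma nn_integral_lborel_shift:
  fixes f :: "'a::euclidean_space \<Rightarrow> ennreal"
  assumes [measurable]: "f \<in> borel_measurable borel"
  shows "(\<integral>\<^sup>+ x. f (a + x) \<partial>lborel) = (\<integral>\<^sup>+ x. f x \<partial>lborel)"
  by (subst (2) lborel_distr_plus[of a, symmetric]) (simp add: nn_integral_distr)

text \<open>The iterated integrals and translations below are handled for Borel functions; this
  exchange costs only a null set.\<close>

lemma borel_representative:
  fixes u :: "'a::euclidean_space \<Rightarrow> real"
  assumes "u \<in> borel_measurable lebesgue"
  obtains u' where "u' \<in> borel_measurable borel" "AE x in lebesgue. u x = u' x"
  using completion_ex_borel_measurable_real[OF assms] unfolding AE_completion_iff by auto

text \<open>By Fubini, almost every \<open>x\<close> satisfies \<open>w y = w x\<close> for almost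
  all \<open>y\<close>. If \<open>w x\<close> were nonzero, almost every \<open>y\<close> would lie
  in a ball containing \<Omega>, although the space has infinite measure.\<close>

lemma AE_zero_of_AE_equal:
  fixes w :: "'a::euclidean_space \<Rightarrow> real"
  assumes w: "w \<in> borel_measurable lebesgue"
    and eq: "AE z in mu. w (fst z) = w (snd z)"
    and out: "AE x in lebesgue. x \<notin> \<Omega> \<longrightarrow> w x = 0" and \<Omega>: "bounded \<Omega>"
  shows "AE x in lebesgue. w x = 0"
proof -
  have "AE z in lebesgue. fst z \<noteq> snd z \<longrightarrow> w (fst z) = w (snd z)"
    using eq unfolding AE_mu_iff .
  then have "AE z in lborel \<Otimes>\<^sub>M lborel. fst z \<noteq> snd z \<longrightarrow> w (fst z) = w (snd z)"
    unfolding AE_completion_iff lborel_prod .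
  from lborel_pair.AE_pair[OF this]
  have *: "AE x in lborel. AE y in lborel. x \<noteq> y \<longrightarrow> w x = w y" by simp
  have out': "AE y in lborel. y \<notin> \<Omega> \<longrightarrow> w y = 0" using out unfolding AE_completion_iff .
  show ?thesis unfolding AE_completion_iff
    using *
  proof eventually_elim
    case (elim x)
    show ?case
    proof (rule ccontr)
      assume nz: "w x \<noteq> 0"
      obtain r where r: "insert x \<Omega> \<subseteq> ball 0 r" using \<Omega> bounded_subset_ballD[of "insert x \<Omega>" 0] by auto
      have "AE y :: 'a in lborel. y \<in> ball 0 r"
        using eventually_conj[OF elim out'] by (rule eventually_mono) (use nz r in auto)
      then have "emeasure lborel (UNIV - ball 0 r :: 'a set) = 0"
        by (subst (asm) AE_iff_measurable[OF _ refl]) (auto simp: set_diff_eq)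
      then have "UNIV - ball 0 r \<in> null_sets (lborel :: 'a measure)" by (intro null_setsI) auto
      then have "emeasure lborel (ball 0 r \<union> (UNIV - ball 0 r) :: 'a set) = emeasure lborel (ball 0 r :: 'a set)"
        by (intro emeasure_Un_null_set) auto
      then have "emeasure lborel (UNIV :: 'a set) = emeasure lborel (ball 0 r :: 'a set)"
        by (simp add: Un_Diff_cancel)
      moreover have "emeasure lborel (ball 0 r :: 'a set) < \<infinity>"
        by (rule emeasure_bounded_finite) auto
      ultimately show False by (simp add: emeasure_lborel_UNIV)
    qed
  qed
qed

definition slope :: "real \<Rightarrow> ('a::euclidean_space \<Rightarrow> real) \<Rightarrow> 'a \<times> 'a \<Rightarrow> real" where
  "slope s u = (\<lambda>(x, y). (u x - u y) / dist x y powr s)"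

lemma measurable_dist_powr [measurable]:
  "(\<lambda>z. dist (fst z) (snd z) powr s) \<in> borel_measurable (borel :: ('a::euclidean_space \<times> 'a) measure)"
  by (intro powr_real_measurable borel_measurable_continuous_onI continuous_intros)

lemma measurable_fst_borel: "fst \<in> borel \<rightarrow>\<^sub>M (borel :: 'a::euclidean_space measure)"
  and measurable_snd_borel: "snd \<in> borel \<rightarrow>\<^sub>M (borel :: 'a::euclidean_space measure)"
  by (intro borel_measurable_continuous_onI continuous_intros)+

lemma measurable_slope_borel [measurable]:
  assumes "u \<in> borel_measurable borel"
  shows "slope s u \<in> borel_measurable borel"
  unfolding slope_def split_beta
  by (intro borel_measurable_divide borel_measurable_diff measurable_dist_powr
      measurable_compose[OF measurable_fst_borel assms] measurable_compose[OF measurable_snd_borel assms])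

lemma measurable_slope [measurable]:
  assumes "u \<in> borel_measurable lebesgue"
  shows "slope s u \<in> borel_measurable lebesgue"
  unfolding slope_def split_beta
  by (intro borel_measurable_divide borel_measurable_diff measurable_lebesgueI[OF measurable_dist_powr]
      measurable_compose[OF measurable_fst_lebesgue assms] measurable_compose[OF measurable_snd_lebesgue assms])

lemma slope_add: "slope s (\<lambda>x. u x + v x) z = slope s u z + slope s v z"
  and slope_diff: "slope s (\<lambda>x. u x - v x) z = slope s u z - slope s v z"
  and slope_cmult: "slope s (\<lambda>x. c * u x) z = c * slope s u z"
  and slope_minus: "slope s (\<lambda>x. - u x) z = - slope s u z"
  by (auto simp: slope_def split_beta diff_divide_distrib add_divide_distrib right_diff_distrib)

lemma slope_cong_AE:
  assumes "AE x in lebesgue. u x = u' x"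
  shows "AE z in mu. slope s u z = slope s u' z"
  using AE_mu_pair[OF assms] by eventually_elim (simp add: slope_def split_beta)

lemma abs_slope_mono:
  assumes "\<bar>u (fst z) - u (snd z)\<bar> \<le> \<bar>v (fst z) - v (snd z)\<bar>"
  shows "\<bar>slope s u z\<bar> \<le> \<bar>slope s v z\<bar>"
  using assms by (auto simp: slope_def split_beta intro!: divide_right_mono)

section \<open>Fractional Orlicz-Sobolev functions\<close>

locale fractional_Orlicz_Sobolev = Clarkson_N_growth +
  fixes s :: real
  assumes s_pos: "0 < s" and s_less_1: "s < 1"
begin

abbreviation modular :: "('a::euclidean_space \<Rightarrow> real) \<Rightarrow> real" where
  "modular u \<equiv> (LINT z|mu. G (slope s u z))"

abbreviation W :: "('a::euclidean_space \<Rightarrow> real) set" where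
  "W \<equiv> W_space s G"

abbreviation W0 :: "'a::euclidean_space set \<Rightarrow> ('a \<Rightarrow> real) set" where
  "W0 \<equiv> W0_space s G"

lemma rho_sG_slope: "rho_sG s G u = (\<integral>\<^sup>+ z. ennreal (G (slope s u z)) \<partial>mu)"
  unfolding rho_sG_def slope_def split_beta
  by (intro nn_integral_cong arg_cong[where f = ennreal]) (metis G_abs abs_divide abs_of_nonneg powr_ge_zero)

lemma rho_G_alt: "rho_G G u = (\<integral>\<^sup>+ x. ennreal (G (u x)) \<partial>lebesgue)"
  by (simp add: rho_G_def)

lemma measurable_G_slope:
  "u \<in> borel_measurable lebesgue \<Longrightarrow> (\<lambda>z. G (slope s u z)) \<in> borel_measurable lebesgue"
  "u \<in> borel_measurable lebesgue \<Longrightarrow> (\<lambda>z. g (slope s u z)) \<in> borel_measurable lebesgue"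
  by (rule measurable_compose[OF measurable_slope measurable_G] measurable_compose[OF measurable_slope measurable_g], simp)+

lemma W_iff: "u \<in> W \<longleftrightarrow> u \<in> borel_measurable lebesgue \<and>
    integrable lebesgue (\<lambda>x. G (u x)) \<and> integrable mu (\<lambda>z. G (slope s u z))"
  unfolding W_space_def rho_sG_slope rho_G_alt
  by (auto simp: integrable_iff_bounded G_nonneg measurable_G_slope)

lemma W_measurable: "u \<in> W \<Longrightarrow> u \<in> borel_measurable lebesgue"
  and W_integrable: "u \<in> W \<Longrightarrow> integrable lebesgue (\<lambda>x. G (u x))"
  and W_integrable_slope: "u \<in> W \<Longrightarrow> integrable mu (\<lambda>z. G (slope s u z))"
  by (auto simp: W_iff)

lemma modular_nonneg: "0 \<le> modular u"
  by (intro integral_nonneg_AE AE_I2 G_nonneg)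

lemma rho_sG_eq_modular: "u \<in> W \<Longrightarrow> rho_sG s G u = ennreal (modular u)"
  unfolding rho_sG_slope by (intro nn_integral_eq_integral W_integrable_slope) (auto simp: G_nonneg)

lemma G_dominated: "\<bar>c\<bar> \<le> \<bar>a\<bar> + \<bar>b\<bar> \<Longrightarrow> G c \<le> 2 powr q * (G a + G b)"
  using G_mono[of c "\<bar>a\<bar> + \<bar>b\<bar>"] G_add[of "\<bar>a\<bar>" "\<bar>b\<bar>"] by simp

text \<open>Sum, difference and maximum of two functions satisfy both hypotheses, so a single
  domination argument closes \<open>W\<close> under all three.\<close>

lemma W_dominated:
  assumes u: "u \<in> W" and v: "v \<in> W" and w: "w \<in> borel_measurable lebesgue"
    and le: "\<And>x. \<bar>w x\<bar> \<le> \<bar>u x\<bar> + \<bar>v x\<bar>"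
    and diff: "\<And>x y. \<bar>w x - w y\<bar> \<le> \<bar>u x - u y\<bar> + \<bar>v x - v y\<bar>"
  shows "w \<in> W"
  unfolding W_iff
proof (intro conjI w)
  show "integrable lebesgue (\<lambda>x. G (w x))"
  proof (rule Bochner_Integration.integrable_bound)
    show "integrable lebesgue (\<lambda>x. 2 powr q * (G (u x) + G (v x)))" using u v by (simp add: W_iff)
    show "AE x in lebesgue. norm (G (w x)) \<le> norm (2 powr q * (G (u x) + G (v x)))"
      using G_dominated[OF le] G_nonneg by (intro AE_I2) (simp add: abs_mult)
  qed (use w in measurable)
  show "integrable mu (\<lambda>z. G (slope s w z))"
  proof (rule Bochner_Integration.integrable_bound)
    show "integrable mu (\<lambda>z. 2 powr q * (G (slope s u z) + G (slope s v z)))" using u v by (simp add: W_iff)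
    have "\<bar>slope s w z\<bar> \<le> \<bar>slope s u z\<bar> + \<bar>slope s v z\<bar>" for z
      using diff[of "fst z" "snd z"]
      by (simp add: slope_def split_beta add_divide_distrib[symmetric] divide_right_mono)
    then show "AE z in mu. norm (G (slope s w z)) \<le> norm (2 powr q * (G (slope s u z) + G (slope s v z)))"
      using G_dominated G_nonneg by (intro AE_I2) (simp add: abs_mult)
  qed (use w in \<open>simp add: measurable_G_slope\<close>)
qed

lemma W_add: "u \<in> W \<Longrightarrow> v \<in> W \<Longrightarrow> (\<lambda>x. u x + v x) \<in> W"
  by (rule W_dominated[of u v]) (auto dest!: W_measurable)

lemma W_diff: "u \<in> W \<Longrightarrow> v \<in> W \<Longrightarrow> (\<lambda>x. u x - v x) \<in> W"
  by (rule W_dominated[of u v]) (auto dest!: W_measurable)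

lemma W_max: "u \<in> W \<Longrightarrow> v \<in> W \<Longrightarrow> (\<lambda>x. max (u x) (v x)) \<in> W"
  by (rule W_dominated[of u v]) (auto dest!: W_measurable)

lemma W_0: "(\<lambda>x. 0) \<in> W"
  by (simp add: W_iff slope_def split_beta)

lemma W_cmult: "u \<in> W \<Longrightarrow> (\<lambda>x. c * u x) \<in> W"
proof -
  assume u: "u \<in> W"
  have m: "(\<lambda>x. c * u x) \<in> borel_measurable lebesgue" using W_measurable[OF u] by simp
  have b: "norm (G (c * t)) \<le> norm ((1 + \<bar>c\<bar>) powr q * G t)" for t
    using G_scale_bound[of c t] G_nonneg by (simp add: abs_mult)
  show ?thesis
    unfolding W_iff slope_cmult
  proof (intro conjI m)
    show "integrable lebesgue (\<lambda>x. G (c * u x))"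
      using b W_measurable[OF u]
      by (intro Bochner_Integration.integrable_bound[OF integrable_mult_right[OF W_integrable[OF u], of "(1 + \<bar>c\<bar>) powr q"]]) auto
    show "integrable mu (\<lambda>z. G (c * slope s u z))"
      using b measurable_slope[OF W_measurable[OF u]]
      by (intro Bochner_Integration.integrable_bound[OF integrable_mult_right[OF W_integrable_slope[OF u], of "(1 + \<bar>c\<bar>) powr q"]]) auto
  qed
qed

lemma W_minus: "u \<in> W \<Longrightarrow> (\<lambda>x. - u x) \<in> W"
  using W_cmult[of u "-1"] by simp

lemma W_cong_AE:
  assumes u: "u \<in> W" and eq: "AE x in lebesgue. u x = w x" and w: "w \<in> borel_measurable lebesgue"
  shows "w \<in> W"
  unfolding W_iff
proof (intro conjI w)
  show "integrable lebesgue (\<lambda>x. G (w x))"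
    by (rule integrable_cong_AE_imp[OF W_integrable[OF u]]) (use w eq in \<open>auto elim: eventually_mono\<close>)
  show "integrable mu (\<lambda>z. G (slope s w z))"
    by (rule integrable_cong_AE_imp[OF W_integrable_slope[OF u]])
       (use w slope_cong_AE[OF eq, of s] in \<open>auto simp: measurable_G_slope elim: eventually_mono\<close>)
qed

lemma W0_iff: "u \<in> W0 \<Omega> \<longleftrightarrow> u \<in> W \<and> (AE x in lebesgue. x \<notin> \<Omega> \<longrightarrow> u x = 0)"
  by (simp add: W0_space_def)

lemma W0_W: "u \<in> W0 \<Omega> \<Longrightarrow> u \<in> W"
  by (simp add: W0_iff)

lemma W0_0: "(\<lambda>x. 0) \<in> W0 \<Omega>"
  by (simp add: W0_iff W_0)

lemma W0_add: "u \<in> W0 \<Omega> \<Longrightarrow> v \<in> W0 \<Omega> \<Longrightarrow> (\<lambda>x. u x + v x) \<in> W0 \<Omega>"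
  and W0_diff: "u \<in> W0 \<Omega> \<Longrightarrow> v \<in> W0 \<Omega> \<Longrightarrow> (\<lambda>x. u x - v x) \<in> W0 \<Omega>"
  and W0_max: "u \<in> W0 \<Omega> \<Longrightarrow> v \<in> W0 \<Omega> \<Longrightarrow> (\<lambda>x. max (u x) (v x)) \<in> W0 \<Omega>"
  by (auto simp: W0_iff W_add W_diff W_max elim!: eventually_elim2)

lemma W0_cmult: "u \<in> W0 \<Omega> \<Longrightarrow> (\<lambda>x. c * u x) \<in> W0 \<Omega>"
  and W0_minus: "u \<in> W0 \<Omega> \<Longrightarrow> (\<lambda>x. - u x) \<in> W0 \<Omega>"
  by (auto simp: W0_iff W_cmult W_minus elim!: eventually_mono)

lemma frac_g_Laplacian_slope:
  "frac_g_Laplacian s g u v = (LINT z|mu. g (slope s u z) * slope s v z)"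
  by (simp add: frac_g_Laplacian_def slope_def split_beta')

lemma integrable_frac_g_Laplacian:
  assumes u: "u \<in> W" and v: "v \<in> W"
  shows "integrable mu (\<lambda>z. g (slope s u z) * slope s v z)"
proof (rule Bochner_Integration.integrable_bound)
  show "integrable mu (\<lambda>z. q * (G (slope s u z) + G (slope s v z)))"
    using u v by (simp add: W_iff)
  show "AE z in mu. norm (g (slope s u z) * slope s v z) \<le> norm (q * (G (slope s u z) + G (slope s v z)))"
    using young[of "slope s u _" "slope s v _"] unfolding real_norm_def
    by (intro AE_I2 order_trans[OF _ abs_ge_self])
  show "(\<lambda>z. g (slope s u z) * slope s v z) \<in> borel_measurable mu"
    using u v by (auto dest!: W_measurable simp: measurable_G_slope measurable_slope intro!: borel_measurable_times)
qed

lemma abs_frac_g_Laplacian_le: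
  assumes u: "u \<in> W" and v: "v \<in> W"
  shows "\<bar>frac_g_Laplacian s g u v\<bar> \<le> q * (modular u + modular v)"
proof -
  have "\<bar>frac_g_Laplacian s g u v\<bar> \<le> (LINT z|mu. q * (G (slope s u z) + G (slope s v z)))"
    unfolding frac_g_Laplacian_slope using u v young
    by (intro order_trans[OF integral_abs_bound] integral_mono integrable_abs integrable_frac_g_Laplacian)
       (auto simp: W_iff)
  then show ?thesis using u v by (simp add: W_iff)
qed

lemma frac_g_Laplacian_cmult: "frac_g_Laplacian s g u (\<lambda>x. c * v x) = c * frac_g_Laplacian s g u v"
  unfolding frac_g_Laplacian_slope slope_cmult by (simp add: mult.left_commute)

lemma frac_g_Laplacian_minus: "frac_g_Laplacian s g (\<lambda>x. - u x) v = - frac_g_Laplacian s g u v"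
  unfolding frac_g_Laplacian_slope slope_minus by (simp add: g_odd)

text \<open>If \<open>w x > w y\<close>, then \<open>w x\<close> is the full difference
  \<open>u x - v x\<close>, while \<open>u y - v y\<close> is at most \<open>w y\<close>; hence
  \<open>u\<close> has the larger jump and strict monotonicity of \<open>g\<close> makes both
  factors of \<open>h\<close> positive. Exchanging \<open>x\<close> and \<open>y\<close> changes the
  sign of both factors, which covers the opposite case.\<close>

lemma comparison_pointwise:
  fixes u v :: "'a::euclidean_space \<Rightarrow> real"
  defines "w \<equiv> \<lambda>x. max 0 (u x - v x)"
  defines "h \<equiv> \<lambda>z. (g (slope s u z) - g (slope s v z)) * slope s w z"
  shows "0 \<le> h z" and "h z = 0 \<Longrightarrow> w (fst z) = w (snd z)"
proof -
  obtain x y where z: "z = (x, y)" by (cases z)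
  have pos: "h (x, y) > 0" if "w x > w y" for x y
  proof -
    have "x \<noteq> y" using that by auto
    then have d: "dist x y powr s > 0" by simp
    have "u x - u y > v x - v y" using that by (auto simp: w_def max_def split: if_splits)
    then have "slope s u (x, y) > slope s v (x, y)" using d by (simp add: slope_def divide_strict_right_mono)
    moreover have "slope s w (x, y) > 0" using d that by (simp add: slope_def)
    ultimately show ?thesis unfolding h_def using g_strict_mono by simp
  qed
  have swap: "h (x, y) = h (y, x)"
  proof -
    have "slope s u (x, y) = - slope s u (y, x)" for u :: "'a \<Rightarrow> real"
      by (simp add: slope_def dist_commute diff_divide_distrib)
    then show ?thesis unfolding h_def by (simp add: g_odd algebra_simps)
  qed
  have eq: "h (x, y) = 0" if "w x = w y" using that by (simp add: h_def slope_def)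
  show "0 \<le> h z" using pos[of y x] pos[of x y] eq swap unfolding z by (cases "w x" "w y" rule: linorder_cases) auto
  show "w (fst z) = w (snd z)" if "h z = 0"
    using that pos[of y x] pos[of x y] swap unfolding z by (cases "w x" "w y" rule: linorder_cases) auto
qed

text \<open>The tested inequality says that the integral of a nonnegative function is at most 0. So
  this function vanishes, the positive part of \<open>u - v\<close> has no jumps, and being zero
  outside a bounded set it is zero.\<close>

lemma comparison:
  fixes u v :: "'a::euclidean_space \<Rightarrow> real"
  assumes u: "u \<in> W" and v: "v \<in> W" and \<Omega>: "bounded \<Omega>"
    and out: "AE x in lebesgue. x \<notin> \<Omega> \<longrightarrow> u x \<le> v x"
    and le: "frac_g_Laplacian s g u (\<lambda>x. max 0 (u x - v x)) \<le> frac_g_Laplacian s g v (\<lambda>x. max 0 (u x - v x))"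
  shows "AE x in lebesgue. u x \<le> v x"
proof -
  define w where "w = (\<lambda>x. max 0 (u x - v x))"
  define h where "h = (\<lambda>z. (g (slope s u z) - g (slope s v z)) * slope s w z)"
  have w: "w \<in> W" unfolding w_def by (intro W_max W_0 W_diff u v)
  have h_eq: "h = (\<lambda>z. g (slope s u z) * slope s w z - g (slope s v z) * slope s w z)"
    by (simp add: h_def algebra_simps)
  have int: "integrable mu h" unfolding h_eq by (intro Bochner_Integration.integrable_diff integrable_frac_g_Laplacian u v w)
  have nn: "AE z in mu. 0 \<le> h z" using comparison_pointwise(1)[where u = u and v = v] by (simp add: h_def w_def)
  have "integral\<^sup>L mu h \<le> 0"
    using le unfolding h_eq frac_g_Laplacian_slope w_def[symmetric]
    by (subst Bochner_Integration.integral_diff) (auto intro: integrable_frac_g_Laplacian u v w)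
  then have "integral\<^sup>L mu h = 0" using integral_nonneg_AE[OF nn] by simp
  then have "AE z in mu. h z = 0" using integral_nonneg_eq_0_iff_AE[OF int nn] by simp
  then have "AE z in mu. w (fst z) = w (snd z)"
    by eventually_elim (use comparison_pointwise(2)[where u = u and v = v] in \<open>simp add: h_def w_def\<close>)
  moreover have "AE x in lebesgue. x \<notin> \<Omega> \<longrightarrow> w x = 0"
    using out by eventually_elim (simp add: w_def)
  ultimately have "AE x in lebesgue. w x = 0"
    using AE_zero_of_AE_equal W_measurable[OF w] \<Omega> by blast
  then show ?thesis by eventually_elim (simp add: w_def max_def split: if_splits)
qed

end

section \<open>Poincare inequality and completeness\<close>

text \<open>Fatou's lemma in the form used throughout: the bounds may vary along the sequence as
  long as they converge, and may fail for the first \<open>N\<close> terms.\<close>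

lemma nn_integral_Fatou_bound:
  fixes F :: "nat \<Rightarrow> 'a \<Rightarrow> real" and c :: "nat \<Rightarrow> real"
  assumes [measurable]: "\<And>n. F n \<in> borel_measurable M"
    and lim: "AE x in M. (\<lambda>n. F n x) \<longlonglongrightarrow> f x"
    and le: "\<And>n. n \<ge> N \<Longrightarrow> (\<integral>\<^sup>+ x. ennreal (F n x) \<partial>M) \<le> ennreal (c n)"
    and c: "c \<longlonglongrightarrow> C"
  shows "(\<integral>\<^sup>+ x. ennreal (f x) \<partial>M) \<le> ennreal C"
proof -
  have "(\<integral>\<^sup>+ x. ennreal (f x) \<partial>M) = (\<integral>\<^sup>+ x. liminf (\<lambda>n. ennreal (F n x)) \<partial>M)"
  proof (rule nn_integral_cong_AE)
    show "AE x in M. ennreal (f x) = liminf (\<lambda>n. ennreal (F n x))"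
      using lim by eventually_elim (intro lim_imp_Liminf[symmetric] tendsto_ennrealI; simp)
  qed
  also have "\<dots> \<le> liminf (\<lambda>n. \<integral>\<^sup>+ x. ennreal (F n x) \<partial>M)"
    by (rule nn_integral_liminf) measurable
  also have "\<dots> \<le> liminf (\<lambda>n. ennreal (c n))"
    using le by (intro Liminf_mono) (auto simp: eventually_sequentially)
  also have "\<dots> = ennreal C"
    using c by (intro lim_imp_Liminf tendsto_ennrealI) auto
  finally show ?thesis .
qed

lemma slope_half_diff: "slope s (\<lambda>x. (u x - v x) / 2) z = (slope s u z - slope s v z) / 2"
  and slope_half_add: "slope s (\<lambda>x. (u x + v x) / 2) z = (slope s u z + slope s v z) / 2"
  by (simp_all add: slope_def split_beta diff_divide_distrib add_divide_distrib)

context fractional_Orlicz_Sobolev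
begin

lemma G_half_commute: "G ((a - b) / 2) = G ((b - a) / 2)"
  using G_even[of "(a - b) / 2"] by (simp add: minus_divide_left)

lemma W0_borel_representative:
  fixes u :: "'a::euclidean_space \<Rightarrow> real"
  assumes u: "u \<in> W0 \<Omega>" and \<Omega>: "open \<Omega>"
  obtains u' where "u' \<in> borel_measurable borel" "AE x in lebesgue. u x = u' x" "\<And>x. x \<notin> \<Omega> \<Longrightarrow> u' x = 0"
    "u' \<in> W0 \<Omega>"
proof -
  obtain v where v: "v \<in> borel_measurable borel" "AE x in lebesgue. u x = v x"
    using borel_representative[OF W_measurable[OF W0_W[OF u]]] by auto
  define u' where "u' = (\<lambda>x. indicator \<Omega> x * v x)"
  have m: "u' \<in> borel_measurable borel" unfolding u'_def using v \<Omega>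
    by (intro borel_measurable_times borel_measurable_indicator) auto
  have "AE x in lebesgue. x \<notin> \<Omega> \<longrightarrow> u x = 0" using u by (simp add: W0_iff)
  with v(2) have eq: "AE x in lebesgue. u x = u' x"
    by eventually_elim (auto simp: u'_def indicator_def)
  moreover have "u' \<in> W"
    using W_cong_AE[OF W0_W[OF u] eq] m by (simp add: measurable_lebesgueI)
  ultimately show ?thesis using that[of u'] m by (auto simp: u'_def W0_iff)
qed

lemma rho_sG_cong_AE:
  assumes "AE x in lebesgue. u x = u' x"
  shows "rho_sG s G u = rho_sG s G u'"
  unfolding rho_sG_slope
  by (intro nn_integral_cong_AE) (use slope_cong_AE[OF assms, of s] in \<open>auto elim: eventually_mono\<close>)

lemma rho_sG_iterated:
  fixes u :: "'a::euclidean_space \<Rightarrow> real"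
  assumes "u \<in> borel_measurable borel"
  shows "rho_sG s G u =
    (\<integral>\<^sup>+ x. \<integral>\<^sup>+ y. ennreal (1 / dist x y ^ DIM('a)) * ennreal (G ((u x - u y) / dist x y powr s)) \<partial>lborel \<partial>lborel)"
proof -
  have "(\<lambda>z. ennreal (G (slope s u z))) \<in> borel_measurable borel"
    by (rule measurable_compose[OF measurable_compose[OF measurable_slope_borel[OF assms] measurable_G] measurable_ennreal])
  from nn_integral_mu[OF this] show ?thesis by (simp add: rho_sG_slope slope_def)
qed

text \<open>Only the part of the energy with \<open>y\<close> in an annulus \<open>Z\<close> around
  \<Omega> is kept. There \<open>u y = 0\<close> and the distance to points of \<Omega> is bounded,
  so both the kernel and the difference quotient are bounded below.\<close>

lemma Poincare:
  fixes \<Omega> :: "'a::euclidean_space set"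
  assumes \<Omega>: "open \<Omega>" "bounded \<Omega>"
  obtains C where "0 \<le> C" "\<And>u. u \<in> W0 \<Omega> \<Longrightarrow> (LINT x|lebesgue. G (u x)) \<le> C * modular u"
proof -
  obtain R where R: "R > 0" "\<Omega> \<subseteq> ball 0 R"
    using \<Omega>(2) bounded_subset_ballD[of \<Omega> 0] by auto
  define Z where "Z = ball 0 (2 * R) - cball (0::'a) R"
  \<comment> \<open>Largest possible distance: \<open>x\<close> has norm below \<open>R\<close> and
    \<open>y\<close> norm below \<open>2 * R\<close>.\<close>
  define D where "D = 3 * R"
  have D: "D > 0" using R by (simp add: D_def)
  have Z_meas [measurable]: "Z \<in> sets borel" by (simp add: Z_def)
  define m where "m = measure lborel Z"
  have Z_fin: "emeasure lborel Z < \<infinity>"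
    unfolding Z_def by (intro emeasure_bounded_finite bounded_diff) auto
  have "Z \<notin> null_sets lborel"
  proof -
    obtain e :: 'a where e: "norm e = 1" using vector_choose_size[of 1] by auto
    have "(3 * R / 2) *\<^sub>R e \<in> Z" using R e by (simp add: Z_def)
    moreover have "open Z" unfolding Z_def by (intro open_Diff) auto
    ultimately have "\<not> negligible Z" using open_not_negligible by blast
    then show ?thesis using negligible_iff_null_sets null_sets_completionI by blast
  qed
  then have m: "m > 0" "emeasure lborel Z = ennreal m"
    using Z_fin by (auto simp: m_def null_sets_def zero_less_measure_iff emeasure_eq_ennreal_measure)
  define c where "c = m / D ^ DIM('a)"
  have c: "c > 0" using m D by (simp add: c_def)
  \<comment> \<open>The cost of undoing the division by \<open>D powr s\<close> inside
    \<open>G\<close>.\<close>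
  define K where "K = (1 + D powr s) powr q"
  have "(LINT x|lebesgue. G (u x)) \<le> K / c * modular u" if u: "u \<in> W0 \<Omega>" for u
  proof -
    obtain v where v [measurable]: "v \<in> borel_measurable borel" and eq: "AE x in lebesgue. u x = v x"
      and out: "\<And>x. x \<notin> \<Omega> \<Longrightarrow> v x = 0" and vW: "v \<in> W0 \<Omega>"
      using W0_borel_representative[OF u \<Omega>(1)] by blast
    have le: "ennreal (1 / D ^ DIM('a)) * ennreal (G (v x / D powr s)) * indicator Z y
        \<le> ennreal (1 / dist x y ^ DIM('a)) * ennreal (G ((v x - v y) / dist x y powr s))" for x y
    proof (cases "x \<in> \<Omega> \<and> y \<in> Z")
      case True
      then have xy: "norm x < R" "norm y < 2 * R" "R < norm y" using R by (auto simp: Z_def)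
      then have "dist x y \<le> D" using norm_triangle_ineq4[of x y] by (simp add: D_def dist_norm)
      moreover have "x \<noteq> y" using xy by auto
      then have d: "0 < dist x y" by simp
      ultimately have 1: "1 / D ^ DIM('a) \<le> 1 / dist x y ^ DIM('a)" and "dist x y powr s \<le> D powr s"
        using s_pos D by (auto intro!: divide_left_mono power_mono powr_mono2 mult_pos_pos)
      then have "G (v x / D powr s) \<le> G (v x / dist x y powr s)"
        using d D by (intro G_mono) (auto simp: abs_divide intro!: divide_left_mono)
      moreover have "v y = 0" using xy R(2) by (intro out) auto
      ultimately show ?thesis using 1 True by (auto intro!: mult_mono ennreal_leI)
    next
      case False
      then show ?thesis using out[of x] by (auto split: split_indicator)
    qed
    have "ennreal c * (\<integral>\<^sup>+ x. ennreal (G (v x / D powr s)) \<partial>lborel)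
        = (\<integral>\<^sup>+ x. ennreal (1 / D ^ DIM('a)) * ennreal (G (v x / D powr s)) * emeasure lborel Z \<partial>lborel)"
      using m D by (subst nn_integral_cmult[symmetric])
        (auto simp: c_def ennreal_mult'[symmetric] G_nonneg mult_ac ennreal_mult''[symmetric] intro!: nn_integral_cong)
    also have "\<dots> = (\<integral>\<^sup>+ x. \<integral>\<^sup>+ y. ennreal (1 / D ^ DIM('a)) * ennreal (G (v x / D powr s)) * indicator Z y \<partial>lborel \<partial>lborel)"
      by (intro nn_integral_cong) (simp add: nn_integral_cmult)
    also have "\<dots> \<le> rho_sG s G v"
      unfolding rho_sG_iterated[OF v] by (intro nn_integral_mono le)
    also have "\<dots> = ennreal (modular v)" by (rule rho_sG_eq_modular[OF W0_W[OF vW]])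
    finally have *: "ennreal c * (\<integral>\<^sup>+ x. ennreal (G (v x / D powr s)) \<partial>lborel) \<le> ennreal (modular v)" .
    have "ennreal (LINT x|lebesgue. G (v x)) = (\<integral>\<^sup>+ x. ennreal (G (v x)) \<partial>lborel)"
      using nn_integral_eq_integral[OF W_integrable[OF W0_W[OF vW]]] by (simp add: G_nonneg nn_integral_completion)
    also have "\<dots> \<le> (\<integral>\<^sup>+ x. ennreal K * ennreal (G (v x / D powr s)) \<partial>lborel)"
    proof (rule nn_integral_mono)
      fix x
      have "G (v x) \<le> K * G (v x / D powr s)"
        using G_scale_bound[of "D powr s" "v x / D powr s"] D by (simp add: K_def)
      then show "ennreal (G (v x)) \<le> ennreal K * ennreal (G (v x / D powr s))"
        by (simp add: ennreal_mult'[symmetric] K_def ennreal_leI)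
    qed
    also have "\<dots> = ennreal (K / c) * (ennreal c * (\<integral>\<^sup>+ x. ennreal (G (v x / D powr s)) \<partial>lborel))"
      using c by (subst nn_integral_cmult) (simp_all add: mult.assoc[symmetric] ennreal_mult'[symmetric] K_def)
    also have "\<dots> \<le> ennreal (K / c) * ennreal (modular v)" by (intro mult_left_mono *) auto
    finally have "(LINT x|lebesgue. G (v x)) \<le> K / c * modular v"
      using c modular_nonneg[of v] by (simp add: ennreal_mult'[symmetric] K_def)
    moreover have "(LINT x|lebesgue. G (v x)) = (LINT x|lebesgue. G (u x))"
      using eq W_measurable[OF W0_W[OF u]] W_measurable[OF W0_W[OF vW]]
      by (intro integral_cong_AE) (auto elim: eventually_mono)
    moreover have "ennreal (modular v) = ennreal (modular u)"
      using rho_sG_cong_AE[OF eq] u vW by (simp add: rho_sG_eq_modular W0_W)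
    then have "modular v = modular u" using modular_nonneg[of u] modular_nonneg[of v] by simp
    ultimately show ?thesis by simp
  qed
  moreover have "0 \<le> K / c" using c by (simp add: K_def)
  ultimately show ?thesis using that by blast
qed

lemma modular_Clarkson:
  assumes u: "u \<in> W" and v: "v \<in> W"
  shows "modular (\<lambda>x. (u x + v x) / 2) + modular (\<lambda>x. (u x - v x) / 2) \<le> (modular u + modular v) / 2"
proof -
  have eq: "slope s (\<lambda>x. (u x + v x) / 2) z = (slope s u z + slope s v z) / 2"
    "slope s (\<lambda>x. (u x - v x) / 2) z = (slope s u z - slope s v z) / 2" for z
    by (rule slope_half_add slope_half_diff)+
  have int: "integrable mu (\<lambda>z. G ((slope s u z + slope s v z) / 2))"
    "integrable mu (\<lambda>z. G ((slope s u z - slope s v z) / 2))"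
    unfolding eq[symmetric]
    using W_integrable_slope[OF W_cmult[OF W_add[OF u v], of "1/2"]]
      W_integrable_slope[OF W_cmult[OF W_diff[OF u v], of "1/2"]] by simp_all
  have "(LINT z|mu. G ((slope s u z + slope s v z) / 2) + G ((slope s u z - slope s v z) / 2))
      \<le> (LINT z|mu. (G (slope s u z) + G (slope s v z)) / 2)"
  proof (rule integral_mono)
    show "G ((slope s u z + slope s v z) / 2) + G ((slope s u z - slope s v z) / 2)
        \<le> (G (slope s u z) + G (slope s v z)) / 2" for z by (rule Clarkson)
  qed (use u v int in \<open>auto simp: W_iff\<close>)
  then show ?thesis using u v int by (simp add: eq W_iff)
qed

text \<open>What matters is that the exponent 2 exceeds 1: a linear functional tested with
  \<open>k * u\<close> loses a factor \<open>1 / k\<close>, and a factor \<open>k\<close> still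
  remains in front of the modular. This gives coercivity.\<close>

lemma modular_scale_small:
  assumes u: "u \<in> W" and k: "0 < k" "k \<le> 1"
  shows "modular (\<lambda>x. k * u x) \<le> k\<^sup>2 * modular u"
proof -
  have "G (k * t) \<le> k\<^sup>2 * G t" for t
  proof -
    have "G (k * t) \<le> k powr p * G t" using k by (rule G_scale_powr_small)
    also have "\<dots> \<le> k powr 2 * G t"
      using k two_lt_p by (intro mult_right_mono powr_mono' G_nonneg) auto
    finally show ?thesis using k by (simp add: powr_numeral)
  qed
  then have "modular (\<lambda>x. k * u x) \<le> (LINT z|mu. k\<^sup>2 * G (slope s u z))"
    using u W_cmult[OF u, of k] by (intro integral_mono) (auto simp: W_iff slope_cmult)
  then show ?thesis by simp
qed

lemma modular_scale_large:
  assumes u: "u \<in> W" and k: "1 \<le> k"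
  shows "modular (\<lambda>x. k * u x) \<le> k powr q * modular u"
proof -
  have "modular (\<lambda>x. k * u x) \<le> (LINT z|mu. k powr q * G (slope s u z))"
    using u W_cmult[OF u, of k] k by (intro integral_mono) (auto simp: W_iff slope_cmult G_scale_powr_large)
  then show ?thesis by simp
qed

lemma modular_tangent:
  assumes u: "u \<in> W" and v: "v \<in> W"
  shows "modular u + frac_g_Laplacian s g u (\<lambda>x. v x - u x) \<le> modular v"
proof -
  have "(LINT z|mu. G (slope s u z) + g (slope s u z) * slope s (\<lambda>x. v x - u x) z) \<le> modular v"
    using u v integrable_frac_g_Laplacian[OF u W_diff[OF v u]]
    by (intro integral_mono) (auto simp: W_iff slope_diff tangent)
  then show ?thesis
    using u integrable_frac_g_Laplacian[OF u W_diff[OF v u]] by (simp add: frac_g_Laplacian_slope W_iff)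
qed

lemma rho_G_eq_integral: "u \<in> W \<Longrightarrow> rho_G G u = ennreal (LINT x|lebesgue. G (u x))"
  unfolding rho_G_alt by (intro nn_integral_eq_integral W_integrable) (auto simp: G_nonneg)

text \<open>The rate \<open>\<epsilon>\<close> is fast enough for the Borel-Cantelli lemma.\<close>

lemma W0_complete:
  fixes u :: "nat \<Rightarrow> 'a::euclidean_space \<Rightarrow> real"
  assumes \<Omega>: "open \<Omega>" "bounded \<Omega>" and u: "\<And>n. u n \<in> W0 \<Omega>"
    and \<epsilon>: "\<And>n. \<epsilon> n \<le> (1/2) ^ n * G ((1/2) ^ n)" "\<epsilon> \<longlonglongrightarrow> 0"
    and Cauchy: "\<And>n m. n \<le> m \<Longrightarrow> modular (\<lambda>x. (u n x - u m x) / 2) \<le> \<epsilon> n"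
  obtains v where "v \<in> W0 \<Omega>" "AE x in lebesgue. (\<lambda>n. u n x) \<longlonglongrightarrow> v x"
    "(\<lambda>n. modular (\<lambda>x. (v x - u n x) / 2)) \<longlonglongrightarrow> 0"
proof -
  obtain C where C: "0 \<le> C" "\<And>u. u \<in> W0 \<Omega> \<Longrightarrow> (LINT x|lebesgue. G (u x)) \<le> C * modular u"
    using Poincare[OF \<Omega>] by blast
  have uW: "u n \<in> W" for n using u W0_W by blast
  have meas [measurable]: "u n \<in> borel_measurable lebesgue" for n using W_measurable[OF uW] .
  have half: "(\<lambda>x. (u n x - u m x) / 2) \<in> W0 \<Omega>" for n m
    using W0_cmult[OF W0_diff[OF u u], of "1/2" n m] by simp
  \<comment> \<open>Chebyshev's inequality for \<open>G\<close> and the Poincare inequality bound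
    the measure of this set of large consecutive differences by a multiple of
    \<open>(1/2) ^ n\<close>, which is summable.\<close>
  define A where "A n = {x. (1/2) ^ n \<le> \<bar>(u n x - u (Suc n) x) / 2\<bar>}" for n
  have A_sets [measurable]: "A n \<in> sets lebesgue" for n
    using borel_measurable_le[of "\<lambda>_. (1/2) ^ n" lebesgue "\<lambda>x. \<bar>(u n x - u (Suc n) x) / 2\<bar>"]
    by (simp add: A_def)
  have A_le: "emeasure lebesgue (A n) \<le> ennreal (C * (1/2) ^ n)" for n
  proof -
    have "ennreal (G ((1/2) ^ n)) * emeasure lebesgue (A n)
        = (\<integral>\<^sup>+ x. ennreal (G ((1/2) ^ n)) * indicator (A n) x \<partial>lebesgue)"
      by (simp add: nn_integral_cmult)
    also have "\<dots> \<le> rho_G G (\<lambda>x. (u n x - u (Suc n) x) / 2)"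
      unfolding rho_G_alt
      by (intro nn_integral_mono) (auto simp: A_def split: split_indicator intro!: ennreal_leI G_mono)
    also have "\<dots> \<le> ennreal (C * \<epsilon> n)"
      using C(2)[OF half, of n "Suc n"] mult_left_mono[OF Cauchy[of n "Suc n"] C(1)]
      by (simp add: rho_G_eq_integral W0_W[OF half] ennreal_leI)
    also have "\<dots> \<le> ennreal (G ((1/2) ^ n)) * ennreal (C * (1/2) ^ n)"
      using mult_left_mono[OF \<epsilon>(1)[of n] C(1)] C(1)
      by (simp add: ennreal_mult'[symmetric] G_nonneg ennreal_leI mult_ac)
    finally show ?thesis
      using G_pos[of "(1/2) ^ n"] by (subst (asm) ennreal_mult_le_mult_iff) (auto simp: ennreal_eq_0_iff not_le)
  qed
  have "AE x in lebesgue. eventually (\<lambda>n. x \<in> space lebesgue - A n) sequentially"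
  proof (rule borel_cantelli_AE1)
    show "emeasure lebesgue (A n) < \<infinity>" for n using le_less_trans[OF A_le[of n]] by simp
    have "measure lebesgue (A n) \<le> C * (1/2) ^ n" for n
      using A_le[of n] C(1) by (simp add: measure_def enn2real_leI)
    moreover have "summable (\<lambda>n. C * (1/2) ^ n)" by (intro summable_mult summable_geometric) simp
    ultimately show "summable (\<lambda>n. measure lebesgue (A n))"
      using summable_comparison_test'[of "\<lambda>n. C * (1/2) ^ n" 0 "\<lambda>n. measure lebesgue (A n)"] by simp
  qed simp
  then have conv: "AE x in lebesgue. convergent (\<lambda>n. u n x)"
  proof eventually_elim
    case (elim x)
    then obtain N where N: "\<And>n. n \<ge> N \<Longrightarrow> x \<notin> A n" unfolding eventually_sequentially by blast
    have "summable (\<lambda>n. u (Suc n) x - u n x)"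
    proof (rule summable_comparison_test')
      show "summable (\<lambda>n. 2 * (1/2) ^ n :: real)" by (intro summable_mult summable_geometric) simp
      show "norm (u (Suc n) x - u n x) \<le> 2 * (1/2) ^ n" if "n \<ge> N" for n
        using N[OF that] by (auto simp: A_def)
    qed
    then have "convergent (\<lambda>n. (\<Sum>i<n. u (Suc i) x - u i x))" by (simp add: summable_iff_convergent)
    then have "convergent (\<lambda>n. u n x - u 0 x)" using sum_lessThan_telescope[of "\<lambda>i. u i x"] by simp
    then have "convergent (\<lambda>n. (u n x - u 0 x) + u 0 x)" by (intro convergent_add convergent_const)
    then show ?case by simp
  qed
  define v where "v = (\<lambda>x. lim (\<lambda>n. u n x))"
  have lim: "AE x in lebesgue. (\<lambda>n. u n x) \<longlonglongrightarrow> v x"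
    using conv by eventually_elim (simp only: v_def convergent_LIMSEQ_iff)
  have v_meas [measurable]: "v \<in> borel_measurable lebesgue" unfolding v_def by measurable
  have slope_lim: "AE z in mu. (\<lambda>n. slope s (u n) z) \<longlonglongrightarrow> slope s v z"
    using AE_mu_pair[OF lim] 
    unfolding slope_def split_beta divide_inverse by eventually_elim (intro tendsto_intros; simp)
  have cG: "isCont G t" for t using cont_G by (simp add: continuous_on_eq_continuous_at)
  \<comment> \<open>Fatou in \<open>m\<close> with \<open>n\<close> fixed turns the Cauchy bound
    into a rate of convergence towards \<open>v\<close>.\<close>
  have dist: "(\<integral>\<^sup>+ z. ennreal (G (slope s (\<lambda>x. (v x - u n x) / 2) z)) \<partial>mu) \<le> ennreal (\<epsilon> n)" for n
  proof (rule nn_integral_Fatou_bound)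
    show "AE z in mu. (\<lambda>m. G (slope s (\<lambda>x. (u m x - u n x) / 2) z)) \<longlonglongrightarrow> G (slope s (\<lambda>x. (v x - u n x) / 2) z)"
      using slope_lim unfolding slope_half_diff
      by eventually_elim (intro isCont_tendsto_compose[OF cG] tendsto_intros; simp)
    show "(\<integral>\<^sup>+ z. ennreal (G (slope s (\<lambda>x. (u m x - u n x) / 2) z)) \<partial>mu) \<le> ennreal (\<epsilon> n)" if "m \<ge> n" for m
    proof -
      have "G (slope s (\<lambda>x. (u m x - u n x) / 2) z) = G (slope s (\<lambda>x. (u n x - u m x) / 2) z)" for z
        unfolding slope_half_diff by (rule G_half_commute)
      then show ?thesis
        using Cauchy[OF that] rho_sG_eq_modular[OF W0_W[OF half], of n m]
        by (simp add: rho_sG_slope ennreal_leI)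
    qed
  qed (auto intro!: measurable_G_slope)
  \<comment> \<open>Fatou controls differences only, so the half difference to \<open>u 0\<close> is
    placed in \<open>W\<close> first and \<open>v\<close> is recovered from it linearly.\<close>
  have v0W: "(\<lambda>x. (v x - u 0 x) / 2) \<in> W"
    unfolding W_space_def
  proof (safe)
    show "rho_sG s G (\<lambda>x. (v x - u 0 x) / 2) < \<infinity>"
      using dist[of 0] by (simp add: rho_sG_slope le_less_trans)
    have "rho_G G (\<lambda>x. (v x - u 0 x) / 2) \<le> ennreal (C * \<epsilon> 0)"
      unfolding rho_G_alt
    proof (rule nn_integral_Fatou_bound)
      show "AE x in lebesgue. (\<lambda>m. G ((u m x - u 0 x) / 2)) \<longlonglongrightarrow> G ((v x - u 0 x) / 2)"
        using lim by eventually_elim (intro isCont_tendsto_compose[OF cG] tendsto_intros; simp)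
      show "(\<integral>\<^sup>+ x. ennreal (G ((u m x - u 0 x) / 2)) \<partial>lebesgue) \<le> ennreal (C * \<epsilon> 0)" for m
      proof -
        have "G ((u m x - u 0 x) / 2) = G ((u 0 x - u m x) / 2)" for x
          by (rule G_half_commute)
        then show ?thesis
          using C(2)[OF half, of 0 m] mult_left_mono[OF Cauchy[of 0 m] C(1)] rho_G_eq_integral[OF W0_W[OF half], of 0 m]
          by (simp add: rho_G_alt ennreal_leI)
      qed
    qed auto
    then show "rho_G G (\<lambda>x. (v x - u 0 x) / 2) < \<infinity>" by (simp add: le_less_trans)
  qed measurable
  have "(\<lambda>x. 2 * ((v x - u 0 x) / 2) + u 0 x) \<in> W" by (intro W_add W_cmult v0W uW)
  moreover have "(\<lambda>x. 2 * ((v x - u 0 x) / 2) + u 0 x) = v" by (rule ext) (simp add: field_simps)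
  ultimately have vW: "v \<in> W" by simp
  have "AE x in lebesgue. \<forall>n. x \<notin> \<Omega> \<longrightarrow> u n x = 0"
    unfolding AE_all_countable using u by (simp only: W0_iff) simp
  with lim have "AE x in lebesgue. x \<notin> \<Omega> \<longrightarrow> v x = 0"
  proof eventually_elim
    case (elim x)
    show ?case
    proof
      assume "x \<notin> \<Omega>"
      then have "u n x = 0" for n using elim(2) by simp
      with elim(1) show "v x = 0" by (simp add: LIMSEQ_const_iff)
    qed
  qed
  then have v: "v \<in> W0 \<Omega>" using vW by (simp add: W0_iff)
  have "(\<lambda>x. (v x - u n x) / 2) \<in> W" for n
    using W_cmult[OF W_diff[OF vW uW], of "1/2" n] by simp
  then have "modular (\<lambda>x. (v x - u n x) / 2) \<le> max 0 (\<epsilon> n)" for n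
    using dist[of n] unfolding rho_sG_slope[symmetric] by (auto simp: rho_sG_eq_modular ennreal_le_iff2 max_def)
  moreover have "(\<lambda>n. max 0 (\<epsilon> n)) \<longlonglongrightarrow> 0"
    using tendsto_max[OF tendsto_const \<epsilon>(2), of 0] by simp
  ultimately have "(\<lambda>n. modular (\<lambda>x. (v x - u n x) / 2)) \<longlonglongrightarrow> 0"
    using tendsto_sandwich[of "\<lambda>_. 0" "\<lambda>n. modular (\<lambda>x. (v x - u n x) / 2)" sequentially "\<lambda>n. max 0 (\<epsilon> n)" 0]
    by (simp add: modular_nonneg)
  then show ?thesis by (rule that[OF v lim])
qed

end

section \<open>Equations with a given dual right-hand side\<close>

context fractional_Orlicz_Sobolev
begin

text \<open>The solution of the linear-dual problem minimises \<open>modular u - L u\<close>; by the Clarkson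
  inequality a minimising sequence is Cauchy in modular, so no weak compactness is needed.\<close>

lemma exists_dual_solution:
  fixes \<Omega> :: "'a::euclidean_space set" and L :: "('a \<Rightarrow> real) \<Rightarrow> real"
  assumes \<Omega>: "open \<Omega>" "bounded \<Omega>"
    and add: "\<And>u v. u \<in> W0 \<Omega> \<Longrightarrow> v \<in> W0 \<Omega> \<Longrightarrow> L (\<lambda>x. u x + v x) = L u + L v"
    and cmult: "\<And>c u. u \<in> W0 \<Omega> \<Longrightarrow> L (\<lambda>x. c * u x) = c * L u"
    and bound: "\<And>v. v \<in> W0 \<Omega> \<Longrightarrow> \<bar>L v\<bar> \<le> K * (1 + modular v)"
  obtains u where "u \<in> W0 \<Omega>" "\<And>v. v \<in> W0 \<Omega> \<Longrightarrow> frac_g_Laplacian s g u v = L v"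
proof -
  define M where "M = max 1 K"
  have M: "M \<ge> 1" by (simp add: M_def)
  have bound_M: "\<bar>L v\<bar> \<le> M * (1 + modular v)" if "v \<in> W0 \<Omega>" for v
  proof -
    have "K * (1 + modular v) \<le> M * (1 + modular v)"
      using modular_nonneg[of v] by (intro mult_right_mono) (auto simp: M_def)
    then show ?thesis using bound[OF that] by linarith
  qed
  \<comment> \<open>Linearity turns the one affine bound into a family: small \<open>k\<close> will
    give coercivity, large \<open>k\<close> continuity along sequences that converge in
    modular.\<close>
  have scaled: "\<bar>L v\<bar> \<le> M / k * (1 + modular (\<lambda>x. k * v x))" if v: "v \<in> W0 \<Omega>" and k: "k > 0" for v k
    using bound_M[OF W0_cmult[OF v, of k]] cmult[OF v, of k] k by (simp add: abs_mult field_simps)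
  define J where "J u = modular u - L u" for u
  have coercive: "modular v / 2 - 2 * M\<^sup>2 \<le> J v" if v: "v \<in> W0 \<Omega>" for v
  proof -
    \<comment> \<open>Chosen such that the coefficient \<open>M * k\<close> of the modular becomes
      \<open>1/2\<close>.\<close>
    define k where "k = 1 / (2 * M)"
    have k: "0 < k" "k \<le> 1" using M by (auto simp: k_def)
    have "\<bar>L v\<bar> \<le> M / k * (1 + modular (\<lambda>x. k * v x))" by (rule scaled[OF v k(1)])
    also have "\<dots> \<le> M / k * (1 + k\<^sup>2 * modular v)"
      using modular_scale_small[OF W0_W[OF v] k] M k by (intro mult_left_mono) auto
    also have "\<dots> = M / k + (M * k) * modular v" using k by (simp add: field_simps power2_eq_square)
    also have "\<dots> = 2 * M\<^sup>2 + modular v / 2" using M by (simp add: k_def power2_eq_square)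
    finally show ?thesis by (simp add: J_def abs_le_iff)
  qed
  have bdd: "bdd_below (J ` W0 \<Omega>)"
  proof (rule bdd_belowI2)
    show "- (2 * M\<^sup>2) \<le> J v" if "v \<in> W0 \<Omega>" for v
      using coercive[OF that] modular_nonneg[of v] by linarith
  qed
  define m where "m = Inf (J ` W0 \<Omega>)"
  have m_le: "m \<le> J v" if "v \<in> W0 \<Omega>" for v
    unfolding m_def using that by (intro cInf_lower bdd) auto
  define \<epsilon> where "\<epsilon> n = (1/2) ^ n * G ((1/2) ^ n)" for n :: nat
  have \<epsilon>_pos: "\<epsilon> n > 0" for n by (simp add: \<epsilon>_def G_pos)
  have \<epsilon>_dec: "\<epsilon> k \<le> \<epsilon> n" if "n \<le> k" for n k
    unfolding \<epsilon>_def using that by (intro mult_mono power_decreasing G_mono) (auto simp: G_nonneg power_decreasing)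
  have \<epsilon>_0: "\<epsilon> \<longlonglongrightarrow> 0"
  proof -
    have "(\<lambda>n. (1/2) ^ n * G 1 :: real) \<longlonglongrightarrow> 0 * G 1" by (intro tendsto_intros LIMSEQ_realpow_zero) auto
    moreover have "\<epsilon> n \<le> (1/2) ^ n * G 1" for n
      unfolding \<epsilon>_def by (intro mult_left_mono G_mono) (auto simp: power_le_one)
    ultimately show ?thesis
      using tendsto_sandwich[of "\<lambda>_. 0" \<epsilon> sequentially "\<lambda>n. (1/2) ^ n * G 1" 0] less_imp_le[OF \<epsilon>_pos] by simp
  qed
  have "\<exists>v\<in>W0 \<Omega>. J v < m + \<epsilon> n" for n
    using cInf_lessD[of "J ` W0 \<Omega>" "m + \<epsilon> n"] \<epsilon>_pos[of n] W0_0[of \<Omega>] by (auto simp: m_def)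
  then obtain u where u: "\<And>n. u n \<in> W0 \<Omega>" and J_u: "\<And>n. J (u n) < m + \<epsilon> n" by metis
  \<comment> \<open>The value of \<open>J\<close> at the midpoint is at least \<open>m\<close>,
    while both end points are almost minimal; Clarkson's inequality leaves only the small gap for
    the half difference.\<close>
  have Cauchy: "modular (\<lambda>x. (u n x - u k x) / 2) \<le> \<epsilon> n" if "n \<le> k" for n k
  proof -
    have mid: "(\<lambda>x. (u n x + u k x) / 2) \<in> W0 \<Omega>"
      using W0_cmult[OF W0_add[OF u u], of "1/2" n k] by simp
    have "L (\<lambda>x. (u n x + u k x) / 2) = (L (u n) + L (u k)) / 2"
      using cmult[OF W0_add[OF u u], of "1/2" n k] add[OF u u, of n k] by simp
    then have "J (\<lambda>x. (u n x + u k x) / 2) + modular (\<lambda>x. (u n x - u k x) / 2) \<le> (J (u n) + J (u k)) / 2"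
      using modular_Clarkson[OF W0_W[OF u] W0_W[OF u], of n k] by (simp add: J_def field_simps)
    then show ?thesis using m_le[OF mid] J_u[of n] J_u[of k] \<epsilon>_dec[OF that] by simp
  qed
  obtain v where v: "v \<in> W0 \<Omega>" and lim: "AE x in lebesgue. (\<lambda>n. u n x) \<longlonglongrightarrow> v x"
    and conv: "(\<lambda>n. modular (\<lambda>x. (v x - u n x) / 2)) \<longlonglongrightarrow> 0"
    by (rule W0_complete[OF \<Omega> u _ \<epsilon>_0 Cauchy]) (auto simp: \<epsilon>_def)
  have L_lim: "(\<lambda>n. L (u n)) \<longlonglongrightarrow> L v"
  proof (rule LIMSEQ_I)
    fix r :: real assume r: "r > 0"
    \<comment> \<open>With \<open>k > 4 * M / r\<close>, the bound \<open>M / k * (1 + 1)\<close>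
      drops below \<open>r\<close> as soon as the scaled difference has modular less than 1.\<close>
    define k where "k = 4 * M / r + 1"
    have "0 \<le> 4 * M / r" using M r by simp
    then have k: "k \<ge> 1" "k > 0" by (auto simp: k_def)
    have Mk: "M / k < r / 4" using M r k by (simp add: k_def field_simps)
    have "(\<lambda>n. (2 * k) powr q * modular (\<lambda>x. (v x - u n x) / 2)) \<longlonglongrightarrow> (2 * k) powr q * 0"
      by (intro tendsto_mult tendsto_const conv)
    then have "eventually (\<lambda>n. (2 * k) powr q * modular (\<lambda>x. (v x - u n x) / 2) < 1) sequentially"
      by (rule order_tendstoD) simp
    then obtain N where N: "\<And>n. n \<ge> N \<Longrightarrow> (2 * k) powr q * modular (\<lambda>x. (v x - u n x) / 2) < 1"
      unfolding eventually_sequentially by blast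
    have "norm (L (u n) - L v) < r" if "n \<ge> N" for n
    proof -
      have d: "(\<lambda>x. v x - u n x) \<in> W0 \<Omega>" by (intro W0_diff v u)
      have h: "(\<lambda>x. (v x - u n x) / 2) \<in> W0 \<Omega>" using W0_cmult[OF d, of "1/2"] by simp
      have "L (\<lambda>x. v x - u n x) = L v - L (u n)"
        using add[OF v W0_minus[OF u], of n] cmult[OF u, of "-1" n] by simp
      then have "norm (L (u n) - L v) = \<bar>L (\<lambda>x. v x - u n x)\<bar>" by simp
      also have "\<dots> \<le> M / k * (1 + modular (\<lambda>x. k * (v x - u n x)))" by (rule scaled[OF d k(2)])
      also have "modular (\<lambda>x. k * (v x - u n x)) \<le> (2 * k) powr q * modular (\<lambda>x. (v x - u n x) / 2)"
        using modular_scale_large[OF W0_W[OF h], of "2 * k"] k by simp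
      then have "M / k * (1 + modular (\<lambda>x. k * (v x - u n x))) \<le> M / k * (1 + 1)"
        using N[OF that] M k by (intro mult_left_mono) auto
      also have "\<dots> = 2 * (M / k)" by simp
      also have "\<dots> < r" using Mk r by linarith
      finally show ?thesis .
    qed
    then show "\<exists>no. \<forall>n\<ge>no. norm (L (u n) - L v) < r" by blast
  qed
  have "modular v \<le> m + L v"
  proof -
    have meas: "(\<lambda>z. G (slope s (u n) z)) \<in> borel_measurable mu" for n
      using W_measurable[OF W0_W[OF u]] by (simp add: measurable_G_slope)
    have cG: "isCont G t" for t using cont_G by (simp add: continuous_on_eq_continuous_at)
    have "AE z in mu. (\<lambda>n. slope s (u n) z) \<longlonglongrightarrow> slope s v z"
      using AE_mu_pair[OF lim] unfolding slope_def split_beta divide_inverse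
      by eventually_elim (intro tendsto_intros; simp)
    then have sl: "AE z in mu. (\<lambda>n. G (slope s (u n) z)) \<longlonglongrightarrow> G (slope s v z)"
      by eventually_elim (rule isCont_tendsto_compose[OF cG])
    have le: "(\<integral>\<^sup>+ z. ennreal (G (slope s (u n) z)) \<partial>mu) \<le> ennreal (m + \<epsilon> n + L (u n))" for n
      unfolding rho_sG_slope[symmetric] rho_sG_eq_modular[OF W0_W[OF u]]
      using J_u[of n] by (intro ennreal_leI) (simp add: J_def)
    have c: "(\<lambda>n. m + \<epsilon> n + L (u n)) \<longlonglongrightarrow> m + L v"
      using tendsto_add[OF tendsto_add[OF tendsto_const \<epsilon>_0] L_lim, of m] by simp
    have "ennreal (modular v) \<le> ennreal (m + L v)"
      unfolding rho_sG_eq_modular[OF W0_W[OF v], symmetric] rho_sG_slope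
      by (rule nn_integral_Fatou_bound[OF meas sl le c])
    \<comment> \<open>Negative reals are sent to 0 by \<open>ennreal\<close>, so the inequality
      returns to the reals only with a nonnegative right-hand side.\<close>
    moreover have "0 \<le> m + L v"
    proof (rule LIMSEQ_le_const[OF c])
      show "\<exists>N. \<forall>n\<ge>N. 0 \<le> m + \<epsilon> n + L (u n)"
        using J_u modular_nonneg unfolding J_def by (metis add.commute diff_less_eq less_imp_le order_trans)
    qed
    ultimately show ?thesis by (simp add: ennreal_le_iff)
  qed
  then have min: "J v \<le> J w" if "w \<in> W0 \<Omega>" for w
    using m_le[OF that] by (simp add: J_def)
  \<comment> \<open>One inequality suffices because \<open>w\<close> may be replaced by its
    negative. The tangent is taken at the perturbed function \<open>v + t * w\<close> and compared
    with the minimiser \<open>v\<close>, so the modular is never differentiated; \<open>t\<close>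
    tends to 0 only in the operator, by dominated convergence.\<close>
  have ge: "L w \<le> frac_g_Laplacian s g v w" if w: "w \<in> W0 \<Omega>" for w
  proof -
    have step: "L w \<le> frac_g_Laplacian s g (\<lambda>x. v x + t * w x) w" if t: "t > 0" for t
    proof -
      have tw: "(\<lambda>x. v x + t * w x) \<in> W0 \<Omega>" by (intro W0_add W0_cmult v w)
      have "modular (\<lambda>x. v x + t * w x) + frac_g_Laplacian s g (\<lambda>x. v x + t * w x) (\<lambda>x. v x - (v x + t * w x)) \<le> modular v"
        by (rule modular_tangent[OF W0_W[OF tw] W0_W[OF v]])
      moreover have "(\<lambda>x. v x - (v x + t * w x)) = (\<lambda>x. (- t) * w x)" by auto
      ultimately have "modular (\<lambda>x. v x + t * w x) - t * frac_g_Laplacian s g (\<lambda>x. v x + t * w x) w \<le> modular v"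
        using frac_g_Laplacian_cmult[of "\<lambda>x. v x + t * w x" "- t" w] by simp
      moreover have "L (\<lambda>x. v x + t * w x) = L v + t * L w"
        using add[OF v W0_cmult[OF w]] cmult[OF w] by simp
      ultimately have "t * L w \<le> t * frac_g_Laplacian s g (\<lambda>x. v x + t * w x) w"
        using min[OF tw] by (simp add: J_def)
      then show ?thesis using t by simp
    qed
    have "(\<lambda>n. frac_g_Laplacian s g (\<lambda>x. v x + inverse (real (Suc n)) * w x) w) \<longlonglongrightarrow> frac_g_Laplacian s g v w"
      unfolding frac_g_Laplacian_slope
    proof (rule integral_dominated_convergence[where w = "\<lambda>z. q * (2 powr q * (G (slope s v z) + G (slope s w z)) + G (slope s w z))"])
      have vW: "v \<in> W" and wW: "w \<in> W" using v w W0_W by auto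
      show "(\<lambda>z. g (slope s v z) * slope s w z) \<in> borel_measurable mu"
        using borel_measurable_integrable[OF integrable_frac_g_Laplacian[OF vW wW]] .
      show "(\<lambda>z. g (slope s (\<lambda>x. v x + inverse (real (Suc n)) * w x) z) * slope s w z) \<in> borel_measurable mu" for n
        by (intro borel_measurable_integrable integrable_frac_g_Laplacian W_add W_cmult vW wW)
      show "integrable mu (\<lambda>z. q * (2 powr q * (G (slope s v z) + G (slope s w z)) + G (slope s w z)))"
        using W_integrable_slope[OF vW] W_integrable_slope[OF wW] by simp
      have cg: "isCont g t" for t using cont_g by (simp add: continuous_on_eq_continuous_at)
      show "AE z in mu. (\<lambda>n. g (slope s (\<lambda>x. v x + inverse (real (Suc n)) * w x) z) * slope s w z)
          \<longlonglongrightarrow> g (slope s v z) * slope s w z"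
      proof (rule AE_I2)
        fix z
        have "(\<lambda>n. slope s v z + inverse (real (Suc n)) * slope s w z) \<longlonglongrightarrow> slope s v z + 0 * slope s w z"
          by (intro tendsto_intros LIMSEQ_inverse_real_of_nat)
        then have "(\<lambda>n. slope s v z + inverse (real (Suc n)) * slope s w z) \<longlonglongrightarrow> slope s v z" by simp
        then show "(\<lambda>n. g (slope s (\<lambda>x. v x + inverse (real (Suc n)) * w x) z) * slope s w z) \<longlonglongrightarrow> g (slope s v z) * slope s w z"
          unfolding slope_add slope_cmult by (intro tendsto_mult tendsto_const isCont_tendsto_compose[OF cg])
      qed
      fix n
      show "AE z in mu. norm (g (slope s (\<lambda>x. v x + inverse (real (Suc n)) * w x) z) * slope s w z)
          \<le> q * (2 powr q * (G (slope s v z) + G (slope s w z)) + G (slope s w z))"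
      proof (rule AE_I2)
        fix z
        define t where "t = inverse (real (Suc n))"
        have t: "0 \<le> t" "t \<le> 1" by (auto simp: t_def divide_simps)
        have "\<bar>slope s v z + t * slope s w z\<bar> \<le> \<bar>slope s v z\<bar> + \<bar>slope s w z\<bar>"
          using t mult_right_mono[OF t(2), of "\<bar>slope s w z\<bar>"] by (simp add: abs_mult order_trans[OF abs_triangle_ineq])
        then have "G (slope s v z + t * slope s w z) \<le> 2 powr q * (G (slope s v z) + G (slope s w z))"
          by (rule G_dominated)
        then have "q * (G (slope s v z + t * slope s w z) + G (slope s w z))
            \<le> q * (2 powr q * (G (slope s v z) + G (slope s w z)) + G (slope s w z))"
          using q_gt_1 by (intro mult_left_mono) auto
        with young[of "slope s v z + t * slope s w z" "slope s w z"]
        show "norm (g (slope s (\<lambda>x. v x + inverse (real (Suc n)) * w x) z) * slope s w z)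
            \<le> q * (2 powr q * (G (slope s v z) + G (slope s w z)) + G (slope s w z))"
          unfolding slope_add slope_cmult t_def[symmetric] real_norm_def by linarith
      qed
    qed
    then show ?thesis by (rule LIMSEQ_le_const) (use step in auto)
  qed
  have "frac_g_Laplacian s g v w = L w" if w: "w \<in> W0 \<Omega>" for w
  proof (rule antisym)
    have "L (\<lambda>x. (-1) * w x) \<le> frac_g_Laplacian s g v (\<lambda>x. (-1) * w x)"
      by (intro ge W0_cmult w)
    then show "frac_g_Laplacian s g v w \<le> L w"
      unfolding cmult[OF w] frac_g_Laplacian_cmult by simp
  qed (rule ge[OF w])
  then show ?thesis by (rule that[OF v])
qed

end

section \<open>The Orlicz-Sobolev conjugate\<close>

locale Sobolev_conjugate = N_growth +
  fixes n :: nat and s :: real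
  assumes s_pos': "0 < s" and s_less_n: "s < real n"
    and conj_infinite: "\<exists>M>0. (\<integral>\<^sup>+t\<in>{M..}. ennreal (conj_integrand n s G t) \<partial>lborel) = \<infinity>"
    and conj_finite: "\<exists>\<delta>>0. (\<integral>\<^sup>+t\<in>{0..\<delta>}. ennreal (conj_integrand n s G t) \<partial>lborel) < \<infinity>"
begin

abbreviation h :: "real \<Rightarrow> real" where "h \<equiv> conj_integrand n s G"

abbreviation I :: "real \<Rightarrow> real" where "I t \<equiv> (LINT \<tau>:{0..t}|lborel. h \<tau>)"

lemma h_nonneg: "0 \<le> h t"
  by (simp add: conj_integrand_def)

lemma measurable_h [measurable]: "h \<in> borel_measurable borel"
  unfolding conj_integrand_def by (intro powr_real_measurable borel_measurable_divide measurable_G) auto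

text \<open>Near 0 this is \<open>conj_finite\<close>; beyond \<open>d\<close> the integrand is
  bounded by its value at \<open>d\<close>, since convexity of \<open>G\<close> makes
  \<open>t / G t\<close> nonincreasing.\<close>

lemma h_set_integrable: "set_integrable lborel {0..t} h"
proof -
  obtain d where d: "d > 0" "(\<integral>\<^sup>+t\<in>{0..d}. ennreal (h t) \<partial>lborel) < \<infinity>" using conj_finite by auto
  define c where "c = (d / G d) powr (s / (real n - s))"
  have le: "h t \<le> c" if "t \<ge> d" for t
  proof -
    have "G (d / t * t) \<le> d / t * G t" using that d by (intro G_scale_le) auto
    then have "t * G d \<le> d * G t" using that d by (simp add: field_simps)
    then have "t / G t \<le> d / G d" using G_pos[of t] G_pos[of d] that d by (simp add: field_simps)
    then show ?thesis unfolding conj_integrand_def c_def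
      using that d s_less_n s_pos' by (intro powr_mono2) (auto simp: G_nonneg)
  qed
  have "(\<integral>\<^sup>+x. ennreal (norm (indicator {0..t} x *\<^sub>R h x)) \<partial>lborel)
      \<le> (\<integral>\<^sup>+x. ennreal (h x) * indicator {0..d} x + ennreal c * indicator {0..t} x \<partial>lborel)"
  proof (rule nn_integral_mono)
    fix x
    show "ennreal (norm (indicator {0..t} x *\<^sub>R h x)) \<le> ennreal (h x) * indicator {0..d} x + ennreal c * indicator {0..t} x"
      using le[of x] h_nonneg[of x] by (cases "x \<le> d") (auto split: split_indicator intro: ennreal_leI)
  qed
  also have "\<dots> = (\<integral>\<^sup>+t\<in>{0..d}. ennreal (h t) \<partial>lborel) + ennreal c * emeasure lborel {0..t}"
    by (subst nn_integral_add) (auto simp: nn_integral_cmult)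
  also have "\<dots> < \<infinity>" using d(2) by (cases "0 \<le> t") (auto simp: ennreal_mult_less_top)
  finally show ?thesis unfolding set_integrable_def by (intro integrableI_bounded) auto
qed

lemma I_subset:
  assumes "A \<in> sets borel" "A \<subseteq> {0..b}" shows "(LINT \<tau>:A|lborel. h \<tau>) \<le> I b"
  using h_set_integrable[of b] set_integrable_subset[OF h_set_integrable[of b], of A] assms h_nonneg
  unfolding set_lebesgue_integral_def set_integrable_def real_scaleR_def
proof (intro integral_mono)
  fix x show "indicator A x * h x \<le> indicator {0..b} x * h x"
    using assms h_nonneg[of x] by (cases "x \<in> A") auto
qed simp_all

lemma I_mono: "a \<le> b \<Longrightarrow> I a \<le> I b"
  by (rule I_subset) auto

lemma I_nonneg: "0 \<le> I a"
  unfolding set_lebesgue_integral_def by (intro integral_nonneg_AE AE_I2) (simp add: h_nonneg)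

text \<open>On the upper half \<open>{b/2..b}\<close> the numerator of \<open>t / G t\<close> is at
  least \<open>b / 2\<close> and the denominator at most \<open>G b\<close>.\<close>

lemma I_lower:
  assumes "0 < b" shows "b / 2 * (b / (2 * G b)) powr (s / (real n - s)) \<le> I b"
proof -
  let ?c = "(b / (2 * G b)) powr (s / (real n - s))"
  have "b / 2 * ?c = (LINT \<tau>:{b/2..b}|lborel. ?c)"
    using assms by (simp add: set_lebesgue_integral_def)
  also have "\<dots> \<le> (LINT \<tau>:{b/2..b}|lborel. h \<tau>)"
  proof (rule set_integral_mono)
    show "set_integrable lborel {b/2..b} (\<lambda>_. ?c)" 
      
    proof -
      have "emeasure lborel {b/2..b} < \<infinity>" by (simp add: emeasure_lborel_Icc_eq)
      then show ?thesis
        unfolding set_integrable_def by (intro integrable_scaleR_left integrable_real_indicator) simp_all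
    qed
    show "set_integrable lborel {b/2..b} h"
      by (rule set_integrable_subset[OF h_set_integrable[of b]]) (use assms in auto)
    fix t assume t: "t \<in> {b/2..b}"
    then have "G t \<le> G b" "0 < G t" using assms by (auto intro!: G_mono G_pos)
    then have "(b / 2) / G b \<le> t / G t"
      using t assms by (intro frac_le) simp_all
    then have "b / (2 * G b) \<le> t / G t" by simp
    then show "?c \<le> h t"
      unfolding conj_integrand_def
      by (intro powr_mono2[rotated 2]) (use assms s_pos' s_less_n G_nonneg[of b] in simp_all)
  qed
  also have "\<dots> \<le> I b"
    by (rule I_subset) (use assms in auto)
  finally show ?thesis .
qed

text \<open>\<open>I_lower\<close> raised to the power \<open>e\<close>: the identities
  \<open>(1 + \<sigma>) * e = 1\<close> and \<open>\<sigma> * e = s / real n\<close> reduce the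
  exponents to 1 and \<open>s / real n\<close>.\<close>

lemma conj_H_lower:
  assumes "0 < b" shows "b / 2 * G b powr - (s / real n) \<le> conj_H n s G b"
proof -
  define \<sigma> e where "\<sigma> = s / (real n - s)" and "e = (real n - s) / real n"
  have n: "0 < real n" "0 < real n - s" using s_pos' s_less_n by auto
  have e: "e > 0" "(1 + \<sigma>) * e = 1" "\<sigma> * e = s / real n" using n by (auto simp: \<sigma>_def e_def field_simps)
  have "b / 2 * G b powr - (s / real n) = (b / 2) powr ((1 + \<sigma>) * e) * G b powr - (\<sigma> * e)"
    using assms e by simp
  also have "\<dots> = ((b / 2) powr (1 + \<sigma>) * G b powr - \<sigma>) powr e"
    using assms by (simp add: powr_mult powr_powr)
  also have "(b / 2) powr (1 + \<sigma>) * G b powr - \<sigma> = b / 2 * (b / (2 * G b)) powr \<sigma>"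
  proof -
    have "b / (2 * G b) = (b / 2) * inverse (G b)" by (simp add: field_simps)
    then have "(b / (2 * G b)) powr \<sigma> = (b / 2) powr \<sigma> * G b powr - \<sigma>"
      using assms G_nonneg[of b] by (simp only: powr_mult) (simp add: powr_minus inverse_powr)
    then show ?thesis using assms by (simp add: powr_add)
  qed
  also have "\<dots> powr e \<le> (I b) powr e"
    using I_lower[OF assms] assms e G_nonneg[of b] by (intro powr_mono2) (auto simp: \<sigma>_def)
  finally show ?thesis by (simp add: conj_H_def e_def)
qed

lemma conj_H_mono: "a \<le> b \<Longrightarrow> conj_H n s G a \<le> conj_H n s G b"
  unfolding conj_H_def using s_less_n by (intro powr_mono2 I_mono I_nonneg) auto

text \<open>Otherwise Fatou along the intervals \<open>{0..real k}\<close> would bound the integral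
  that \<open>conj_infinite\<close> makes infinite.\<close>

lemma I_unbounded: "\<exists>t\<ge>0. y \<le> I t"
proof (rule ccontr)
  assume "\<not> ?thesis"
  then have less: "I t < y" if "t \<ge> 0" for t using that by force
  have "(\<integral>\<^sup>+ x. ennreal (indicator {0..} x * h x) \<partial>lborel) \<le> ennreal y"
  proof (rule nn_integral_Fatou_bound[where F = "\<lambda>k x. indicator {0..real k} x * h x" and N = 0 and c = "\<lambda>_. y"])
    show "AE x in lborel. (\<lambda>k. indicator {0..real k} x * h x) \<longlonglongrightarrow> indicator {0..} x * h x"
    proof (rule AE_I2)
      fix x :: real
      obtain N :: nat where N: "x \<le> real N" using real_arch_simple by blast
      have "eventually (\<lambda>k. indicator {0..real k} x * h x = indicator {0..} x * h x) sequentially"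
        using eventually_ge_at_top[of N]
        by eventually_elim (use N in \<open>auto split: split_indicator\<close>)
      then show "(\<lambda>k. indicator {0..real k} x * h x) \<longlonglongrightarrow> indicator {0..} x * h x"
        by (rule tendsto_eventually)
    qed
    show "(\<integral>\<^sup>+ x. ennreal (indicator {0..real k} x * h x) \<partial>lborel) \<le> ennreal y" for k
    proof -
      have "(\<integral>\<^sup>+ x. ennreal (indicator {0..real k} x * h x) \<partial>lborel) = ennreal (I (real k))"
        using h_set_integrable[of "real k"] h_nonneg unfolding set_integrable_def set_lebesgue_integral_def real_scaleR_def
        by (intro nn_integral_eq_integral) auto
      then show ?thesis using less[of "real k"] by (simp add: ennreal_leI)
    qed
  qed auto
  moreover obtain M where M: "M > 0" "(\<integral>\<^sup>+t\<in>{M..}. ennreal (h t) \<partial>lborel) = \<infinity>" using conj_infinite by auto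
  have "(\<integral>\<^sup>+t\<in>{M..}. ennreal (h t) \<partial>lborel) \<le> (\<integral>\<^sup>+ x. ennreal (indicator {0..} x * h x) \<partial>lborel)"
    using M(1) by (intro nn_integral_mono) (auto split: split_indicator)
  ultimately show False using M(2) by (simp add: top_unique)
qed

text \<open>Intermediate values of the continuous, unbounded integral \<open>I\<close>. This makes
  \<open>inv_into\<close> in \<open>sobolev_conj\<close> a right inverse of \<open>conj_H\<close> on
  the nonnegative reals.\<close>

lemma conj_H_surj:
  assumes "0 \<le> t" obtains \<tau> where "0 \<le> \<tau>" "conj_H n s G \<tau> = t"
proof -
  define e where "e = (real n - s) / real n"
  have e: "e > 0" using s_pos' s_less_n by (simp add: e_def)
  define y where "y = t powr (1 / e)"
  obtain T where T: "T \<ge> 0" "y \<le> I T" using I_unbounded by blast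
  have I_eq: "I x = integral {0..x} h" for x
    using set_borel_integral_eq_integral(2)[OF h_set_integrable] .
  have "continuous_on {0..T} I"
    unfolding I_eq
    by (rule indefinite_integral_continuous_1) (rule set_borel_integral_eq_integral(1)[OF h_set_integrable])
  moreover have "I 0 \<le> y" unfolding I_eq y_def by simp
  ultimately obtain \<tau> where \<tau>: "0 \<le> \<tau>" "I \<tau> = y" using IVT'[of I 0 y T] T by auto
  have "y powr e = t" using assms e by (cases "t = 0") (auto simp: y_def powr_powr)
  then have "conj_H n s G \<tau> = t" using \<tau> by (simp add: conj_H_def e_def)
  then show ?thesis using that \<tau> by blast
qed

text \<open>Removes the inverse of \<open>conj_H\<close>. Take \<beta> with
  \<open>G \<beta> = Y\<close>; then \<beta> is at most the preimage \<tau> of \<open>t\<close>, so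
  \<open>conj_H n s G \<beta>\<close> is at most \<open>t\<close>, and \<open>conj_H_lower\<close>
  bounds \<beta> by \<open>2 * t * Y powr (s / real n)\<close>.\<close>

lemma le_sobolev_conj:
  assumes t: "0 < t" and Y: "0 \<le> Y" "Y \<le> sobolev_conj n s G t"
  shows "Y \<le> G (2 * t * Y powr (s / real n))"
proof (cases "Y = 0")
  case False
  define \<tau> where "\<tau> = inv_into {0..} (conj_H n s G) t"
  have "t \<in> conj_H n s G ` {0..}" using conj_H_surj[of t] t by (metis atLeast_iff imageI less_imp_le)
  then have \<tau>: "0 \<le> \<tau>" "conj_H n s G \<tau> = t"
    using f_inv_into_f[of t "conj_H n s G" "{0..}"] inv_into_into[of t "conj_H n s G" "{0..}"] by (auto simp: \<tau>_def)
  have Y\<tau>: "Y \<le> G \<tau>" using Y t by (simp add: sobolev_conj_def \<tau>_def)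
  obtain \<beta> where \<beta>: "\<beta> \<ge> 0" "G \<beta> = Y" using G_surj_nonneg[OF Y(1)] by blast
  have \<beta>0: "\<beta> > 0" using \<beta> False by (cases "\<beta> = 0") auto
  have "\<beta> \<le> \<tau>"
  proof (rule ccontr)
    assume "\<not> \<beta> \<le> \<tau>"
    then have "\<tau> / \<beta> < 1" using \<beta>0 by simp
    moreover have "G (\<tau> / \<beta> * \<beta>) \<le> \<tau> / \<beta> * G \<beta>"
      using \<open>\<tau> / \<beta> < 1\<close> \<tau>(1) \<beta>0 by (intro G_scale_le) auto
    moreover have "\<tau> / \<beta> * G \<beta> < 1 * G \<beta>" using \<open>\<tau> / \<beta> < 1\<close> \<beta>0 by (intro mult_strict_right_mono G_pos) auto
    ultimately show False using Y\<tau> \<beta> \<beta>0 by simp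
  qed
  then have "\<beta> / 2 * Y powr - (s / real n) \<le> t"
    using conj_H_lower[OF \<beta>0] conj_H_mono \<tau> \<beta> by fastforce
  then have "\<beta> \<le> 2 * t * Y powr (s / real n)"
    using False Y(1) by (simp add: powr_minus field_simps)
  then have "G \<beta> \<le> G (2 * t * Y powr (s / real n))" using \<beta>0 by (intro G_mono) auto
  then show ?thesis using \<beta> by simp
qed (simp add: G_nonneg)

lemma sobolev_conj_pos: "0 < t \<Longrightarrow> 0 < sobolev_conj n s G t"
proof -
  assume t: "0 < t"
  define \<tau> where "\<tau> = inv_into {0..} (conj_H n s G) t"
  have "t \<in> conj_H n s G ` {0..}" using conj_H_surj[of t] t by (metis atLeast_iff imageI less_imp_le)
  then have "conj_H n s G \<tau> = t"
    using f_inv_into_f[of t "conj_H n s G" "{0..}"] by (auto simp: \<tau>_def)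
  moreover have "conj_H n s G 0 = 0"
    using set_borel_integral_eq_integral(2)[OF h_set_integrable[of 0]] by (simp add: conj_H_def)
  ultimately have "\<tau> \<noteq> 0" using t by auto
  then show ?thesis using t G_pos[of \<tau>] by (simp add: sobolev_conj_def \<tau>_def)
qed

text \<open>The form in which subcriticality reaches the level set argument. The freedom to choose
  \<open>c\<close> in the definition of \<open>ess_slower\<close> converts the factor 2 of
  \<open>le_sobolev_conj\<close> into an arbitrary \<epsilon>.\<close>

lemma ess_slower_sobolev_conj:
  assumes B: "B \<lless> sobolev_conj n s G" "\<And>t. 0 \<le> B t" and \<epsilon>: "0 < \<epsilon>"
  shows "eventually (\<lambda>t. B t \<le> G (\<epsilon> * t * B t powr (s / real n))) at_top"
proof -
  define c where "c = 2 / \<epsilon>"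
  have c: "c > 0" using \<epsilon> by (simp add: c_def)
  have "((\<lambda>t. B (c * t) / sobolev_conj n s G t) \<longlongrightarrow> 0) at_top"
    using B(1) c by (simp add: ess_slower_def)
  then have "eventually (\<lambda>t. B (c * t) / sobolev_conj n s G t < 1) at_top"
    by (rule order_tendstoD) simp
  then have *: "eventually (\<lambda>t. B (c * t) \<le> G (\<epsilon> * (c * t) * B (c * t) powr (s / real n))) at_top"
    using eventually_gt_at_top[of 0]
  proof eventually_elim
    case (elim t)
    then have "B (c * t) \<le> sobolev_conj n s G t" using sobolev_conj_pos[of t] by (simp add: field_simps)
    then have "B (c * t) \<le> G (2 * t * B (c * t) powr (s / real n))"
      using elim B(2) by (intro le_sobolev_conj) auto
    then show ?case using \<epsilon> by (simp add: c_def)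
  qed
  have "filterlim (\<lambda>t. t / c) at_top at_top"
    using c by real_asymp
  from eventually_compose_filterlim[OF * this]
  show ?thesis using c by simp
qed

end

section \<open>Embedding by level sets\<close>

context fractional_Orlicz_Sobolev
begin

text \<open>Convexity with \<open>G 0 = 0\<close> at least halves a term when its argument is
  halved, so a geometric series of sum 2 measured from the largest index bounds everything.\<close>

lemma sum_G_dyadic_le:
  fixes d :: real
  assumes "finite S" "S \<noteq> {}"
  shows "(\<Sum>k\<in>S. G (2 ^ k / d)) \<le> 2 * G (2 ^ Max S / d)"
proof -
  have "(\<Sum>k\<in>S. G (2 ^ k / d)) \<le> (\<Sum>k\<in>S. (1/2) ^ (Max S - k) * G (2 ^ Max S / d))"
  proof (rule sum_mono)
    fix k assume k: "k \<in> S"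
    then have "k \<le> Max S" using assms by simp
    then have "2 ^ Max S = 2 ^ k * (2 :: real) ^ (Max S - k)" by (simp add: power_add[symmetric])
    then have e: "2 ^ k / d = (1/2) ^ (Max S - k) * (2 ^ Max S / d)" by (simp add: power_divide)
    show "G (2 ^ k / d) \<le> (1/2) ^ (Max S - k) * G (2 ^ Max S / d)"
      unfolding e by (rule G_scale_le) (simp_all add: power_le_one)
  qed
  also have "\<dots> = (\<Sum>k\<in>S. (1/2) ^ (Max S - k)) * G (2 ^ Max S / d)" by (simp add: sum_distrib_right)
  also have "\<dots> \<le> 2 * G (2 ^ Max S / d)"
  proof (rule mult_right_mono[OF _ G_nonneg])
    have "(\<Sum>k\<in>S. (1/2 :: real) ^ (Max S - k)) = (\<Sum>j\<in>(\<lambda>k. Max S - k) ` S. (1/2) ^ j)"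
      using assms by (subst sum.reindex) (auto simp: inj_on_def Max_ge dest!: Max_ge[OF assms(1)])
    also have "\<dots> \<le> (\<Sum>j. (1/2) ^ j)"
      using assms by (intro sum_le_suminf summable_geometric) auto
    also have "\<dots> = 2" by (subst suminf_geometric) auto
    finally show "(\<Sum>k\<in>S. (1/2 :: real) ^ (Max S - k)) \<le> 2" .
  qed
  finally show ?thesis .
qed

definition level :: "('a \<Rightarrow> real) \<Rightarrow> nat \<Rightarrow> 'a set" where
  "level w k = {x. 2 ^ k < w x}"

text \<open>The share of the energy due to pairs that jump across the whole shell between
  \<open>2 ^ k\<close> and \<open>2 ^ Suc k\<close>; such a jump has size at least
  \<open>2 ^ k\<close>, which replaces the true jump inside \<open>G\<close>.\<close>

definition jump_energy :: "('a::euclidean_space \<Rightarrow> real) \<Rightarrow> nat \<Rightarrow> ennreal" where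
  "jump_energy w k = (\<integral>\<^sup>+ x. \<integral>\<^sup>+ y. ennreal (1 / dist x y ^ DIM('a)) *
     ennreal (indicator (level w (Suc k)) x * indicator (- level w k) y * G (2 ^ k / dist x y powr s)) \<partial>lborel \<partial>lborel)"

lemma level_sets [measurable]: "w \<in> borel_measurable borel \<Longrightarrow> level w k \<in> sets borel"
  unfolding level_def by measurable

text \<open>For a fixed pair, the largest shell that is crossed dominates the dyadic sum, and its
  height is at most the actual jump.\<close>

lemma jump_sum_pointwise:
  "(\<Sum>k<N. indicator (level w (Suc k)) x * indicator (- level w k) y * G (2 ^ k / dist x y powr s))
    \<le> 2 * G ((w x - w y) / dist x y powr s)"
proof -
  define S where "S = {k. k < N \<and> x \<in> level w (Suc k) \<and> y \<notin> level w k}"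
  have S: "finite S" by (simp add: S_def)
  have "(\<Sum>k<N. indicator (level w (Suc k)) x * indicator (- level w k) y * G (2 ^ k / dist x y powr s))
      = (\<Sum>k\<in>S. G (2 ^ k / dist x y powr s))"
    by (rule sum.mono_neutral_cong_right) (auto simp: S_def indicator_def)
  also have "\<dots> \<le> 2 * G ((w x - w y) / dist x y powr s)"
  proof (cases "S = {}")
    case False
    then have "Max S \<in> S" using S by simp
    then have "2 ^ Suc (Max S) < w x" "w y \<le> 2 ^ Max S" by (auto simp: S_def level_def)
    then have "2 ^ Max S \<le> w x - w y" by simp
    then have "G (2 ^ Max S / dist x y powr s) \<le> G ((w x - w y) / dist x y powr s)"
      by (intro G_mono) (auto intro!: divide_right_mono order_trans[OF _ abs_ge_self])
    then show ?thesis using sum_G_dyadic_le[OF S False, of "dist x y powr s"] by linarith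
  qed (simp add: G_nonneg)
  finally show ?thesis .
qed

lemma measurable_jump_integrand:
  fixes w :: "'a::euclidean_space \<Rightarrow> real"
  assumes [measurable]: "w \<in> borel_measurable borel"
  shows "(\<lambda>z :: 'a \<times> 'a. ennreal (indicator (level w (Suc k)) (fst z) * indicator (- level w k) (snd z) *
    G (2 ^ k / dist (fst z) (snd z) powr s))) \<in> borel_measurable borel"
proof -
  have "indicator (level w (Suc k)) \<in> borel_measurable (borel :: 'a measure)"
    "indicator (- level w k) \<in> borel_measurable (borel :: 'a measure)"
    by (intro borel_measurable_indicator; measurable)+
  then show ?thesis
    by (intro measurable_compose[OF _ measurable_ennreal] borel_measurable_times
        measurable_compose[OF _ measurable_G] borel_measurable_divide measurable_dist_powr
        measurable_compose[OF measurable_fst_borel] measurable_compose[OF measurable_snd_borel])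
      auto
qed

lemma jump_energy_sum:
  fixes w :: "'a::euclidean_space \<Rightarrow> real"
  assumes w: "w \<in> borel_measurable borel"
  shows "(\<Sum>k<N. jump_energy w k) \<le> 2 * rho_sG s G w"
proof -
  let ?f = "\<lambda>k z :: 'a \<times> 'a. ennreal (indicator (level w (Suc k)) (fst z) * indicator (- level w k) (snd z) *
    G (2 ^ k / dist (fst z) (snd z) powr s))"
  have "jump_energy w k = (\<integral>\<^sup>+ z. ?f k z \<partial>mu)" for k
    unfolding jump_energy_def using nn_integral_mu[OF measurable_jump_integrand[OF w], of k] by simp
  then have "(\<Sum>k<N. jump_energy w k) = (\<Sum>k<N. \<integral>\<^sup>+ z. ?f k z \<partial>mu)" by simp
  also have "\<dots> = (\<integral>\<^sup>+ z. (\<Sum>k<N. ?f k z) \<partial>mu)"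
    by (intro nn_integral_sum[symmetric]) (simp add: measurable_lebesgueI[OF measurable_jump_integrand[OF w]])
  also have "\<dots> \<le> (\<integral>\<^sup>+ z. 2 * ennreal (G (slope s w z)) \<partial>mu)"
  proof (rule nn_integral_mono)
    fix z :: "'a \<times> 'a"
    have "(\<Sum>k<N. ?f k z) = ennreal (\<Sum>k<N. indicator (level w (Suc k)) (fst z) * indicator (- level w k) (snd z) *
        G (2 ^ k / dist (fst z) (snd z) powr s))"
      by (rule sum_ennreal) (simp add: G_nonneg)
    also have "\<dots> \<le> ennreal (2 * G (slope s w z))"
      using jump_sum_pointwise[where N = N and w = w and x = "fst z" and y = "snd z"]
      by (intro ennreal_leI) (simp add: slope_def split_beta)
    also have "\<dots> = 2 * ennreal (G (slope s w z))" by (simp add: ennreal_mult')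
    finally show "(\<Sum>k<N. ?f k z) \<le> 2 * ennreal (G (slope s w z))" .
  qed
  also have "\<dots> = 2 * rho_sG s G w"
    unfolding rho_sG_slope
    by (intro nn_integral_cmult) (simp add: measurable_compose[OF measurable_G_slope(1) measurable_ennreal] measurable_lebesgueI w)
  finally show ?thesis .
qed

text \<open>A ball around \<open>x\<close> with twice the measure of the level set meets the complement of the level
  set in a set of at least half its measure.\<close>

lemma jump_energy_lower:
  fixes w :: "'a::euclidean_space \<Rightarrow> real"
  assumes w [measurable]: "w \<in> borel_measurable borel"
    and fin: "emeasure lborel (level w k) = ennreal a" "a > 0"
    and r: "r > 0" "unit_ball_vol DIM('a) * r ^ DIM('a) = 2 * a"
  shows "ennreal (unit_ball_vol DIM('a) / 2 * G (2 ^ k / r powr s)) * emeasure lborel (level w (Suc k)) \<le> jump_energy w k"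
proof -
  let ?n = "DIM('a)" and ?\<omega> = "unit_ball_vol DIM('a)"
  have inner: "ennreal (?\<omega> / 2 * G (2 ^ k / r powr s)) \<le> (\<integral>\<^sup>+ y. ennreal (1 / dist x y ^ ?n) *
      ennreal (indicator (- level w k) y * G (2 ^ k / dist x y powr s)) \<partial>lborel)" for x
  proof -
    \<comment> \<open>Deleting the centre keeps the distance positive, as needed to compare the
      kernel with its value at \<open>r\<close>.\<close>
    define Z where "Z = ball x r - level w k - {x}"
    have [measurable]: "Z \<in> sets borel" unfolding Z_def by measurable
    have "emeasure lborel (ball x r) = ennreal (2 * a)"
      using r emeasure_ball[of r x] by (simp)
    moreover have "emeasure lborel (ball x r) \<le> emeasure lborel (Z \<union> (level w k \<union> {x}))"
      by (rule emeasure_mono) (auto simp: Z_def)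
    moreover have "emeasure lborel (Z \<union> (level w k \<union> {x})) \<le> emeasure lborel Z + (emeasure lborel (level w k) + emeasure lborel {x})"
      by (intro order_trans[OF emeasure_subadditive] add_left_mono emeasure_subadditive) auto
    ultimately have "ennreal (2 * a) \<le> emeasure lborel Z + ennreal a" using fin by simp
    then have "ennreal a + ennreal a \<le> ennreal a + emeasure lborel Z"
      using fin(2) by (simp add: ennreal_plus[symmetric] add.commute del: ennreal_plus)
    then have Z_ge: "ennreal a \<le> emeasure lborel Z"
      by (simp add: ennreal_add_left_cancel_le)
    have "ennreal (?\<omega> / 2 * G (2 ^ k / r powr s)) = ennreal (1 / r ^ ?n * G (2 ^ k / r powr s)) * ennreal a"
    proof -
      have "?\<omega> / 2 = 1 / r ^ ?n * a" using r by (simp add: field_simps)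
      then show ?thesis using G_nonneg r fin by (simp add: ennreal_mult'[symmetric] mult_ac)
    qed
    also have "\<dots> \<le> ennreal (1 / r ^ ?n * G (2 ^ k / r powr s)) * emeasure lborel Z"
      by (intro mult_left_mono Z_ge) auto
    also have "\<dots> = (\<integral>\<^sup>+ y. ennreal (1 / r ^ ?n * G (2 ^ k / r powr s)) * indicator Z y \<partial>lborel)"
      by (simp add: nn_integral_cmult)
    also have "\<dots> \<le> (\<integral>\<^sup>+ y. ennreal (1 / dist x y ^ ?n) *
      ennreal (indicator (- level w k) y * G (2 ^ k / dist x y powr s)) \<partial>lborel)"
    proof (rule nn_integral_mono)
      fix y
      show "ennreal (1 / r ^ ?n * G (2 ^ k / r powr s)) * indicator Z y \<le> ennreal (1 / dist x y ^ ?n) *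
        ennreal (indicator (- level w k) y * G (2 ^ k / dist x y powr s))"
      proof (cases "y \<in> Z")
        case True
        then have d: "0 < dist x y" "dist x y \<le> r" by (auto simp: Z_def)
        then have "1 / r ^ ?n \<le> 1 / dist x y ^ ?n" "dist x y powr s \<le> r powr s"
          using s_pos r by (auto intro!: divide_left_mono power_mono powr_mono2 mult_pos_pos)
        moreover from this have "G (2 ^ k / r powr s) \<le> G (2 ^ k / dist x y powr s)"
          using d r by (intro G_mono) (auto intro!: divide_left_mono mult_pos_pos)
        ultimately have "1 / r ^ ?n * G (2 ^ k / r powr s) \<le> 1 / dist x y ^ ?n * G (2 ^ k / dist x y powr s)"
          using d by (intro mult_mono) (auto simp: G_nonneg)
        then show ?thesis using True by (simp add: Z_def ennreal_mult'[symmetric] ennreal_leI)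
      qed simp
    qed
    finally show ?thesis .
  qed
  have "ennreal (?\<omega> / 2 * G (2 ^ k / r powr s)) * emeasure lborel (level w (Suc k))
      = (\<integral>\<^sup>+ x. ennreal (?\<omega> / 2 * G (2 ^ k / r powr s)) * indicator (level w (Suc k)) x \<partial>lborel)"
    by (simp add: nn_integral_cmult)
  also have "\<dots> \<le> jump_energy w k"
    unfolding jump_energy_def
  proof (rule nn_integral_mono)
    fix x
    show "ennreal (?\<omega> / 2 * G (2 ^ k / r powr s)) * indicator (level w (Suc k)) x \<le>
      (\<integral>\<^sup>+ y. ennreal (1 / dist x y ^ ?n) * ennreal (indicator (level w (Suc k)) x * indicator (- level w k) y * G (2 ^ k / dist x y powr s)) \<partial>lborel)"
      using inner[of x] by (cases "x \<in> level w (Suc k)") auto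
  qed
  finally show ?thesis .
qed

end

context fractional_Orlicz_Sobolev
begin

text \<open>Induction on \<open>k\<close>. The bound at level \<open>k\<close> keeps the ball with
  twice the measure of that level set small enough for \<open>growth\<close> to yield
  \<open>B (2 ^ Suc k) \<le> G (2 ^ k / r powr s)\<close>. Then \<open>jump_energy_lower\<close>
  gives the second claim, and the smallness of the energy turns it into the bound at the next
  level.\<close>

lemma level_decay:
  fixes w :: "'a::euclidean_space \<Rightarrow> real"
  assumes B: "N_growth B b qm qp"
    and w: "w \<in> borel_measurable borel"
    and growth: "\<And>t. 2 ^ k0 \<le> t \<Longrightarrow>
      B t \<le> G ((unit_ball_vol DIM('a) / (2 * 2 powr qp)) powr (s / DIM('a)) / 2 * t * B t powr (s / DIM('a)))"
    and \<rho>: "rho_sG s G w \<le> ennreal (unit_ball_vol DIM('a) / 4)"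
    and base: "ennreal (B (2 ^ k0)) * emeasure lborel (level w k0) \<le> 1"
    and k: "k0 \<le> k"
  shows "ennreal (B (2 ^ k)) * emeasure lborel (level w k) \<le> 1"
    and "ennreal (unit_ball_vol DIM('a) / 2 * B (2 ^ Suc k)) * emeasure lborel (level w (Suc k)) \<le> jump_energy w k"
proof -
  interpret B: N_growth B b qm qp by (rule B)
  define \<omega> where "\<omega> = unit_ball_vol DIM('a)"
  have \<omega>: "\<omega> > 0" by (simp add: \<omega>_def)
  let ?n = "DIM('a)"
  have step: "ennreal (\<omega> / 2 * B (2 ^ Suc k)) * emeasure lborel (level w (Suc k)) \<le> jump_energy w k"
    if k: "k0 \<le> k" and le: "ennreal (B (2 ^ k)) * emeasure lborel (level w k) \<le> 1" for k
  proof -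
    have Bpos: "B (2 ^ k) > 0" "B (2 ^ Suc k) > 0" by (simp_all add: B.G_pos)
    have "emeasure lborel (level w k) < \<infinity>"
      using le Bpos by (cases "emeasure lborel (level w k) = \<infinity>") (auto simp: ennreal_mult_top top.not_eq_extremum top_unique)
    then obtain a where a: "emeasure lborel (level w k) = ennreal a" "a \<ge> 0"
      by (metis ennreal_cases infinity_ennreal_def order_less_irrefl)
    have mono: "emeasure lborel (level w (Suc k)) \<le> emeasure lborel (level w k)"
      using w by (intro emeasure_mono) (auto simp: level_def order_less_trans[of "2 ^ k" "2 ^ Suc k"] intro: le_less_trans[rotated])
    show ?thesis
    proof (cases "a = 0")
      case True
      then show ?thesis using mono a by simp
    next
      case False
      then have a0: "a > 0" using a by simp
      have Ba: "B (2 ^ k) * a \<le> 1" using le a by (simp add: ennreal_mult'[symmetric] B.G_nonneg)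
      define r where "r = (2 * a / \<omega>) powr (1 / ?n)"
      have r: "r > 0" using a0 \<omega> by (simp add: r_def)
      have "r ^ ?n = 2 * a / \<omega>"
        using a0 \<omega> by (simp add: r_def powr_realpow[symmetric] powr_powr)
      then have r': "unit_ball_vol ?n * r ^ ?n = 2 * a" using \<omega> by (simp add: \<omega>_def[symmetric])
      have "B (2 ^ Suc k) \<le> 2 powr qp * B (2 ^ k)" using B.G_double[of "2 ^ k"] by simp
      then have "B (2 ^ Suc k) * a \<le> 2 powr qp * (B (2 ^ k) * a)" using a0 by (simp add: mult_right_mono)
      also have "\<dots> \<le> 2 powr qp * 1" using Ba by (intro mult_left_mono) auto
      finally have Ba': "B (2 ^ Suc k) * a \<le> 2 powr qp" by simp
      \<comment> \<open>Twice the constant in \<open>growth\<close>: the spare factor 2 is the ratio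
        between \<open>2 ^ Suc k\<close>, where \<open>growth\<close> is evaluated, and the jump
        height \<open>2 ^ k\<close>.\<close>
      define \<kappa> where "\<kappa> = (\<omega> / (2 * 2 powr qp)) powr (s / ?n)"
      have "\<kappa> * B (2 ^ Suc k) powr (s / ?n) = (\<omega> / (2 * 2 powr qp) * B (2 ^ Suc k)) powr (s / ?n)"
        unfolding \<kappa>_def by (rule powr_mult[symmetric])
      also have "\<dots> \<le> (\<omega> / (2 * a)) powr (s / ?n)"
        using Ba' a0 \<omega> s_pos B.G_nonneg by (intro powr_mono2) (auto simp: field_simps)
      also have "\<dots> = 1 / r powr s"
      proof -
        show ?thesis using a0 \<omega> by (simp add: r_def powr_powr powr_divide)
      qed
      finally have "\<kappa> * B (2 ^ Suc k) powr (s / ?n) \<le> 1 / r powr s" .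
      then have "2 ^ k * (\<kappa> * B (2 ^ Suc k) powr (s / ?n)) \<le> 2 ^ k * (1 / r powr s)"
        by (intro mult_left_mono) auto
      then have le2: "\<kappa> / 2 * 2 ^ Suc k * B (2 ^ Suc k) powr (s / ?n) \<le> 2 ^ k / r powr s"
        by (simp add: mult_ac)
      have "(2 :: real) ^ k0 \<le> 2 ^ Suc k" using k by (intro power_increasing) auto
      then have "B (2 ^ Suc k) \<le> G (\<kappa> / 2 * 2 ^ Suc k * B (2 ^ Suc k) powr (s / ?n))"
        unfolding \<kappa>_def \<omega>_def by (rule growth)
      also have "\<dots> \<le> G (2 ^ k / r powr s)"
        using le2 by (intro G_mono) (auto simp: \<kappa>_def abs_mult)
      finally have "B (2 ^ Suc k) \<le> G (2 ^ k / r powr s)" .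
      then have "ennreal (\<omega> / 2 * B (2 ^ Suc k)) \<le> ennreal (\<omega> / 2 * G (2 ^ k / r powr s))"
        using \<omega> by (intro ennreal_leI mult_left_mono) auto
      then have "ennreal (\<omega> / 2 * B (2 ^ Suc k)) * emeasure lborel (level w (Suc k))
          \<le> ennreal (\<omega> / 2 * G (2 ^ k / r powr s)) * emeasure lborel (level w (Suc k))"
        by (rule mult_right_mono) simp
      also have "\<dots> \<le> jump_energy w k"
        unfolding \<omega>_def by (rule jump_energy_lower[OF w a(1) a0 r r'])
      finally show ?thesis .
    qed
  qed
  \<comment> \<open>The bound \<omega>/4 on the energy is doubled by the dyadic sum; the resulting
    \<omega>/2 is exactly the factor to be cancelled in the induction.\<close>
  have jump_le: "jump_energy w k \<le> ennreal (\<omega> / 2)" for k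
  proof -
    have "jump_energy w k \<le> (\<Sum>i<Suc k. jump_energy w i)" by (rule member_le_sum) auto
    also have "\<dots> \<le> 2 * rho_sG s G w" by (rule jump_energy_sum[OF w])
    also have "\<dots> \<le> 2 * ennreal (\<omega> / 4)" using \<rho> unfolding \<omega>_def by (rule mult_left_mono) simp
    also have "\<dots> = ennreal (\<omega> / 2)"
      using \<omega> by (subst ennreal_numeral[symmetric]) (simp del: ennreal_numeral add: ennreal_mult'[symmetric])
    finally show ?thesis .
  qed
  have main: "ennreal (B (2 ^ k)) * emeasure lborel (level w k) \<le> 1" if "k0 \<le> k" for k
    using that
  proof (induction k rule: dec_induct)
    case base then show ?case using assms(5) .
  next
    case (step k)
    have "ennreal (\<omega> / 2) * (ennreal (B (2 ^ Suc k)) * emeasure lborel (level w (Suc k)))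
        = ennreal (\<omega> / 2 * B (2 ^ Suc k)) * emeasure lborel (level w (Suc k))"
      unfolding mult.assoc[symmetric] using \<omega> by (subst ennreal_mult'[symmetric]) auto
    also have "\<dots> \<le> jump_energy w k" using \<open>\<And>k. k0 \<le> k \<Longrightarrow> _ \<Longrightarrow> _\<close> step by blast
    also have "\<dots> \<le> ennreal (\<omega> / 2) * 1" using jump_le by simp
    finally show ?case using \<omega> by (subst (asm) ennreal_mult_le_mult_iff) (auto simp: ennreal_eq_0_iff)
  qed
  show "ennreal (B (2 ^ k)) * emeasure lborel (level w k) \<le> 1" by (rule main[OF k])
  show "ennreal (unit_ball_vol DIM('a) / 2 * B (2 ^ Suc k)) * emeasure lborel (level w (Suc k)) \<le> jump_energy w k"
    using step[OF k main[OF k]] unfolding \<omega>_def .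
qed

text \<open>A layer-cake estimate: a point with \<open>2 ^ m < w x \<le> 2 ^ Suc m\<close> is
  charged to level \<open>m\<close>, at the cost of one doubling of \<open>B\<close>. After the base
  level, each weighted measure is at most a multiple of the preceding jump energy, and the jump
  energies have a finite sum.\<close>

lemma integrable_of_level_decay:
  fixes w :: "'a::euclidean_space \<Rightarrow> real"
  assumes B: "N_growth B b qm qp"
    and w [measurable]: "w \<in> borel_measurable borel" "\<And>x. 0 \<le> w x"
    and \<Omega>: "\<Omega> \<in> sets borel" "bounded \<Omega>"
    and growth: "\<And>t. 2 ^ k0 \<le> t \<Longrightarrow>
      B t \<le> G ((unit_ball_vol DIM('a) / (2 * 2 powr qp)) powr (s / DIM('a)) / 2 * t * B t powr (s / DIM('a)))"
    and \<rho>: "rho_sG s G w \<le> ennreal (unit_ball_vol DIM('a) / 4)"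
    and base: "ennreal (B (2 ^ k0)) * emeasure lborel (level w k0) \<le> 1"
  shows "(\<integral>\<^sup>+ x. ennreal (indicator \<Omega> x * B (w x)) \<partial>lborel) < \<infinity>"
proof -
  interpret B: N_growth B b qm qp by (rule B)
  define \<omega> where "\<omega> = unit_ball_vol DIM('a)"
  have \<omega>: "\<omega> > 0" by (simp add: \<omega>_def)
  have [measurable]: "\<Omega> \<in> sets borel" by (rule \<Omega>)
  define Q where "Q = 2 powr qp"
  define a where "a k = ennreal (B (2 ^ k)) * emeasure lborel (level w k)" for k
  have pw: "ennreal (indicator \<Omega> x * B (w x)) \<le> ennreal (B (2 ^ k0)) * indicator \<Omega> x +
      (\<Sum>j. ennreal (B (2 ^ Suc (k0 + j))) * indicator (level w (k0 + j)) x)" for x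
  proof (cases "x \<in> level w k0")
    case True
    obtain K where K: "w x < 2 ^ K" using real_arch_pow[of 2 "w x"] by auto
    define S where "S = {k. 2 ^ k < w x}"
    have "k < K" if "k \<in> S" for k
      using that K less_trans[of "2 ^ k" "w x" "2 ^ K"] by (simp add: S_def)
    then have S: "finite S" "k0 \<in> S" using True by (auto simp: S_def level_def intro: finite_subset[of _ "{..<K}"])
    define m where "m = Max S"
    have m: "m \<in> S" "k0 \<le> m" unfolding m_def using S by (auto intro!: Max_in)
    have "Suc m \<notin> S" using Max_ge[OF S(1), of "Suc m"] by (auto simp: m_def)
    then have "B (w x) \<le> B (2 ^ Suc m)" using w(2)[of x] by (intro B.G_mono) (simp add: S_def not_less)
    then have "ennreal (indicator \<Omega> x * B (w x)) \<le> ennreal (B (2 ^ Suc m)) * indicator (level w m) x"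
      using m(1) by (auto simp: S_def level_def indicator_def intro!: ennreal_leI)
    also have "\<dots> \<le> (\<Sum>j. ennreal (B (2 ^ Suc (k0 + j))) * indicator (level w (k0 + j)) x)"
    proof -
      define f where "f j = ennreal (B (2 ^ Suc (k0 + j))) * indicator (level w (k0 + j)) x" for j
      have "f (m - k0) \<le> suminf f" using sum_le_suminf[of f "{m - k0}"] by simp
      then show ?thesis using m(2) unfolding f_def by simp
    qed
    finally show ?thesis by (rule order_trans) simp
  next
    case False
    then have "B (w x) \<le> B (2 ^ k0)" using w(2)[of x] by (intro B.G_mono) (simp add: level_def)
    then have "ennreal (indicator \<Omega> x * B (w x)) \<le> ennreal (B (2 ^ k0)) * indicator \<Omega> x"
      by (auto simp: indicator_def intro!: ennreal_leI)
    then show ?thesis by (rule order_trans) simp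
  qed
  have "(\<integral>\<^sup>+ x. ennreal (indicator \<Omega> x * B (w x)) \<partial>lborel) \<le>
    (\<integral>\<^sup>+ x. ennreal (B (2 ^ k0)) * indicator \<Omega> x +
      (\<Sum>j. ennreal (B (2 ^ Suc (k0 + j))) * indicator (level w (k0 + j)) x) \<partial>lborel)"
    by (rule nn_integral_mono) (rule pw)
  also have "\<dots> = ennreal (B (2 ^ k0)) * emeasure lborel \<Omega> + (\<Sum>j. ennreal (B (2 ^ Suc (k0 + j))) * emeasure lborel (level w (k0 + j)))"
    by (subst nn_integral_add) (simp_all add: nn_integral_suminf nn_integral_cmult)
  also have "\<dots> \<le> ennreal (B (2 ^ k0)) * emeasure lborel \<Omega> + ennreal Q * (\<Sum>j. a (k0 + j))"
  proof (rule add_left_mono)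
    have "ennreal (B (2 ^ Suc k)) * emeasure lborel (level w k) \<le> ennreal Q * a k" for k
    proof -
      have "ennreal (B (2 ^ Suc k)) \<le> ennreal Q * ennreal (B (2 ^ k))"
        using B.G_double[of "2 ^ k"] by (simp add: Q_def ennreal_mult'[symmetric] ennreal_leI)
      then show ?thesis unfolding a_def mult.assoc[symmetric] by (rule mult_right_mono) simp
    qed
    then have "(\<Sum>j. ennreal (B (2 ^ Suc (k0 + j))) * emeasure lborel (level w (k0 + j))) \<le> (\<Sum>j. ennreal Q * a (k0 + j))"
      by (intro suminf_le) auto
    then show "(\<Sum>j. ennreal (B (2 ^ Suc (k0 + j))) * emeasure lborel (level w (k0 + j))) \<le> ennreal Q * (\<Sum>j. a (k0 + j))"
      by simp
  qed
  also have "\<dots> < \<infinity>"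
  proof -
    have "(\<Sum>j<N. a (k0 + j)) \<le> 1 + ennreal (2 / \<omega>) * (2 * rho_sG s G w)" for N
    proof -
      \<comment> \<open>One more term is appended so that the first can be split off: it is bounded
        by \<open>base\<close>, all others by jump energies.\<close>
      have "(\<Sum>j<N. a (k0 + j)) \<le> (\<Sum>j<Suc N. a (k0 + j))" by simp
      also have "\<dots> = a k0 + (\<Sum>j<N. a (k0 + Suc j))" by (subst sum.lessThan_Suc_shift) simp
      also have "\<dots> \<le> 1 + (\<Sum>j<N. ennreal (2 / \<omega>) * jump_energy w (k0 + j))"
      proof (intro add_mono sum_mono)
        show "a k0 \<le> 1" using base by (simp add: a_def)
        fix j
        have "a (k0 + Suc j) = ennreal (2 / \<omega>) * (ennreal (\<omega> / 2 * B (2 ^ Suc (k0 + j))) * emeasure lborel (level w (Suc (k0 + j))))"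
          using \<omega> by (simp add: a_def mult.assoc[symmetric] ennreal_mult'[symmetric])
        also have "\<dots> \<le> ennreal (2 / \<omega>) * jump_energy w (k0 + j)"
          using level_decay(2)[OF B w(1) growth \<rho> base, of "k0 + j"] by (intro mult_left_mono) (auto simp: \<omega>_def)
        finally show "a (k0 + Suc j) \<le> ennreal (2 / \<omega>) * jump_energy w (k0 + j)" .
      qed
      also have "\<dots> = 1 + ennreal (2 / \<omega>) * (\<Sum>j<N. jump_energy w (k0 + j))" by (simp add: sum_distrib_left)
      also have "(\<Sum>j<N. jump_energy w (k0 + j)) = (\<Sum>k\<in>(+) k0 ` {..<N}. jump_energy w k)"
        by (subst sum.reindex) (auto simp: inj_on_def)
      also have "\<dots> \<le> (\<Sum>k<k0 + N. jump_energy w k)" by (rule sum_mono2) auto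
      also have "\<dots> \<le> 2 * rho_sG s G w" by (rule jump_energy_sum[OF w(1)])
      finally show ?thesis by (simp add: add_left_mono mult_left_mono)
    qed
    then have "(\<Sum>j. a (k0 + j)) \<le> 1 + ennreal (2 / \<omega>) * (2 * rho_sG s G w)"
      unfolding suminf_eq_SUP by (intro SUP_least) auto
    also have "\<dots> < \<infinity>"
      using le_less_trans[OF \<rho>, of \<infinity>] by (auto simp: ennreal_mult_less_top)
    finally have "(\<Sum>j. a (k0 + j)) < \<infinity>" .
    moreover have "emeasure lborel \<Omega> < \<infinity>" by (rule emeasure_bounded_finite[OF \<Omega>(2)])
    ultimately show ?thesis by (auto simp: ennreal_mult_less_top)
  qed
  finally show ?thesis .
qed

text \<open>Division by a large constant makes the energy and the base level set as small as the
  level set argument demands. The constant depends on \<open>u\<close>, which is harmless since only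
  finiteness is claimed.\<close>

theorem Orlicz_Sobolev_embedding:
  fixes u :: "'a::euclidean_space \<Rightarrow> real"
  assumes B: "N_growth B b qm qp"
    and conj: "Sobolev_conjugate G g p q DIM('a) s"
    and slower: "B \<lless> sobolev_conj DIM('a) s G"
    and u: "u \<in> W" and \<Omega>: "open \<Omega>" "bounded \<Omega>"
  shows "integrable lebesgue (\<lambda>x. indicator \<Omega> x * B (u x))"
proof -
  interpret B: N_growth B b qm qp by (rule B)
  interpret C: Sobolev_conjugate G g p q "DIM('a)" s by (rule conj)
  define \<omega> where "\<omega> = unit_ball_vol DIM('a)"
  have \<omega>: "\<omega> > 0" by (simp add: \<omega>_def)
  define \<epsilon> where "\<epsilon> = (\<omega> / (2 * 2 powr qp)) powr (s / DIM('a)) / 2"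
  have "\<epsilon> > 0" using \<omega> by (simp add: \<epsilon>_def)
  from C.ess_slower_sobolev_conj[OF slower B.G_nonneg this]
  obtain T where T: "\<And>t. t \<ge> T \<Longrightarrow> B t \<le> G (\<epsilon> * t * B t powr (s / DIM('a)))"
    by (auto simp: eventually_at_top_linorder)
  obtain k0 where k0: "T < 2 ^ k0" using real_arch_pow[of 2 T] by auto
  obtain v where v [measurable]: "v \<in> borel_measurable borel" and eq: "AE x in lebesgue. u x = v x"
    using borel_representative[OF W_measurable[OF u]] by blast
  have vW: "v \<in> W" using W_cong_AE[OF u eq] by (simp add: measurable_lebesgueI)
  define X where "X = (LINT x|lebesgue. G (v x))"
  have X: "0 \<le> X" unfolding X_def by (intro integral_nonneg_AE AE_I2 G_nonneg)
  \<comment> \<open>The second entry makes the base bound hold through Chebyshev's inequality and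
    \<open>G c \<ge> c * G 1\<close>; the third brings the energy below \<omega>/4.\<close>
  define c where "c = max 1 (max (B (2 ^ k0) * X / G 1) (4 * modular v / \<omega>))"
  have c: "c \<ge> 1" "B (2 ^ k0) * X / G 1 \<le> c" "4 * modular v / \<omega> \<le> c" by (auto simp: c_def)
  define w where "w = (\<lambda>x. \<bar>v x / c\<bar>)"
  have w [measurable]: "w \<in> borel_measurable borel" unfolding w_def by measurable
  have \<rho>: "rho_sG s G w \<le> ennreal (\<omega> / 4)"
  proof -
    have "rho_sG s G w \<le> rho_sG s G (\<lambda>x. (1 / c) * v x)"
      unfolding rho_sG_slope
      by (intro nn_integral_mono ennreal_leI G_mono abs_slope_mono)
         (simp add: w_def abs_triangle_ineq3 del: abs_divide)
    also have "\<dots> = ennreal (modular (\<lambda>x. (1 / c) * v x))"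
      by (intro rho_sG_eq_modular W_cmult vW)
    also have "\<dots> \<le> ennreal ((1 / c)\<^sup>2 * modular v)"
      using c(1) by (intro ennreal_leI modular_scale_small vW) auto
    also have "\<dots> \<le> ennreal (\<omega> / 4)"
    proof (rule ennreal_leI)
      have "(1 / c)\<^sup>2 * modular v \<le> 1 / c * modular v"
        using c(1) modular_nonneg[of v] by (intro mult_right_mono) (auto simp: power2_eq_square field_simps)
      also have "\<dots> \<le> \<omega> / 4" using c \<omega> by (simp add: field_simps)
      finally show "(1 / c)\<^sup>2 * modular v \<le> \<omega> / 4" .
    qed
    finally show ?thesis .
  qed
  have base: "ennreal (B (2 ^ k0)) * emeasure lborel (level w k0) \<le> 1"
  proof -
    have "ennreal (c * G 1) * emeasure lborel (level w k0) = (\<integral>\<^sup>+ x. ennreal (c * G 1) * indicator (level w k0) x \<partial>lborel)"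
      by (simp add: nn_integral_cmult)
    also have "\<dots> \<le> (\<integral>\<^sup>+ x. ennreal (G (v x)) \<partial>lborel)"
    proof (rule nn_integral_mono)
      fix x
      show "ennreal (c * G 1) * indicator (level w k0) x \<le> ennreal (G (v x))"
      proof (cases "x \<in> level w k0")
        case True
        then have "2 ^ k0 < \<bar>v x\<bar> / c" using c(1) by (simp add: level_def w_def)
        moreover have "(1 :: real) \<le> 2 ^ k0" by simp
        ultimately have "1 < \<bar>v x\<bar> / c" by linarith
        then have "c \<le> \<bar>v x\<bar>" using c(1) by (simp add: field_simps)
        then have "G c \<le> G (v x)" using c(1) by (intro G_mono) auto
        moreover have "G (1 / c * c) \<le> 1 / c * G c" using c(1) by (intro G_scale_le) auto
        ultimately have "c * G 1 \<le> G (v x)" using c(1) by (simp add: field_simps)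
        then show ?thesis using True by (simp add: ennreal_leI)
      qed simp
    qed
    also have "\<dots> = ennreal X"
      using rho_G_eq_integral[OF vW] by (simp add: rho_G_alt X_def nn_integral_completion)
    finally have *: "ennreal (c * G 1) * emeasure lborel (level w k0) \<le> ennreal X" .
    have G1: "G 1 > 0" by (simp add: G_pos)
    have "ennreal (B (2 ^ k0)) * (ennreal (c * G 1) * emeasure lborel (level w k0)) \<le> ennreal (B (2 ^ k0)) * ennreal X"
      by (intro mult_left_mono *) auto
    also have "\<dots> \<le> ennreal (c * G 1) * 1"
      using c(2) G1 X by (simp add: ennreal_mult'[symmetric] B.G_nonneg ennreal_leI field_simps)
    finally have "ennreal (c * G 1) * (ennreal (B (2 ^ k0)) * emeasure lborel (level w k0)) \<le> ennreal (c * G 1) * 1"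
      by (simp add: mult.left_commute)
    then show ?thesis
      using c(1) G1 by (subst (asm) ennreal_mult_le_mult_iff) (auto simp: ennreal_eq_0_iff mult_le_0_iff)
  qed
  have "(\<integral>\<^sup>+ x. ennreal (indicator \<Omega> x * B (w x)) \<partial>lborel) < \<infinity>"
  proof (rule integrable_of_level_decay[OF B w _ _ \<Omega>(2) _ _ base])
    show "B t \<le> G ((unit_ball_vol (real DIM('a)) / (2 * 2 powr qp)) powr (s / real DIM('a)) / 2 * t * B t powr (s / real DIM('a)))"
      if "2 ^ k0 \<le> t" for t using T[of t] that k0 by (simp add: \<epsilon>_def \<omega>_def)
    show "rho_sG s G w \<le> ennreal (unit_ball_vol (real DIM('a)) / 4)" using \<rho> by (simp add: \<omega>_def)
  qed (use \<Omega> in \<open>auto simp: w_def\<close>)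
  then have "integrable lborel (\<lambda>x. indicator \<Omega> x * B (w x))"
    using \<Omega>(1) by (intro integrableI_bounded) (auto simp: B.G_nonneg)
  then have int: "integrable lebesgue (\<lambda>x. indicator \<Omega> x * B (w x))"
    using \<Omega>(1) by (subst integrable_completion) auto
  show ?thesis
  proof (rule Bochner_Integration.integrable_bound[OF integrable_mult_right[OF int, of "(1 + c) powr qp"]])
    show "(\<lambda>x. indicator \<Omega> x * B (u x)) \<in> borel_measurable lebesgue"
      using \<Omega>(1) W_measurable[OF u]
      by (intro borel_measurable_times borel_measurable_indicator measurable_compose[OF _ B.measurable_G]) auto
    show "AE x in lebesgue. norm (indicator \<Omega> x * B (u x)) \<le> norm ((1 + c) powr qp * (indicator \<Omega> x * B (w x)))"
      using eq
    proof eventually_elim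
      case (elim x)
      have "B (v x) \<le> (1 + c) powr qp * B (w x)"
        using B.G_scale_bound[of c "v x / c"] c(1) B.G_abs[of "v x / c"] by (simp add: w_def)
      then show ?case using elim by (auto simp: indicator_def B.G_nonneg)
    qed
  qed
qed

end

section \<open>Smooth functions and convolutions\<close>

lemma Ck_SucI:
  assumes "\<And>x. (f has_derivative f' x) (at x)" "\<And>h. Ck k (\<lambda>x. f' x h)"
  shows "Ck (Suc k) f"
proof -
  have "frechet_derivative f (at x) = f' x" for x using frechet_derivative_at[OF assms(1)] by simp
  then show ?thesis using assms by (auto simp: differentiable_def)
qed

lemma Ck_Suc_derivative: "Ck (Suc k) f \<Longrightarrow> (f has_derivative frechet_derivative f (at x)) (at x)"
  by (simp add: frechet_derivative_works[symmetric])

lemma Ck_SucD: "Ck (Suc k) f \<Longrightarrow> Ck k f"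
proof (induction k arbitrary: f)
  case 0
  then show ?case by (auto intro: continuous_at_imp_continuous_on differentiable_imp_continuous_within)
next
  case (Suc k)
  then show ?case by (metis Ck.simps(2))
qed

lemma Ck_const: "Ck k (\<lambda>x. c)"
proof (induction k arbitrary: c)
  case (Suc k)
  then show ?case by (intro Ck_SucI[where f' = "\<lambda>x h. 0"]) auto
qed simp

lemma Ck_add: "Ck k f \<Longrightarrow> Ck k g \<Longrightarrow> Ck k (\<lambda>x. f x + g x)"
proof (induction k arbitrary: f g)
  case 0 then show ?case by (auto intro: continuous_on_add)
next
  case (Suc k)
  show ?case
  proof (rule Ck_SucI)
    show "((\<lambda>x. f x + g x) has_derivative (\<lambda>h. frechet_derivative f (at x) h + frechet_derivative g (at x) h)) (at x)" for x
      using Suc.prems by (intro has_derivative_add Ck_Suc_derivative)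
  qed (use Suc in auto)
qed

lemma Ck_mult: "Ck k f \<Longrightarrow> Ck k g \<Longrightarrow> Ck k (\<lambda>x. f x * g x)"
proof (induction k arbitrary: f g)
  case 0 then show ?case by (auto intro: continuous_on_mult)
next
  case (Suc k)
  show ?case
  proof (rule Ck_SucI)
    show "((\<lambda>x. f x * g x) has_derivative (\<lambda>h. f x * frechet_derivative g (at x) h + frechet_derivative f (at x) h * g x)) (at x)" for x
      using Suc.prems by (intro has_derivative_mult Ck_Suc_derivative)
    have "Ck k f" "Ck k g" using Suc.prems by (auto simp del: Ck.simps intro: Ck_SucD)
    then show "Ck k (\<lambda>x. f x * frechet_derivative g (at x) h + frechet_derivative f (at x) h * g x)" for h
      using Suc by (intro Ck_add Suc.IH) auto
  qed
qed

lemma Ck_inner: "Ck k (\<lambda>x. x \<bullet> a)"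
proof (cases k)
  case (Suc k)
  then show ?thesis by (auto intro!: Ck_SucI[where f' = "\<lambda>x h. h \<bullet> a"] Ck_const derivative_eq_intros simp del: Ck.simps)
qed (auto intro!: continuous_intros)

section \<open>Smooth bump functions\<close>

definition flat_exp :: "nat \<Rightarrow> real \<Rightarrow> real" where
  "flat_exp k t = (if 0 < t then (1 / t) ^ k * exp (- (1 / t)) else 0)"

lemma flat_exp_tendsto_0: "(flat_exp k \<longlongrightarrow> 0) (at 0)"
proof -
  have "((\<lambda>t. inverse t ^ k / exp (inverse t)) \<longlongrightarrow> 0) (at_right (0::real))"
    by (rule filterlim_compose[OF tendsto_power_div_exp_0 filterlim_inverse_at_top_right])
  moreover have "eventually (\<lambda>t. inverse t ^ k / exp (inverse t) = flat_exp k t) (at_right (0::real))"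
    using eventually_at_right_less[of 0]
    by eventually_elim (simp add: flat_exp_def exp_minus inverse_eq_divide)
  ultimately have "(flat_exp k \<longlongrightarrow> 0) (at_right 0)" by (rule Lim_transform_eventually)
  moreover have "(flat_exp k \<longlongrightarrow> 0) (at_left 0)"
    by (rule tendsto_eventually) (auto simp: flat_exp_def eventually_at_filter)
  ultimately show ?thesis by (simp add: filterlim_at_split)
qed

text \<open>The derivative stays in the linear span of the family, which is what drives the
  induction on the order of smoothness. At 0 the difference quotient is itself the next member of
  the family.\<close>

lemma DERIV_flat_exp:
  "(flat_exp k has_real_derivative flat_exp (k + 2) t - real k * flat_exp (k + 1) t) (at t)"
proof -
  consider "t > 0" | "t < 0" | "t = 0" by linarith
  then show ?thesis
  proof cases
    case 1
    have pw: "real k * (1 / t) ^ (k - 1) * (1 / t)\<^sup>2 = real k * (1 / t) ^ (k + 1)"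
      by (cases k) (auto simp: power2_eq_square)
    have inv: "((\<lambda>t. 1 / t) has_real_derivative - ((1 / t)\<^sup>2)) (at t)"
      using 1 by (auto intro!: derivative_eq_intros simp: power2_eq_square)
    have "((\<lambda>t. (1 / t) ^ k * exp (- (1 / t))) has_real_derivative
        real k * (1 / t) ^ (k - 1) * (- ((1 / t)\<^sup>2)) * exp (- (1 / t)) + (1 / t) ^ k * (exp (- (1 / t)) * (1 / t)\<^sup>2)) (at t)"
      by (rule DERIV_cong[OF DERIV_mult[OF DERIV_power[OF inv] DERIV_chain2[OF DERIV_exp DERIV_minus[OF inv]]]])
         (simp add: algebra_simps)
    also have "real k * (1 / t) ^ (k - 1) * (- ((1 / t)\<^sup>2)) * exp (- (1 / t)) + (1 / t) ^ k * (exp (- (1 / t)) * (1 / t)\<^sup>2)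
        = flat_exp (k + 2) t - real k * flat_exp (k + 1) t"
      using 1 pw by (simp add: flat_exp_def algebra_simps power2_eq_square)
    finally show ?thesis
      by (rule has_field_derivative_transform_within_open[where S = "{0<..}"]) (use 1 in \<open>auto simp: flat_exp_def\<close>)
  next
    case 2
    have "((\<lambda>t. 0) has_real_derivative 0) (at t)" by simp
    then have "(flat_exp k has_real_derivative 0) (at t)"
      by (rule has_field_derivative_transform_within_open[where S = "{..<0}"]) (use 2 in \<open>auto simp: flat_exp_def\<close>)
    then show ?thesis using 2 by (simp add: flat_exp_def)
  next
    case 3
    have "(\<lambda>h. (flat_exp k (0 + h) - flat_exp k 0) / h) = (\<lambda>h. flat_exp (Suc k) h)"
      by (auto simp: flat_exp_def fun_eq_iff)
    moreover have "flat_exp j 0 = 0" for j by (simp add: flat_exp_def)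
    ultimately show ?thesis using flat_exp_tendsto_0[of "Suc k"]
      unfolding DERIV_def 3 by simp
  qed
qed

text \<open>Using the squared distance keeps the inner function polynomial, so smoothness at the
  centre needs no separate treatment. The index \<open>k\<close> varies because differentiation
  raises it.\<close>

lemma Ck_flat_exp:
  fixes a :: "'a::euclidean_space"
  shows "Ck m (\<lambda>x. flat_exp k (c - (x - a) \<bullet> (x - a)))"
proof (induction m arbitrary: k)
  case 0
  have "continuous_on UNIV (flat_exp k)"
    using DERIV_flat_exp by (intro continuous_at_imp_continuous_on ballI) (rule DERIV_isCont)
  then show ?case by (auto intro!: continuous_on_compose2[of UNIV "flat_exp k"] continuous_intros)
next
  case (Suc m)
  define f' where "f' x h = (flat_exp (k + 2) (c - (x - a) \<bullet> (x - a)) + (- real k) * flat_exp (k + 1) (c - (x - a) \<bullet> (x - a))) *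
      ((-2) * (x \<bullet> h + (-1) * (a \<bullet> h)))" for x h
  show ?case
  proof (rule Ck_SucI)
    show "((\<lambda>x. flat_exp k (c - (x - a) \<bullet> (x - a))) has_derivative f' x) (at x)" for x
    proof -
      have "((\<lambda>x. c - (x - a) \<bullet> (x - a)) has_derivative (\<lambda>h. - 2 * ((x - a) \<bullet> h))) (at x)"
        by (auto intro!: derivative_eq_intros simp: inner_commute algebra_simps)
      from has_derivative_compose[OF this DERIV_flat_exp[unfolded has_field_derivative_def]]
      show ?thesis unfolding f'_def by (rule has_derivative_eq_rhs) (simp add: fun_eq_iff algebra_simps inner_diff_left)
    qed
    show "Ck m (\<lambda>x. f' x h)" for h
      unfolding f'_def by (intro Ck_mult Ck_add Ck_const Suc Ck_inner)
  qed
qed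

lemma exists_bump:
  fixes a :: "'a::euclidean_space"
  assumes r: "0 < r"
  obtains \<psi> where "smooth \<psi>" "\<And>x. 0 \<le> \<psi> x" "\<And>x. x \<notin> ball a r \<Longrightarrow> \<psi> x = 0"
    "integrable lborel \<psi>" "(LINT x|lborel. \<psi> x) = 1"
proof -
  define f where "f x = flat_exp 0 (r\<^sup>2 - (x - a) \<bullet> (x - a))" for x
  have f_smooth: "Ck k f" for k unfolding f_def by (rule Ck_flat_exp)
  have f_cont: "continuous_on UNIV f" using f_smooth[of 0] by simp
  have [measurable]: "f \<in> borel_measurable borel" by (rule borel_measurable_continuous_onI[OF f_cont])
  have f_nonneg: "0 \<le> f x" for x by (simp add: f_def flat_exp_def)
  have f_out: "f x = 0" if "x \<notin> ball a r" for x
  proof -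
    have "r \<le> norm (x - a)" using that by (simp add: dist_norm norm_minus_commute)
    then have "r\<^sup>2 \<le> (x - a) \<bullet> (x - a)" using r by (simp add: power2_norm_eq_inner[symmetric] power_mono)
    then show ?thesis by (simp add: f_def flat_exp_def)
  qed
  have f_le: "f x \<le> indicator (ball a r) x" for x
    using f_out[of x] by (cases "x \<in> ball a r") (auto simp: f_def flat_exp_def)
  have f_int: "integrable lborel f"
  proof (rule Bochner_Integration.integrable_bound)
    show "integrable lborel (indicator (ball a r) :: 'a \<Rightarrow> real)"
      by (intro integrable_real_indicator emeasure_bounded_finite) auto
    show "AE x in lborel. norm (f x) \<le> norm (indicator (ball a r) x :: real)"
      using f_le f_nonneg by (intro AE_I2) (simp add: abs_of_nonneg)
  qed simp
  have pos: "0 < (LINT x|lborel. f x)"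
  proof -
    have "(LINT x|lborel. f x) \<noteq> 0"
    proof
      assume "(LINT x|lborel. f x) = 0"
      then have "AE x in lborel. f x = 0"
        using integral_nonneg_eq_0_iff_AE[OF f_int] f_nonneg by simp
      then have "AE x in lborel. x \<notin> ball a r"
      proof eventually_elim
        case (elim x)
        show ?case
        proof
          assume "x \<in> ball a r"
          then have "norm (x - a) < r" by (simp add: dist_norm norm_minus_commute)
          then have "(norm (x - a))\<^sup>2 < r\<^sup>2" using r by (intro power_strict_mono) auto
          then have "(x - a) \<bullet> (x - a) < r\<^sup>2" by (simp add: power2_norm_eq_inner)
          then show False using elim by (simp add: f_def flat_exp_def)
        qed
      qed
      then have "emeasure lborel (ball a r) = 0"
        by (subst (asm) AE_iff_measurable[OF _ refl]) (auto simp: ball_def)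
      moreover have "0 < unit_ball_vol DIM('a) * r ^ DIM('a)" using r by (intro mult_pos_pos) auto
      ultimately show False using r by (simp add: emeasure_ball ennreal_eq_0_iff)
    qed
    moreover have "0 \<le> (LINT x|lborel. f x)" by (intro integral_nonneg_AE AE_I2 f_nonneg)
    ultimately show ?thesis by simp
  qed
  define \<psi> where "\<psi> x = (1 / (LINT x|lborel. f x)) * f x" for x
  show ?thesis
  proof (rule that[of \<psi>])
    show "smooth \<psi>" unfolding smooth_def \<psi>_def by (intro allI Ck_mult Ck_const f_smooth)
    show "0 \<le> \<psi> x" for x using pos f_nonneg by (simp add: \<psi>_def)
    show "\<psi> x = 0" if "x \<notin> ball a r" for x using f_out[OF that] by (simp add: \<psi>_def)
    show "integrable lborel \<psi>" unfolding \<psi>_def using f_int by simp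
    show "(LINT x|lborel. \<psi> x) = 1" unfolding \<psi>_def using pos by simp
  qed
qed

section \<open>Uniform estimates for functions vanishing outside a ball\<close>

lemma smooth_derivative: "smooth f \<Longrightarrow> (f has_derivative frechet_derivative f (at x)) (at x)"
  unfolding smooth_def using Ck_Suc_derivative by blast

lemma smooth_frechet_derivative: "smooth f \<Longrightarrow> smooth (\<lambda>x. frechet_derivative f (at x) h)"
  unfolding smooth_def by (metis Ck.simps(2))

lemma smooth_continuous: "smooth f \<Longrightarrow> continuous_on UNIV f"
  unfolding smooth_def by (metis Ck.simps(1))

lemma frechet_derivative_outside:
  assumes "\<And>x. x \<notin> cball a R \<Longrightarrow> f x = 0" "x \<notin> cball a R"
  shows "frechet_derivative f (at x) h = 0"
proof -
  have "((\<lambda>_. 0) has_derivative (\<lambda>_. 0)) (at x)" by simp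
  then have "(f has_derivative (\<lambda>_. 0)) (at x)"
    by (rule has_derivative_transform_within_open[where s = "- cball a R"]) (use assms in auto)
  then show ?thesis using frechet_derivative_at[of f "\<lambda>_. 0" x] by metis
qed

lemma uniformly_continuous_vanishing:
  fixes f :: "'a::euclidean_space \<Rightarrow> real"
  assumes f: "continuous_on UNIV f" "\<And>x. x \<notin> cball a R \<Longrightarrow> f x = 0" and e: "0 < e"
  obtains d where "0 < d" "\<And>x y. dist x y < d \<Longrightarrow> \<bar>f x - f y\<bar> < e"
proof -
  have "uniformly_continuous_on (cball a (R + 1)) f"
    by (rule compact_uniformly_continuous) (auto intro: continuous_on_subset[OF f(1)])
  then obtain d where d: "d > 0" "\<And>x y. x \<in> cball a (R + 1) \<Longrightarrow> y \<in> cball a (R + 1) \<Longrightarrow> dist x y < d \<Longrightarrow> dist (f x) (f y) < e"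
    unfolding uniformly_continuous_on_def using e by metis
  show ?thesis
  \<comment> \<open>Capping the distance by 1 guarantees that two points not both in the larger ball
    both lie outside the smaller one, where \<open>f\<close> is 0.\<close>
  proof (rule that[of "min d 1"])
    fix x y :: 'a assume xy: "dist x y < min d 1"
    show "\<bar>f x - f y\<bar> < e"
    proof (cases "x \<in> cball a (R + 1) \<and> y \<in> cball a (R + 1)")
      case True
      then show ?thesis using d(2)[of x y] xy by (simp add: dist_real_def)
    next
      case False
      have "dist a x \<le> dist a y + dist x y" "dist a y \<le> dist a x + dist x y"
        by (metis add.commute dist_commute dist_triangle)+
      then have "x \<notin> cball a R" "y \<notin> cball a R" using False xy by auto
      then show ?thesis using f(2) e by simp
    qed
  qed (use d in auto)
qed

lemma bounded_vanishing:
  fixes f :: "'a::euclidean_space \<Rightarrow> real"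
  assumes f: "continuous_on UNIV f" "\<And>x. x \<notin> cball a R \<Longrightarrow> f x = 0"
  obtains M where "0 < M" "\<And>x. \<bar>f x\<bar> \<le> M"
proof -
  have "compact (f ` cball a R)"
    by (intro compact_continuous_image continuous_on_subset[OF f(1)]) auto
  then obtain M where M: "M > 0" "\<And>y. y \<in> f ` cball a R \<Longrightarrow> norm y \<le> M"
    using compact_imp_bounded bounded_pos by metis
  show ?thesis
  proof (rule that[of M])
    fix x show "\<bar>f x\<bar> \<le> M" using M f(2)[of x] by (cases "x \<in> cball a R") auto
  qed (rule M)
qed

text \<open>The mean value theorem on the segment reduces the error to the variation of the partial
  derivatives, finitely many uniformly continuous functions. Uniformity in \<open>y\<close> is what
  permits differentiation under the integral.\<close>

lemma uniform_derivative:
  fixes f :: "'a::euclidean_space \<Rightarrow> real"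
  assumes f: "smooth f" "\<And>x. x \<notin> cball a R \<Longrightarrow> f x = 0" and e: "0 < e"
  obtains d where "0 < d"
    "\<And>y v. norm v < d \<Longrightarrow> \<bar>f (y + v) - f y - frechet_derivative f (at y) v\<bar> \<le> e * norm v"
proof -
  define D where "D i y = frechet_derivative f (at y) i" for i y
  define e' where "e' = e / DIM('a)"
  have e': "e' > 0" using e by (simp add: e'_def)
  have "\<exists>d>0. \<forall>x y. dist x y < d \<longrightarrow> \<bar>D i x - D i y\<bar> < e'" for i
  proof -
    have cont: "continuous_on UNIV (D i)"
      unfolding D_def by (rule smooth_continuous[OF smooth_frechet_derivative[OF f(1)]])
    have out: "\<And>x. x \<notin> cball a R \<Longrightarrow> D i x = 0"
      unfolding D_def by (rule frechet_derivative_outside[OF f(2)])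
    show ?thesis by (rule uniformly_continuous_vanishing[OF cont out e']) auto
  qed
  then obtain d where d: "\<And>i. d i > 0" "\<And>i x y. dist x y < d i \<Longrightarrow> \<bar>D i x - D i y\<bar> < e'" by metis
  define d0 where "d0 = Min (d ` Basis)"
  have d0: "d0 > 0" "\<And>i. i \<in> Basis \<Longrightarrow> d0 \<le> d i" using d(1) by (auto simp: d0_def)
  have D_sum: "frechet_derivative f (at y) v = (\<Sum>i\<in>Basis. (v \<bullet> i) * D i y)" for y v
  proof -
    have lin: "linear (frechet_derivative f (at y))" using smooth_derivative[OF f(1)] has_derivative_linear by blast
    have "frechet_derivative f (at y) (\<Sum>i\<in>Basis. (v \<bullet> i) *\<^sub>R i) = (\<Sum>i\<in>Basis. (v \<bullet> i) * D i y)"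
      unfolding linear_sum[OF lin] by (simp add: linear_scale[OF lin] D_def)
    then show ?thesis by (simp add: euclidean_representation)
  qed
  show ?thesis
  proof (rule that[OF d0(1)])
    fix y v :: 'a assume v: "norm v < d0"
    define \<phi> where "\<phi> t = f (y + t *\<^sub>R v)" for t :: real
    have "\<exists>t\<in>{0<..<1}. \<phi> 1 - \<phi> 0 = (\<lambda>h. frechet_derivative f (at (y + t *\<^sub>R v)) (h *\<^sub>R v)) (1 - 0)"
    proof (rule mvt_simple)
      fix t :: real
      have "((\<lambda>t. y + t *\<^sub>R v) has_derivative (\<lambda>h. h *\<^sub>R v)) (at t within {0..1})"
        by (auto intro!: derivative_eq_intros)
      then show "(\<phi> has_derivative (\<lambda>h. frechet_derivative f (at (y + t *\<^sub>R v)) (h *\<^sub>R v))) (at t within {0..1})"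
        unfolding \<phi>_def by (rule has_derivative_compose[OF _ smooth_derivative[OF f(1)]])
    qed simp
    then obtain t where t: "0 < t" "t < 1" "f (y + v) - f y = frechet_derivative f (at (y + t *\<^sub>R v)) v"
      by (auto simp: \<phi>_def)
    have "\<bar>f (y + v) - f y - frechet_derivative f (at y) v\<bar> = \<bar>\<Sum>i\<in>Basis. (v \<bullet> i) * (D i (y + t *\<^sub>R v) - D i y)\<bar>"
      unfolding t(3) D_sum by (simp add: sum_subtractf algebra_simps)
    also have "\<dots> \<le> (\<Sum>i\<in>Basis. \<bar>(v \<bullet> i) * (D i (y + t *\<^sub>R v) - D i y)\<bar>)"
      by (rule sum_abs)
    also have "\<dots> \<le> (\<Sum>i\<in>(Basis :: 'a set). norm v * e')"
    proof (rule sum_mono)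
      fix i :: 'a assume i: "i \<in> Basis"
      have "norm (t *\<^sub>R v) \<le> norm v" using t by (simp add: mult_left_le_one_le)
      then have "dist (y + t *\<^sub>R v) y < d i" using v d0(2)[OF i] by (simp add: dist_norm)
      then show "\<bar>(v \<bullet> i) * (D i (y + t *\<^sub>R v) - D i y)\<bar> \<le> norm v * e'"
        using d(2)[of "y + t *\<^sub>R v" y i] Basis_le_norm[OF i, of v] by (simp add: abs_mult mult_mono)
    qed
    also have "\<dots> = e * norm v" by (simp add: e'_def)
    finally show "\<bar>f (y + v) - f y - frechet_derivative f (at y) v\<bar> \<le> e * norm v" .
  qed
qed

section \<open>Convolution with a smooth kernel\<close>

lemma integrable_mult_vanishing:
  fixes w \<psi> :: "'a::euclidean_space \<Rightarrow> real"
  assumes w: "integrable lborel w" and \<psi>: "continuous_on UNIV \<psi>" "\<And>x. x \<notin> cball a R \<Longrightarrow> \<psi> x = 0"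
  shows "integrable lborel (\<lambda>z. w z * \<psi> (z - x))"
proof -
  obtain M where M: "0 < M" "\<And>x. \<bar>\<psi> x\<bar> \<le> M" using bounded_vanishing[OF \<psi>] by blast
  have \<psi>m: "(\<lambda>z. \<psi> (z - x)) \<in> borel_measurable borel"
    by (intro borel_measurable_continuous_onI continuous_on_compose2[OF \<psi>(1)] continuous_intros) auto
  show ?thesis
  proof (rule Bochner_Integration.integrable_bound[OF integrable_mult_left[OF w, of M]])
    show "(\<lambda>z. w z * \<psi> (z - x)) \<in> borel_measurable lborel"
      using \<psi>m borel_measurable_integrable[OF w] by (intro borel_measurable_times) auto
    show "AE z in lborel. norm (w z * \<psi> (z - x)) \<le> norm (w z * M)"
      using M by (intro AE_I2) (simp add: abs_mult mult_left_mono)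
  qed
qed

text \<open>The first order error of \<open>\<psi>\<close> is uniform in \<open>z\<close>, so it
  integrates against \<open>\<bar>w z\<bar>\<close>. The minus sign stems from the argument
  \<open>z - x\<close>.\<close>

lemma has_derivative_convolution:
  fixes w \<psi> :: "'a::euclidean_space \<Rightarrow> real"
  assumes w: "integrable lborel w" and \<psi>: "smooth \<psi>" "\<And>x. x \<notin> cball a R \<Longrightarrow> \<psi> x = 0"
  shows "((\<lambda>x. LINT z|lborel. w z * \<psi> (z - x)) has_derivative
    (\<lambda>v. - (LINT z|lborel. w z * frechet_derivative \<psi> (at (z - x)) v))) (at x)"
proof -
  let ?D = "\<lambda>v z. w z * frechet_derivative \<psi> (at (z - x)) v"
  have int: "integrable lborel (\<lambda>z. w z * \<psi> (z - x))" for x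
    by (rule integrable_mult_vanishing[OF w smooth_continuous[OF \<psi>(1)] \<psi>(2)])
  have intD: "integrable lborel (?D v)" for v
    by (rule integrable_mult_vanishing[OF w smooth_continuous[OF smooth_frechet_derivative[OF \<psi>(1)]] frechet_derivative_outside[OF \<psi>(2)]])
  have lin: "linear (frechet_derivative \<psi> (at y))" for y using smooth_derivative[OF \<psi>(1)] has_derivative_linear by blast
  have "linear (\<lambda>v. - (LINT z|lborel. ?D v z))"
  proof (rule linearI)
    fix u v :: 'a and c :: real
    show "- (LINT z|lborel. ?D (u + v) z) = - (LINT z|lborel. ?D u z) + - (LINT z|lborel. ?D v z)"
      using intD by (simp add: linear_add[OF lin] distrib_left)
    show "- (LINT z|lborel. ?D (c *\<^sub>R v) z) = c *\<^sub>R (- (LINT z|lborel. ?D v z))"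
      by (simp add: linear_scale[OF lin] mult.left_commute)
  qed
  then have bl: "bounded_linear (\<lambda>v. - (LINT z|lborel. ?D v z))" by (simp add: linear_conv_bounded_linear)
  define A where "A = (LINT z|lborel. \<bar>w z\<bar>)"
  have A: "0 \<le> A" by (simp add: A_def)
  show ?thesis
    unfolding has_derivative_within_alt
  proof (intro conjI bl allI impI)
    fix e :: real assume e: "0 < e"
    \<comment> \<open>The summand 1 covers the case that the L1 norm \<open>A\<close> of
      \<open>w\<close> is 0.\<close>
    have "0 < e / (A + 1)" using e A by simp
    then obtain d where d: "0 < d"
      "\<And>y v. norm v < d \<Longrightarrow> \<bar>\<psi> (y + v) - \<psi> y - frechet_derivative \<psi> (at y) v\<bar> \<le> e / (A + 1) * norm v"
      using uniform_derivative[OF \<psi>] by blast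
    have "norm ((LINT z|lborel. w z * \<psi> (z - y)) - (LINT z|lborel. w z * \<psi> (z - x)) - - (LINT z|lborel. ?D (y - x) z))
        \<le> e * norm (y - x)" if "norm (y - x) < d" for y
    proof -
      have pw: "\<bar>\<psi> (z - y) - \<psi> (z - x) + frechet_derivative \<psi> (at (z - x)) (y - x)\<bar> \<le> e / (A + 1) * norm (y - x)" for z
        using d(2)[of "- (y - x)" "z - x"] that linear_neg[OF lin, of "z - x" "y - x"] by (simp add: norm_minus_commute)
      define P where "P z = \<psi> (z - y) - \<psi> (z - x) + frechet_derivative \<psi> (at (z - x)) (y - x)" for z
      have wP: "(\<lambda>z. w z * P z) = (\<lambda>z. w z * \<psi> (z - y) - w z * \<psi> (z - x) + ?D (y - x) z)"
        by (simp add: P_def distrib_left right_diff_distrib)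
      have intP: "integrable lborel (\<lambda>z. w z * P z)"
        unfolding wP by (intro Bochner_Integration.integrable_add Bochner_Integration.integrable_diff int intD)
      have "(LINT z|lborel. w z * \<psi> (z - y)) - (LINT z|lborel. w z * \<psi> (z - x)) - - (LINT z|lborel. ?D (y - x) z)
          = (LINT z|lborel. w z * P z)"
        unfolding wP using int intD by simp
      also have "norm \<dots> \<le> (LINT z|lborel. norm (w z * P z))"
        by (rule integral_norm_bound)
      also have "\<dots> \<le> (LINT z|lborel. \<bar>w z\<bar> * (e / (A + 1) * norm (y - x)))"
      proof (rule integral_mono)
        show "norm (w z * P z) \<le> \<bar>w z\<bar> * (e / (A + 1) * norm (y - x))" for z
          unfolding real_norm_def abs_mult P_def by (intro mult_left_mono pw) simp
      qed (use w intP in auto)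
      also have "\<dots> = A / (A + 1) * e * norm (y - x)" by (simp add: A_def)
      also have "\<dots> \<le> 1 * e * norm (y - x)" using A e by (intro mult_right_mono) auto
      finally show ?thesis by simp
    qed
    then show "\<exists>d>0. \<forall>y\<in>UNIV. norm (y - x) < d \<longrightarrow>
        norm ((LINT z|lborel. w z * \<psi> (z - y)) - (LINT z|lborel. w z * \<psi> (z - x)) - - (LINT z|lborel. ?D (y - x) z)) \<le> e * norm (y - x)"
      using d(1) by blast
  qed
qed

text \<open>The induction generalises \<open>\<psi>\<close>: a directional derivative of the
  convolution is, up to sign, the convolution with the derivative of \<open>\<psi>\<close>, which
  again vanishes outside the same ball.\<close>

lemma smooth_convolution:
  fixes w \<psi> :: "'a::euclidean_space \<Rightarrow> real"
  assumes w: "integrable lborel w" and \<psi>: "smooth \<psi>" "\<And>x. x \<notin> cball a R \<Longrightarrow> \<psi> x = 0"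
  shows "smooth (\<lambda>x. LINT z|lborel. w z * \<psi> (z - x))"
proof -
  have "Ck k (\<lambda>x. LINT z|lborel. w z * \<psi> (z - x))" for k
    using \<psi>
  proof (induction k arbitrary: \<psi>)
    case 0
    have "isCont (\<lambda>x. LINT z|lborel. w z * \<psi> (z - x)) x" for x
      by (rule has_derivative_continuous[OF has_derivative_convolution[OF w 0]])
    then show ?case by (simp add: continuous_at_imp_continuous_on)
  next
    case (Suc k)
    show ?case
    proof (rule Ck_SucI[OF has_derivative_convolution[OF w Suc.prems]])
      fix h
      have "Ck k (\<lambda>x. (-1) * (LINT z|lborel. w z * frechet_derivative \<psi> (at (z - x)) h))"
        by (intro Ck_mult Ck_const Suc.IH smooth_frechet_derivative Suc.prems frechet_derivative_outside[OF Suc.prems(2)])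
      then show "Ck k (\<lambda>x. - (LINT z|lborel. w z * frechet_derivative \<psi> (at (z - x)) h))" by simp
    qed
  qed
  then show ?thesis by (simp add: smooth_def)
qed

section \<open>Cut-off and test functions\<close>

text \<open>Each point is charged to one ball of the cover, so \<open>f\<close> is dominated by the
  sum of the constants \<open>c k\<close> on these balls, whose volumes are proportional to
  \<open>R k ^ DIM('a)\<close>.\<close>

lemma nn_integral_dyadic_finite:
  fixes f :: "'a::euclidean_space \<Rightarrow> real" and R c :: "nat \<Rightarrow> real"
  assumes cover: "\<And>z. 0 < f z \<Longrightarrow> \<exists>k. norm z \<le> R k \<and> f z \<le> c k"
    and nonneg: "\<And>k. 0 \<le> R k" "\<And>k. 0 \<le> c k"
    and sum: "summable (\<lambda>k. c k * R k ^ DIM('a))"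
  shows "(\<integral>\<^sup>+ z. ennreal (f z) \<partial>lborel) < \<infinity>"
proof -
  have "(\<integral>\<^sup>+ z. ennreal (f z) \<partial>lborel) \<le> (\<integral>\<^sup>+ z. (\<Sum>k. ennreal (c k) * indicator (cball (0::'a) (R k)) z) \<partial>lborel)"
  proof (rule nn_integral_mono)
    fix z
    show "ennreal (f z) \<le> (\<Sum>k. ennreal (c k) * indicator (cball 0 (R k)) z)"
    proof (cases "0 < f z")
      case True
      then obtain k where k: "norm z \<le> R k" "f z \<le> c k" using cover by blast
      define F where "F k = ennreal (c k) * indicator (cball 0 (R k)) z" for k
      have "ennreal (f z) \<le> F k" using k by (simp add: F_def ennreal_leI)
      also have "F k \<le> suminf F" using sum_le_suminf[of F "{k}"] by simp
      finally show ?thesis unfolding F_def .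
    qed (simp add: ennreal_neg)
  qed
  also have "\<dots> = (\<Sum>k. ennreal (c k) * emeasure lborel (cball (0::'a) (R k)))"
  proof (subst nn_integral_suminf)
    show "(\<lambda>z. ennreal (c i) * indicator (cball (0::'a) (R i)) z) \<in> borel_measurable lborel" for i
      by (intro borel_measurable_times_ennreal borel_measurable_const borel_measurable_indicator) simp
  qed (simp add: nn_integral_cmult_indicator)
  also have "\<dots> = (\<Sum>k. ennreal (unit_ball_vol DIM('a) * (c k * R k ^ DIM('a))))"
    using nonneg by (simp add: emeasure_cball ennreal_mult'[symmetric] mult_ac)
  also have "\<dots> = ennreal (\<Sum>k. unit_ball_vol DIM('a) * (c k * R k ^ DIM('a)))"
    using nonneg sum by (intro suminf_ennreal2 summable_mult) auto
  finally show ?thesis by (simp add: le_less_trans)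
qed

lemma power_powr_swap: "0 \<le> x \<Longrightarrow> (x ^ k) powr s = (x powr s) ^ k" for x :: real
  by (induction k) (simp_all add: powr_mult)

lemma dyadic_scale_ge_1:
  fixes x :: real assumes "1 \<le> x" obtains k where "2 ^ k \<le> x" "x \<le> 2 ^ Suc k"
proof -
  obtain N where N: "x < 2 ^ N" using real_arch_pow[of 2 x] by auto
  define S where "S = {k. 2 ^ k \<le> x}"
  have "k < N" if "k \<in> S" for k
    using that N le_less_trans[of "2 ^ k" x "2 ^ N"] by (simp add: S_def)
  then have S: "finite S" "S \<noteq> {}" using assms by (auto simp: S_def intro: finite_subset[of _ "{..<N}"] exI[of _ 0])
  have "Max S \<in> S" by (rule Max_in[OF S])
  moreover have "Suc (Max S) \<notin> S" using Max_ge[OF S(1), of "Suc (Max S)"] by auto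
  ultimately show ?thesis using that[of "Max S"] by (simp add: S_def)
qed

text \<open>The two pieces are the parts inside and outside the unit ball, bounded on dyadic shells.\<close>

lemma kernel_finite:
  assumes s: "0 < s" "s < 1"
  shows "(\<integral>\<^sup>+ z. ennreal (min 1 (norm z) / norm z powr s / norm (z::'a::euclidean_space) ^ DIM('a)) \<partial>lborel) < \<infinity>"
proof -
  let ?n = "DIM('a)"
  define f1 :: "'a \<Rightarrow> real" where "f1 z = (if norm z \<le> 1 then norm z / norm z powr s / norm z ^ ?n else 0)" for z
  define f2 :: "'a \<Rightarrow> real" where "f2 z = (if 1 < norm z then 1 / norm z powr s / norm z ^ ?n else 0)" for z
  have half: "(1/2) powr s < (1::real)" "0 < (1/2::real) powr s" "1/2 < (1/2::real) powr s"
  proof -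
    show "(1/2) powr s < (1::real)" using powr_less_mono2_neg[of "-s" "1/2" 1] powr_less_mono'[of "1/2" 0 s] s by simp
    show "1/2 < (1/2::real) powr s" using powr_less_mono'[of "1/2" s 1] s by simp
  qed simp
  have "(\<integral>\<^sup>+ z. ennreal (f1 z) \<partial>lborel) < \<infinity>"
  proof (rule nn_integral_dyadic_finite[where R = "\<lambda>k. (1/2) ^ k" and
        c = "\<lambda>k. (1/2) ^ k / ((1/2) ^ Suc k) powr s / ((1/2) ^ Suc k) ^ ?n"])
    fix z assume "0 < f1 z"
    then have z: "0 < norm z" "norm z \<le> 1" by (auto simp: f1_def split: if_splits)
    obtain k where k: "2 ^ k \<le> inverse (norm z)" "inverse (norm z) \<le> 2 ^ Suc k"
      using dyadic_scale_ge_1[of "inverse (norm z)"] z by (auto simp: one_le_inverse_iff)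
    have le: "norm z \<le> (1/2) ^ k" "(1/2) ^ Suc k \<le> norm z"
      using k z by (simp_all add: power_divide field_simps)
    have "norm z / norm z powr s / norm z ^ ?n \<le> (1/2) ^ k / ((1/2) ^ Suc k) powr s / ((1/2) ^ Suc k) ^ ?n"
      by (intro frac_le powr_mono2 power_mono le) (use s in auto)
    then show "\<exists>k. norm z \<le> (1/2) ^ k \<and> f1 z \<le> (1/2) ^ k / ((1/2) ^ Suc k) powr s / ((1/2) ^ Suc k) ^ ?n"
      using z le by (auto simp: f1_def)
  next
    \<comment> \<open>A geometric series whose ratio is \<open>1/2\<close> to the power
      \<open>1 - s\<close>, summable because \<open>s < 1\<close>. For the outer part the ratio will
      be \<open>(1/2) powr s\<close>, summable because \<open>s > 0\<close>.\<close>
    have eq: "(1/2) ^ k / ((1/2) ^ Suc k) powr s / ((1/2) ^ Suc k) ^ ?n * ((1/2) ^ k) ^ ?n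
        = 2 ^ ?n / (1/2) powr s * ((1/2) / (1/2) powr s) ^ k" for k :: nat
    proof -
      have "((1/2::real) ^ Suc k) powr s = ((1/2) powr s) ^ Suc k" by (rule power_powr_swap) simp
      moreover have "((1/2::real) ^ Suc k) ^ ?n = (1/2) ^ ?n * ((1/2) ^ k) ^ ?n" by (simp only: power_Suc power_mult_distrib)
      ultimately show ?thesis using half(2) by (simp only:) (simp add: power_divide)
    qed
    show "summable (\<lambda>k. (1/2) ^ k / ((1/2) ^ Suc k) powr s / ((1/2) ^ Suc k) ^ ?n * ((1/2) ^ k) ^ ?n)"
      unfolding eq using half by (intro summable_mult summable_geometric) simp
  qed auto
  moreover have "(\<integral>\<^sup>+ z. ennreal (f2 z) \<partial>lborel) < \<infinity>"
  proof (rule nn_integral_dyadic_finite[where R = "\<lambda>k. 2 ^ Suc k" and c = "\<lambda>k. 1 / (2 ^ k) powr s / (2 ^ k) ^ ?n"])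
    fix z assume "0 < f2 z"
    then have z: "1 < norm z" by (auto simp: f2_def split: if_splits)
    obtain k where k: "2 ^ k \<le> norm z" "norm z \<le> 2 ^ Suc k"
      using dyadic_scale_ge_1[of "norm z"] z by auto
    have "1 / norm z powr s / norm z ^ ?n \<le> 1 / (2 ^ k) powr s / (2 ^ k) ^ ?n"
      by (intro frac_le powr_mono2 power_mono k) (use s in auto)
    then show "\<exists>k. norm z \<le> 2 ^ Suc k \<and> f2 z \<le> 1 / (2 ^ k) powr s / (2 ^ k) ^ ?n"
      using z k by (auto simp: f2_def)
  next
    have eq: "1 / (2 ^ k) powr s / (2 ^ k) ^ ?n * (2 ^ Suc k) ^ ?n = 2 ^ ?n * ((1/2) powr s) ^ k" for k :: nat
      by (simp add: power_powr_swap powr_divide power_divide power_mult_distrib)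
    show "summable (\<lambda>k. 1 / (2 ^ k) powr s / (2 ^ k) ^ ?n * (2 ^ Suc k) ^ ?n)"
      unfolding eq using half by (intro summable_mult summable_geometric) simp
  qed auto
  moreover have "(\<integral>\<^sup>+ z. ennreal (min 1 (norm z) / norm z powr s / norm (z::'a) ^ ?n) \<partial>lborel)
      \<le> (\<integral>\<^sup>+ z. ennreal (f1 z) + ennreal (f2 z) \<partial>lborel)"
    by (intro nn_integral_mono) (auto simp: f1_def f2_def min_def)
  moreover have "(\<integral>\<^sup>+ z. ennreal (f1 z) + ennreal (f2 z) \<partial>lborel) = (\<integral>\<^sup>+ z. ennreal (f1 z) \<partial>lborel) + (\<integral>\<^sup>+ z. ennreal (f2 z) \<partial>lborel)"
  proof (rule nn_integral_add)
    have [measurable]: "(\<lambda>z::'a. norm z powr s) \<in> borel_measurable borel"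
      by (intro powr_real_measurable) auto
    show "(\<lambda>x. ennreal (f1 x)) \<in> borel_measurable lborel" "(\<lambda>x. ennreal (f2 x)) \<in> borel_measurable lborel"
      unfolding f1_def f2_def by measurable
  qed
  ultimately show ?thesis by (auto simp: le_less_trans)
qed

section \<open>Cut-off functions, and test functions as members of \<open>W\<close>\<close>

context fractional_Orlicz_Sobolev
begin

text \<open>Models the difference quotient of a bounded Lipschitz function: the distance counts when
  it is small, the bound 1 when it is large.\<close>

definition near :: "'a::euclidean_space \<times> 'a \<Rightarrow> real" where
  "near z = min 1 (dist (fst z) (snd z)) / dist (fst z) (snd z) powr s"

lemma near_bounds: "0 \<le> near z" "near z \<le> 1"
proof -
  show "near z \<le> 1"
  proof (cases "dist (fst z) (snd z) = 0")
    case False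
    then have d: "0 < dist (fst z) (snd z)" by simp
    have "min 1 (dist (fst z) (snd z)) \<le> dist (fst z) (snd z) powr s"
    proof (cases "dist (fst z) (snd z) \<le> 1")
      case True
      then have "dist (fst z) (snd z) powr 1 \<le> dist (fst z) (snd z) powr s"
        using d s_less_1 by (intro powr_mono') auto
      then show ?thesis using d by (simp add: min_def)
    qed (use s_pos in \<open>auto simp: min_def intro: ge_one_powr_ge_zero\<close>)
    then show ?thesis using d by (simp add: near_def)
  qed (simp add: near_def)
qed (simp add: near_def)

lemma measurable_near [measurable]: "near \<in> borel_measurable (borel :: ('a::euclidean_space \<times> 'a) measure)"
  unfolding near_def
  by (intro borel_measurable_divide borel_measurable_min measurable_dist_powr borel_measurable_const
      borel_measurable_continuous_onI continuous_intros)

text \<open>Since \<open>near\<close> is at most 1, convexity pulls it out of \<open>G\<close> as a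
  factor. Together with the density of \<open>mu\<close> it forms a kernel in \<open>x - y\<close>
  that is integrable by \<open>kernel_finite\<close>, so the double integral factorises.\<close>

lemma near_modular_finite:
  fixes f :: "'a::euclidean_space \<Rightarrow> real"
  assumes f: "f \<in> borel_measurable borel" and fin: "(\<integral>\<^sup>+ x. ennreal (G (f x)) \<partial>lborel) < \<infinity>"
  shows "(\<integral>\<^sup>+ z. ennreal (G (near z * f (fst z))) \<partial>mu) < \<infinity>"
    and "(\<integral>\<^sup>+ z. ennreal (G (near z * f (snd z))) \<partial>mu) < \<infinity>"
proof -
  define \<kappa> where "\<kappa> = (\<integral>\<^sup>+ z. ennreal (min 1 (norm z) / norm z powr s / norm (z::'a) ^ DIM('a)) \<partial>lborel)"
  have \<kappa>: "\<kappa> < \<infinity>" unfolding \<kappa>_def by (rule kernel_finite[OF s_pos s_less_1])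
  have m1: "(\<lambda>z. ennreal (G (near z * f (fst z)))) \<in> borel_measurable borel"
    and m2: "(\<lambda>z. ennreal (G (near z * f (snd z)))) \<in> borel_measurable borel"
    by (intro measurable_compose[OF _ measurable_ennreal] measurable_compose[OF _ measurable_G] borel_measurable_times
        measurable_near measurable_compose[OF measurable_fst_borel f] measurable_compose[OF measurable_snd_borel f])+
  have [measurable]: "(\<lambda>z::'a. norm z powr s) \<in> borel_measurable borel"
    by (intro powr_real_measurable) auto
  let ?k = "\<lambda>z::'a. ennreal (min 1 (norm z) / norm z powr s / norm z ^ DIM('a))"
  have k: "?k \<in> borel_measurable borel" by measurable
  have shift1: "(\<integral>\<^sup>+ x. ?k (x - y) \<partial>lborel) = \<kappa>" for y
    using nn_integral_lborel_shift[of "\<lambda>x. ?k (x - y)" y] k by (simp add: \<kappa>_def measurable_compose[OF _ k])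
  have shift: "(\<integral>\<^sup>+ x. c * ?k (x - y) \<partial>lborel) = c * \<kappa>" for c y
  proof -
    have "(\<lambda>x. ?k (x - y)) \<in> borel_measurable lborel"
      by (rule measurable_compose[OF _ k]) simp
    then show ?thesis unfolding shift1[of y, symmetric] by (rule nn_integral_cmult)
  qed
  have bound: "ennreal (1 / dist x y ^ DIM('a)) * ennreal (G (near (x, y) * t)) \<le> ennreal (G t) * ?k (x - y)" for x y :: 'a and t
  proof -
    have "G (near (x, y) * t) \<le> near (x, y) * G t" using near_bounds[of "(x, y)"] by (intro G_scale_le) auto
    then have "1 / dist x y ^ DIM('a) * G (near (x, y) * t) \<le> 1 / dist x y ^ DIM('a) * (near (x, y) * G t)"
      by (intro mult_left_mono) auto
    also have "\<dots> = G t * (min 1 (norm (x - y)) / norm (x - y) powr s / norm (x - y) ^ DIM('a))"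
      by (simp add: near_def dist_norm mult_ac)
    finally show ?thesis by (simp add: ennreal_mult'[symmetric] G_nonneg ennreal_leI)
  qed
  have [measurable]: "(\<lambda>x. ennreal (G (f x))) \<in> borel_measurable borel"
    by (intro measurable_compose[OF _ measurable_ennreal] measurable_compose[OF f measurable_G])
  have "(\<integral>\<^sup>+ z. ennreal (G (near z * f (snd z))) \<partial>mu) \<le> (\<integral>\<^sup>+ y. \<integral>\<^sup>+ x. ennreal (G (f y)) * ?k (x - y) \<partial>lborel \<partial>lborel)"
    unfolding nn_integral_mu_swap[OF m2] snd_conv by (intro nn_integral_mono bound)
  also have "\<dots> = (\<integral>\<^sup>+ y. ennreal (G (f y)) * \<kappa> \<partial>lborel)"
    unfolding shift ..
  also have "\<dots> < \<infinity>" using \<kappa> fin by (simp add: nn_integral_multc ennreal_mult_less_top)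
  finally show "(\<integral>\<^sup>+ z. ennreal (G (near z * f (snd z))) \<partial>mu) < \<infinity>" .
  have bound': "ennreal (1 / dist x y ^ DIM('a)) * ennreal (G (near (x, y) * t)) \<le> ennreal (G t) * ?k (y - x)" for x y :: 'a and t
    using bound[of x y t] by (simp add: norm_minus_commute)
  have "(\<integral>\<^sup>+ z. ennreal (G (near z * f (fst z))) \<partial>mu) \<le> (\<integral>\<^sup>+ x. \<integral>\<^sup>+ y. ennreal (G (f x)) * ?k (y - x) \<partial>lborel \<partial>lborel)"
    unfolding nn_integral_mu[OF m1] fst_conv by (intro nn_integral_mono bound')
  also have "\<dots> = (\<integral>\<^sup>+ x. ennreal (G (f x)) * \<kappa> \<partial>lborel)"
    unfolding shift ..
  also have "\<dots> < \<infinity>" using \<kappa> fin by (simp add: nn_integral_multc ennreal_mult_less_top)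
  finally show "(\<integral>\<^sup>+ z. ennreal (G (near z * f (fst z))) \<partial>mu) < \<infinity>" .
qed

lemma W_borelI:
  assumes v: "v \<in> borel_measurable borel" and fin: "(\<integral>\<^sup>+ x. ennreal (G (v x)) \<partial>lborel) < \<infinity>"
    and le: "\<And>z. \<bar>slope s v z\<bar> \<le> \<bar>A z\<bar> + \<bar>B z\<bar>"
    and A: "A \<in> borel_measurable lebesgue" "(\<integral>\<^sup>+ z. ennreal (G (A z)) \<partial>mu) < \<infinity>"
    and B: "B \<in> borel_measurable lebesgue" "(\<integral>\<^sup>+ z. ennreal (G (B z)) \<partial>mu) < \<infinity>"
  shows "v \<in> W"
  unfolding W_space_def
proof safe
  show "v \<in> borel_measurable lebesgue" using v by (rule measurable_lebesgueI)
  show "rho_G G v < \<infinity>" using fin by (simp add: rho_G_alt nn_integral_completion)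
  have "rho_sG s G v \<le> (\<integral>\<^sup>+ z. ennreal (2 powr q) * (ennreal (G (A z)) + ennreal (G (B z))) \<partial>mu)"
    unfolding rho_sG_slope
    by (intro nn_integral_mono) (simp add: ennreal_plus[symmetric] ennreal_mult'[symmetric] G_nonneg G_dominated[OF le] ennreal_leI del: ennreal_plus)
  also have "\<dots> = ennreal (2 powr q) * ((\<integral>\<^sup>+ z. ennreal (G (A z)) \<partial>mu) + (\<integral>\<^sup>+ z. ennreal (G (B z)) \<partial>mu))"
    using A(1) B(1) by (subst nn_integral_cmult) (auto simp: nn_integral_add)
  also have "\<dots> < \<infinity>" using A(2) B(2) by (simp add: ennreal_mult_less_top)
  finally show "rho_sG s G v < \<infinity>" .
qed

lemma abs_slope_le_near:
  assumes "\<bar>u (fst z) - u (snd z)\<bar> \<le> min 1 (dist (fst z) (snd z)) * c"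
  shows "\<bar>slope s u z\<bar> \<le> near z * c"
  using divide_right_mono[OF assms, of "dist (fst z) (snd z) powr s"]
  by (simp add: slope_def split_beta near_def)

text \<open>A discrete product rule: the jump of the product splits into \<open>\<eta> x\<close>
  times the jump of \<open>v\<close>, and \<open>v y\<close> times the jump of
  \<open>\<eta>\<close>; the latter is of the type controlled by \<open>near\<close>.\<close>

lemma W_cutoff:
  fixes v \<eta> :: "'a::euclidean_space \<Rightarrow> real"
  assumes v: "v \<in> W" and \<eta>: "\<eta> \<in> borel_measurable borel" "\<And>x. \<bar>\<eta> x\<bar> \<le> 1"
    "\<And>x y. \<bar>\<eta> x - \<eta> y\<bar> \<le> M * min 1 (dist x y)"
  shows "(\<lambda>x. \<eta> x * v x) \<in> W"
proof -
  obtain v' where v': "v' \<in> borel_measurable borel" and eq: "AE x in lebesgue. v x = v' x"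
    using borel_representative[OF W_measurable[OF v]] by blast
  have v'W: "v' \<in> W" using W_cong_AE[OF v eq] v' by (simp add: measurable_lebesgueI)
  have "(\<lambda>x. \<eta> x * v' x) \<in> W"
  proof (rule W_borelI[where A = "slope s v'" and B = "\<lambda>z. near z * (M * v' (snd z))"])
    show "(\<lambda>x. \<eta> x * v' x) \<in> borel_measurable borel" using \<eta>(1) v' by simp
    show "(\<integral>\<^sup>+ x. ennreal (G (\<eta> x * v' x)) \<partial>lborel) < \<infinity>"
    proof (rule le_less_trans)
      show "(\<integral>\<^sup>+ x. ennreal (G (\<eta> x * v' x)) \<partial>lborel) \<le> rho_G G v'"
        unfolding rho_G_alt nn_integral_completion using \<eta>(2)
        by (intro nn_integral_mono ennreal_leI G_mono) (simp add: abs_mult mult_left_le_one_le)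
      show "rho_G G v' < \<infinity>" using v'W by (simp add: W_space_def)
    qed
    show "slope s v' \<in> borel_measurable lebesgue" using v' by (simp add: measurable_slope measurable_lebesgueI)
    show "(\<integral>\<^sup>+ z. ennreal (G (slope s v' z)) \<partial>mu) < \<infinity>"
      using v'W by (simp add: W_space_def rho_sG_slope)
    have Mv: "(\<lambda>x. M * v' x) \<in> borel_measurable borel" using v' by simp
    show "(\<lambda>z. near z * (M * v' (snd z))) \<in> borel_measurable lebesgue"
      by (intro measurable_lebesgueI borel_measurable_times measurable_near measurable_compose[OF measurable_snd_borel Mv])
    have "rho_G G (\<lambda>x. M * v' x) < \<infinity>" using W_cmult[OF v'W, of M] by (simp add: W_space_def)
    then show "(\<integral>\<^sup>+ z. ennreal (G (near z * (M * v' (snd z)))) \<partial>mu) < \<infinity>"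
      by (intro near_modular_finite(2)[OF Mv]) (simp add: rho_G_alt nn_integral_completion)
    fix z :: "'a \<times> 'a"
    obtain x y where z: "z = (x, y)" by (cases z)
    let ?d = "dist x y powr s"
    have "\<bar>\<eta> x * v' x - \<eta> y * v' y\<bar> = \<bar>\<eta> x * (v' x - v' y) + v' y * (\<eta> x - \<eta> y)\<bar>" by (simp add: algebra_simps)
    also have "\<dots> \<le> \<bar>v' x - v' y\<bar> + \<bar>v' y\<bar> * (M * min 1 (dist x y))"
      using \<eta>(2)[of x] \<eta>(3)[of x y]
      by (intro order_trans[OF abs_triangle_ineq] add_mono) (auto simp: abs_mult mult_left_le_one_le intro!: mult_left_mono)
    also have "\<dots> \<le> \<bar>v' x - v' y\<bar> + \<bar>min 1 (dist x y) * (M * v' y)\<bar>"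
      by (simp add: abs_mult mult_ac mult_right_mono mult_left_mono)
    finally have "\<bar>\<eta> x * v' x - \<eta> y * v' y\<bar> / ?d \<le> (\<bar>v' x - v' y\<bar> + \<bar>min 1 (dist x y) * (M * v' y)\<bar>) / ?d"
      by (rule divide_right_mono) simp
    then show "\<bar>slope s (\<lambda>x. \<eta> x * v' x) z\<bar> \<le> \<bar>slope s v' z\<bar> + \<bar>near z * (M * v' (snd z))\<bar>"
      by (simp add: z slope_def near_def abs_mult add_divide_distrib)
  qed
  then show ?thesis
  proof (rule W_cong_AE)
    show "AE x in lebesgue. \<eta> x * v' x = \<eta> x * v x" using eq by eventually_elim simp
    show "(\<lambda>x. \<eta> x * v x) \<in> borel_measurable lebesgue"
      by (intro borel_measurable_times measurable_lebesgueI[OF \<eta>(1)] W_measurable[OF v])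
  qed
qed

text \<open>A nonzero jump has at least one end in the ball, so it may be charged to the indicator
  of the ball at that end.\<close>

lemma vanishing_Lipschitz_in_W:
  fixes \<phi> :: "'a::euclidean_space \<Rightarrow> real"
  assumes \<phi>: "\<phi> \<in> borel_measurable borel" "\<And>x. x \<notin> cball a R \<Longrightarrow> \<phi> x = 0" "\<And>x. \<bar>\<phi> x\<bar> \<le> M"
    and lip: "\<And>x y. \<bar>\<phi> x - \<phi> y\<bar> \<le> M * min 1 (dist x y)"
  shows "\<phi> \<in> W"
proof -
  define f where "f x = M * indicator (cball a R) x" for x :: 'a
  have f: "f \<in> borel_measurable borel" unfolding f_def by (intro borel_measurable_times borel_measurable_indicator) auto
  have M: "0 \<le> M" using \<phi>(3)[of a] by linarith
  have fin: "(\<integral>\<^sup>+ x. ennreal (G (f x)) \<partial>lborel) < \<infinity>"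
  proof -
    have "(\<integral>\<^sup>+ x. ennreal (G (f x)) \<partial>lborel) = (\<integral>\<^sup>+ x. ennreal (G M) * indicator (cball a R) x \<partial>lborel)"
      by (intro nn_integral_cong) (auto simp: f_def indicator_def)
    also have "\<dots> < \<infinity>" using emeasure_bounded_finite[of "cball a R"] by (subst nn_integral_cmult_indicator) (auto simp: ennreal_mult_less_top)
    finally show ?thesis .
  qed
  show ?thesis
  proof (rule W_borelI[where A = "\<lambda>z. near z * f (fst z)" and B = "\<lambda>z. near z * f (snd z)"])
    show "(\<lambda>z. near z * f (fst z)) \<in> borel_measurable lebesgue" "(\<lambda>z. near z * f (snd z)) \<in> borel_measurable lebesgue"
      by (intro measurable_lebesgueI borel_measurable_times measurable_near measurable_compose[OF measurable_snd_borel f]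
          measurable_compose[OF measurable_fst_borel f])+
    have "G (\<phi> x) \<le> G (f x)" for x
      using \<phi>(2)[of x] \<phi>(3)[of x] M by (intro G_mono) (auto simp: f_def indicator_def)
    then have "(\<integral>\<^sup>+ x. ennreal (G (\<phi> x)) \<partial>lborel) \<le> (\<integral>\<^sup>+ x. ennreal (G (f x)) \<partial>lborel)"
      by (intro nn_integral_mono ennreal_leI)
    then show "(\<integral>\<^sup>+ x. ennreal (G (\<phi> x)) \<partial>lborel) < \<infinity>" using fin by (rule le_less_trans)
    fix z :: "'a \<times> 'a"
    have "\<bar>\<phi> (fst z) - \<phi> (snd z)\<bar> \<le> min 1 (dist (fst z) (snd z)) * (f (fst z) + f (snd z))"
    proof (cases "fst z \<in> cball a R \<or> snd z \<in> cball a R")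
      case True
      then have "M \<le> f (fst z) + f (snd z)" using M by (auto simp: f_def)
      then have "min 1 (dist (fst z) (snd z)) * M \<le> min 1 (dist (fst z) (snd z)) * (f (fst z) + f (snd z))"
        by (intro mult_left_mono) auto
      then show ?thesis using lip[of "fst z" "snd z"] by (simp add: mult.commute)
    qed (simp add: \<phi>(2) f_def M)
    then have "\<bar>slope s \<phi> z\<bar> \<le> near z * (f (fst z) + f (snd z))" by (rule abs_slope_le_near)
    also have "\<dots> \<le> \<bar>near z * f (fst z)\<bar> + \<bar>near z * f (snd z)\<bar>" by (simp add: distrib_left add_mono)
    finally show "\<bar>slope s \<phi> z\<bar> \<le> \<bar>near z * f (fst z)\<bar> + \<bar>near z * f (snd z)\<bar>" .
  qed (use \<phi>(1) near_modular_finite[OF f fin] in auto)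
qed

lemma smooth_vanishing_in_W:
  fixes \<phi> :: "'a::euclidean_space \<Rightarrow> real"
  assumes \<phi>: "smooth \<phi>" "\<And>x. x \<notin> cball a R \<Longrightarrow> \<phi> x = 0"
  shows "\<phi> \<in> W"
proof -
  obtain M0 where M0: "0 < M0" "\<And>x. \<bar>\<phi> x\<bar> \<le> M0"
    using bounded_vanishing[OF smooth_continuous[OF \<phi>(1)] \<phi>(2)] by blast
  obtain d where d: "0 < d" "\<And>y v. norm v < d \<Longrightarrow> \<bar>\<phi> (y + v) - \<phi> y - frechet_derivative \<phi> (at y) v\<bar> \<le> 1 * norm v"
    using uniform_derivative[OF \<phi>, where e = 1] by auto
  have "\<exists>M. \<forall>x. \<bar>frechet_derivative \<phi> (at x) i\<bar> \<le> M" for i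
  proof -
    have out: "frechet_derivative \<phi> (at x) i = 0" if "x \<notin> cball a R" for x
      using frechet_derivative_outside[OF \<phi>(2) that] .
    show ?thesis
      by (rule bounded_vanishing[OF smooth_continuous[OF smooth_frechet_derivative[OF \<phi>(1)]] out]) blast+
  qed
  then obtain D where D: "\<And>i x. \<bar>frechet_derivative \<phi> (at x) i\<bar> \<le> D i" by metis
  define C where "C = (\<Sum>i\<in>Basis. D i)"
  have D_le: "\<bar>frechet_derivative \<phi> (at y) v\<bar> \<le> C * norm v" for y v
  proof -
    have lin: "linear (frechet_derivative \<phi> (at y))" using smooth_derivative[OF \<phi>(1)] has_derivative_linear by blast
    have "\<bar>frechet_derivative \<phi> (at y) (\<Sum>i\<in>Basis. (v \<bullet> i) *\<^sub>R i)\<bar> \<le> (\<Sum>i\<in>Basis. norm v * D i)"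
      unfolding linear_sum[OF lin] linear_scale[OF lin]
    proof (rule order_trans[OF sum_abs], rule sum_mono)
      fix i :: 'a assume "i \<in> Basis"
      then show "\<bar>(v \<bullet> i) *\<^sub>R frechet_derivative \<phi> (at y) i\<bar> \<le> norm v * D i"
        using Basis_le_norm[of i v] D[of y i] by (simp add: abs_mult mult_mono)
    qed
    then show ?thesis by (simp add: euclidean_representation C_def sum_distrib_left mult.commute)
  qed
  define d' where "d' = min d 1"
  have d': "0 < d'" "d' \<le> 1" "d' \<le> d" using d by (auto simp: d'_def)
  \<comment> \<open>Covers in turn the supremum of \<open>\<phi>\<close>, its Lipschitz constant at
    distances below \<open>d'\<close>, and the quotient of twice the supremum by \<open>d'\<close>
    at larger distances.\<close>
  define M where "M = max M0 (max (C + 1) (2 * M0 / d'))"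
  have M: "M0 \<le> M" "C + 1 \<le> M" "2 * M0 / d' \<le> M" "0 \<le> M" using M0(1) by (auto simp: M_def)
  show ?thesis
  proof (rule vanishing_Lipschitz_in_W[where M = M])
    show "\<phi> \<in> borel_measurable borel" using smooth_continuous[OF \<phi>(1)] by (rule borel_measurable_continuous_onI)
    show "\<bar>\<phi> x\<bar> \<le> M" for x using M0(2)[of x] M by linarith
    fix x y
    show "\<bar>\<phi> x - \<phi> y\<bar> \<le> M * min 1 (dist x y)"
    proof (cases "dist x y < d'")
      case True
      then have "norm (x - y) < d" using d' by (simp add: dist_norm)
      then have "\<bar>\<phi> x - \<phi> y - frechet_derivative \<phi> (at y) (x - y)\<bar> \<le> norm (x - y)"
        using d(2)[of "x - y" y] by simp
      then have "\<bar>\<phi> x - \<phi> y\<bar> \<le> (C + 1) * norm (x - y)"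
        using D_le[of y "x - y"] by (simp add: algebra_simps)
      also have "\<dots> \<le> M * norm (x - y)" using M by (intro mult_right_mono) auto
      finally show ?thesis using True d' by (simp add: dist_norm min_def)
    next
      case False
      then have "d' \<le> min 1 (dist x y)" using d' by auto
      then have "2 * M0 / d' * d' \<le> M * min 1 (dist x y)" using M M0 d' by (intro mult_mono) auto
      moreover have "\<bar>\<phi> x - \<phi> y\<bar> \<le> 2 * M0" using M0(2)[of x] M0(2)[of y] by linarith
      ultimately show ?thesis using d' by simp
    qed
  qed (rule \<phi>(2))
qed

lemma Cc_infinity_in_W: "\<phi> \<in> Cc_infinity \<Omega> \<Longrightarrow> \<phi> \<in> W"
proof -
  assume \<phi>: "\<phi> \<in> Cc_infinity \<Omega>"
  then have "bounded (closure {x. \<phi> x \<noteq> 0})" by (simp add: Cc_infinity_def compact_imp_bounded)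
  then obtain R where "closure {x. \<phi> x \<noteq> 0} \<subseteq> ball 0 R" using bounded_subset_ballD by metis
  then have R: "closure {x. \<phi> x \<noteq> 0} \<subseteq> cball 0 R" using ball_subset_cball by (rule subset_trans)
  show ?thesis
  proof (rule smooth_vanishing_in_W[where a = 0 and R = R])
    show "smooth \<phi>" using \<phi> unfolding Cc_infinity_def by blast
    show "\<phi> x = 0" if "x \<notin> cball 0 R" for x
    proof (rule ccontr)
      assume "\<phi> x \<noteq> 0"
      then have "x \<in> closure {x. \<phi> x \<noteq> 0}" by (intro closure_subset[THEN subsetD]) simp
      then show False using R that by blast
    qed
  qed
qed

end

section \<open>Translations\<close>

lemma integral_lborel_shift:
  fixes f :: "'a::euclidean_space \<Rightarrow> real"
  assumes "f \<in> borel_measurable borel"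
  shows "(LINT x|lborel. f (a + x)) = (LINT x|lborel. f x)"
    and "integrable lborel (\<lambda>x. f (a + x)) \<longleftrightarrow> integrable lborel f"
proof -
  have f: "f \<in> borel_measurable borel" by (rule assms)
  show "(LINT x|lborel. f (a + x)) = (LINT x|lborel. f x)"
    by (subst (2) lborel_distr_plus[of a, symmetric]) (simp add: integral_distr f)
  show "integrable lborel (\<lambda>x. f (a + x)) \<longleftrightarrow> integrable lborel f"
    by (subst (2) lborel_distr_plus[of a, symmetric]) (simp add: integrable_distr_eq f)
qed

text \<open>Measurability supplies continuous functions converging almost everywhere. Truncating
  them to \<open>[-M, M]\<close> and multiplying by a cut-off leaves the limit unchanged and
  supplies the integrable majorant.\<close>

lemma continuous_L1_approximation:
  fixes f :: "'a::euclidean_space \<Rightarrow> real"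
  assumes f: "f \<in> borel_measurable borel" "\<And>x. \<bar>f x\<bar> \<le> M" "\<And>x. x \<notin> cball 0 R \<Longrightarrow> f x = 0" and e: "0 < e"
  obtains h where "continuous_on UNIV h" "\<And>x. \<bar>h x\<bar> \<le> M" "\<And>x. x \<notin> cball 0 (R + 1) \<Longrightarrow> h x = 0"
    "(LINT x|lborel. \<bar>f x - h x\<bar>) < e"
proof -
  have M: "0 \<le> M" using f(2)[of 0] by linarith
  have "f measurable_on UNIV"
    by (rule lebesgue_measurable_imp_measurable_on_real) (auto intro: measurable_lebesgueI f(1))
  then obtain N gs where N: "negligible N" and gs: "\<And>n. continuous_on UNIV (gs n)"
    and lim: "\<And>x. x \<notin> N \<Longrightarrow> (\<lambda>n. gs n x) \<longlonglongrightarrow> f x"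
    unfolding measurable_on_def by auto
  define cut where "cut x = max 0 (min 1 (R + 1 - norm x))" for x :: 'a
  define h where "h n x = cut x * max (- M) (min M (gs n x))" for n x
  have cut: "0 \<le> cut x" "cut x \<le> 1" for x by (auto simp: cut_def)
  have h_cont: "continuous_on UNIV (h n)" for n
    unfolding h_def cut_def by (intro continuous_intros gs)
  have h_le: "\<bar>h n x\<bar> \<le> M" for n x
  proof -
    have "\<bar>h n x\<bar> \<le> 1 * M"
      unfolding h_def abs_mult using cut[of x] M by (intro mult_mono) auto
    then show ?thesis by simp
  qed
  have h_out: "h n x = 0" if "x \<notin> cball 0 (R + 1)" for n x using that by (simp add: h_def cut_def)
  have f_mult: "f x = cut x * f x" for x using f(3)[of x] by (cases "x \<in> cball 0 R") (auto simp: cut_def)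
  have "(\<lambda>n. LINT x|lborel. \<bar>f x - h n x\<bar>) \<longlonglongrightarrow> (LINT x|(lborel :: 'a measure). 0)"
  proof (rule integral_dominated_convergence[where w = "\<lambda>x. 2 * M * indicator (cball 0 (R + 1)) x"])
    show "integrable lborel (\<lambda>x. 2 * M * indicator (cball 0 (R + 1)) x :: real)"
      by (intro integrable_mult_right integrable_real_indicator emeasure_bounded_finite) auto
    show "(\<lambda>x. \<bar>f x - h n x\<bar>) \<in> borel_measurable lborel" for n
      using f(1) borel_measurable_continuous_onI[OF h_cont[of n]] by simp
    show "AE x in lborel. norm \<bar>f x - h n x\<bar> \<le> 2 * M * indicator (cball 0 (R + 1)) x" for n
    proof (rule AE_I2)
      fix x
      show "norm \<bar>f x - h n x\<bar> \<le> 2 * M * indicator (cball 0 (R + 1)) x"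
      proof (cases "x \<in> cball 0 (R + 1)")
        case True
        then show ?thesis using f(2)[of x] h_le[of n x] by simp
      next
        case False
        then have "x \<notin> cball 0 R" by auto
        then show ?thesis using f(3) h_out[OF False] M by simp
      qed
    qed
    have "N \<in> null_sets lebesgue" using N by (simp add: negligible_iff_null_sets)
    then have "AE x in lebesgue. x \<notin> N" by (rule AE_not_in)
    then have "AE x in lborel. x \<notin> N" by (simp add: AE_completion_iff)
    then show "AE x in lborel. (\<lambda>n. \<bar>f x - h n x\<bar>) \<longlonglongrightarrow> 0"
    proof eventually_elim
      case (elim x)
      have "(\<lambda>n. h n x) \<longlonglongrightarrow> cut x * max (- M) (min M (f x))"
        unfolding h_def by (intro tendsto_intros lim elim)
      moreover have "max (- M) (min M (f x)) = f x" using f(2)[of x] by (auto simp: abs_le_iff)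
      ultimately have "(\<lambda>n. h n x) \<longlonglongrightarrow> f x" using f_mult[of x] by simp
      then have "(\<lambda>n. \<bar>f x - h n x\<bar>) \<longlonglongrightarrow> \<bar>f x - f x\<bar>" by (intro tendsto_intros)
      then show ?case by simp
    qed
  qed simp
  then have "(\<lambda>n. LINT x|lborel. \<bar>f x - h n x\<bar>) \<longlonglongrightarrow> 0" by simp
  then have "eventually (\<lambda>n. (LINT x|lborel. \<bar>f x - h n x\<bar>) < e) sequentially"
    using e by (rule order_tendstoD(2))
  then obtain n where "(LINT x|lborel. \<bar>f x - h n x\<bar>) < e" by (auto simp: eventually_sequentially)
  then show ?thesis using that[OF h_cont h_le h_out] by blast
qed

lemma bounded_vanishing_integrable:
  fixes f :: "'a::euclidean_space \<Rightarrow> real"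
  assumes "f \<in> borel_measurable borel" "\<And>x. \<bar>f x\<bar> \<le> M" "\<And>x. x \<notin> cball 0 R \<Longrightarrow> f x = 0"
  shows "integrable lborel f"
proof (rule Bochner_Integration.integrable_bound)
  show "integrable lborel (\<lambda>x::'a. M * indicator (cball 0 R) x)"
    by (intro integrable_mult_right integrable_real_indicator emeasure_bounded_finite) auto
  show "AE x in lborel. norm (f x) \<le> norm (M * indicator (cball 0 R) x)"
    using assms(2,3) by (intro AE_I2) (auto simp: indicator_def intro: order_trans[OF _ abs_ge_self])
qed (use assms in simp)

text \<open>Three thirds of \<open>e\<close>: two approximation errors, equal by translation
  invariance, and the continuous approximant, for which dominated convergence works.\<close>

lemma L1_translation:
  fixes f :: "'a::euclidean_space \<Rightarrow> real"
  assumes f: "f \<in> borel_measurable borel" "\<And>x. \<bar>f x\<bar> \<le> M" "\<And>x. x \<notin> cball 0 R \<Longrightarrow> f x = 0"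
    and a: "a \<longlonglongrightarrow> 0"
  shows "(\<lambda>n. LINT x|lborel. \<bar>f (a n + x) - f x\<bar>) \<longlonglongrightarrow> 0"
proof (rule LIMSEQ_I)
  fix e :: real assume e: "0 < e"
  have M: "0 \<le> M" using f(2)[of 0] by linarith
  obtain h where h: "continuous_on UNIV h" "\<And>x. \<bar>h x\<bar> \<le> M" "\<And>x. x \<notin> cball 0 (R + 1) \<Longrightarrow> h x = 0"
    "(LINT x|lborel. \<bar>f x - h x\<bar>) < e / 3"
    using continuous_L1_approximation[OF f, where e = "e / 3"] e by auto
  have hm: "h \<in> borel_measurable borel" by (rule borel_measurable_continuous_onI[OF h(1)])
  \<comment> \<open>Shifts shorter than 1 keep every difference supported in
    \<open>cball 0 (R + 2)\<close>, where the majorant lives.\<close>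
  obtain N0 where N0: "\<And>n. n \<ge> N0 \<Longrightarrow> norm (a n) < 1"
    using LIMSEQ_D[OF a, of 1] by auto
  have "(\<lambda>n. LINT x|lborel. \<bar>h (a (n + N0) + x) - h x\<bar>) \<longlonglongrightarrow> (LINT x|(lborel :: 'a measure). 0)"
  proof (rule integral_dominated_convergence[where w = "\<lambda>x. 2 * M * indicator (cball 0 (R + 2)) x"])
    show "integrable lborel (\<lambda>x. 2 * M * indicator (cball 0 (R + 2)) x :: real)"
      by (intro integrable_mult_right integrable_real_indicator emeasure_bounded_finite) auto
    show "(\<lambda>x. \<bar>h (a (n + N0) + x) - h x\<bar>) \<in> borel_measurable lborel" for n
      using hm by simp
    show "AE x in lborel. norm \<bar>h (a (n + N0) + x) - h x\<bar> \<le> 2 * M * indicator (cball 0 (R + 2)) x" for n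
    proof (rule AE_I2)
      fix x
      show "norm \<bar>h (a (n + N0) + x) - h x\<bar> \<le> 2 * M * indicator (cball 0 (R + 2)) x"
      proof (cases "x \<in> cball 0 (R + 2)")
        case True
        then show ?thesis using h(2)[of "a (n + N0) + x"] h(2)[of x] by simp
      next
        case False
        have "norm x \<le> norm (a (n + N0) + x) + norm (a (n + N0))"
          using norm_triangle_ineq4[of "a (n + N0) + x" "a (n + N0)"] by simp
        then have "a (n + N0) + x \<notin> cball 0 (R + 1)" using False N0[of "n + N0"] by simp
        moreover have "x \<notin> cball 0 (R + 1)" using False by simp
        ultimately show ?thesis using h(3) M by simp
      qed
    qed
    have "(\<lambda>n. \<bar>h (a (n + N0) + x) - h x\<bar>) \<longlonglongrightarrow> 0" for x
    proof -
      have "(\<lambda>n. a (n + N0)) \<longlonglongrightarrow> 0" by (rule LIMSEQ_ignore_initial_segment[OF a])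
      then have "(\<lambda>n. a (n + N0) + x) \<longlonglongrightarrow> 0 + x" by (intro tendsto_intros)
      moreover have "isCont h (0 + x)" using h(1) by (simp add: continuous_on_eq_continuous_at)
      ultimately have "(\<lambda>n. h (a (n + N0) + x)) \<longlonglongrightarrow> h (0 + x)" by (rule isCont_tendsto_compose[rotated])
      then have "(\<lambda>n. \<bar>h (a (n + N0) + x) - h x\<bar>) \<longlonglongrightarrow> \<bar>h (0 + x) - h x\<bar>" by (intro tendsto_intros)
      then show ?thesis by simp
    qed
    then show "AE x in lborel. (\<lambda>n. \<bar>h (a (n + N0) + x) - h x\<bar>) \<longlonglongrightarrow> 0" by simp
  qed simp
  then have "(\<lambda>n. LINT x|lborel. \<bar>h (a (n + N0) + x) - h x\<bar>) \<longlonglongrightarrow> 0" by simp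
  from LIMSEQ_D[OF this, of "e / 3"] e
  obtain N1 where N1: "\<And>n. n \<ge> N1 \<Longrightarrow> \<bar>LINT x|lborel. \<bar>h (a (n + N0) + x) - h x\<bar>\<bar> < e / 3" by auto
  have fi: "integrable lborel f" by (rule bounded_vanishing_integrable[OF f])
  have hi: "integrable lborel h" by (rule bounded_vanishing_integrable[OF hm h(2,3)])
  have main: "\<bar>LINT x|lborel. \<bar>f (a n + x) - f x\<bar>\<bar> < e" if n: "n \<ge> N1 + N0" for n
  proof -
    have fs: "integrable lborel (\<lambda>x. f (a n + x))" and hs: "integrable lborel (\<lambda>x. h (a n + x))"
      using integral_lborel_shift(2) f(1) hm fi hi by blast+
    have "(LINT x|lborel. \<bar>f (a n + x) - f x\<bar>)
        \<le> (LINT x|lborel. \<bar>f (a n + x) - h (a n + x)\<bar> + \<bar>h (a n + x) - h x\<bar> + \<bar>f x - h x\<bar>)"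
      by (intro integral_mono Bochner_Integration.integrable_add integrable_abs Bochner_Integration.integrable_diff fi hi fs hs) linarith
    also have "\<dots> = (LINT x|lborel. \<bar>f (a n + x) - h (a n + x)\<bar>) + (LINT x|lborel. \<bar>h (a n + x) - h x\<bar>) + (LINT x|lborel. \<bar>f x - h x\<bar>)"
      using fi hi fs hs by simp
    also have "(LINT x|lborel. \<bar>f (a n + x) - h (a n + x)\<bar>) = (LINT x|lborel. \<bar>f x - h x\<bar>)"
      using f(1) hm by (intro integral_lborel_shift(1)) simp
    also have "(LINT x|lborel. \<bar>h (a n + x) - h x\<bar>) < e / 3"
      using N1[of "n - N0"] n by simp
    finally have "(LINT x|lborel. \<bar>f (a n + x) - f x\<bar>) < e" using h(4) by linarith
    then show ?thesis by simp
  qed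
  then show "\<exists>no. \<forall>n\<ge>no. norm ((LINT x|lborel. \<bar>f (a n + x) - f x\<bar>) - 0) < e"
    by (auto intro!: exI[of _ "N1 + N0"])
qed

text \<open>\<open>w\<close> may be unbounded, so translation continuity in L1 is applied to
  \<open>arctan (w x)\<close>; almost everywhere convergence of a subsequence is carried back by
  \<open>tan\<close>.\<close>

lemma AE_translation_subsequence:
  fixes w :: "'a::euclidean_space \<Rightarrow> real"
  assumes w: "w \<in> borel_measurable borel" "\<And>x. x \<notin> cball 0 R \<Longrightarrow> w x = 0" and a: "a \<longlonglongrightarrow> 0"
  obtains r :: "nat \<Rightarrow> nat" where "strict_mono r" "AE x in lborel. (\<lambda>n. w (a (r n) + x)) \<longlonglongrightarrow> w x"
proof -
  define f where "f x = arctan (w x)" for x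
  have f: "f \<in> borel_measurable borel" "\<And>x. \<bar>f x\<bar> \<le> pi / 2" "\<And>x. x \<notin> cball 0 R \<Longrightarrow> f x = 0"
  proof -
    show "f \<in> borel_measurable borel" unfolding f_def using w(1) by measurable
    show "\<bar>f x\<bar> \<le> pi / 2" for x using arctan_bounded[of "w x"] by (auto simp: f_def abs_if)
    show "f x = 0" if "x \<notin> cball 0 R" for x using w(2)[OF that] by (simp add: f_def)
  qed
  have fi: "integrable lborel f" by (rule bounded_vanishing_integrable[OF f])
  have fs: "integrable lborel (\<lambda>x. f (a n + x))" for n using integral_lborel_shift(2)[OF f(1)] fi by blast
  have fd: "integrable lborel (\<lambda>x. f (a n + x) - f x)" for n
    by (rule Bochner_Integration.integrable_diff[OF fs fi])
  have "(\<lambda>n. LINT x|lborel. norm (f (a n + x) - f x)) \<longlonglongrightarrow> 0"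
    using L1_translation[OF f a] by simp
  from tendsto_L1_AE_subseq[of lborel "\<lambda>n x. f (a n + x) - f x", OF fd this]
  obtain r where r: "strict_mono r" "AE x in lborel. (\<lambda>n. f (a (r n) + x) - f x) \<longlonglongrightarrow> 0"
    by blast
  from r(2) have "AE x in lborel. (\<lambda>n. w (a (r n) + x)) \<longlonglongrightarrow> w x"
  proof eventually_elim
    case (elim x)
    then have lim: "(\<lambda>n. f (a (r n) + x)) \<longlonglongrightarrow> f x" by (rule LIM_zero_cancel)
    have "isCont tan (f x)" unfolding f_def using cos_arctan_not_zero by (intro isCont_tan) simp
    from isCont_tendsto_compose[OF this lim] show ?case by (simp add: f_def tan_arctan)
  qed
  then show ?thesis using that r(1) by blast
qed

section \<open>Continuity of translations in modular\<close>

context N_growth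
begin

text \<open>A variant of the Brezis-Lieb argument: Fatou's lemma for
  \<open>2 powr q * (G f + G f\<^sub>n) - G (f - f\<^sub>n)\<close>.\<close>

lemma equal_modular_limit:
  fixes f :: "'b \<Rightarrow> real"
  assumes f: "f \<in> borel_measurable M" "integrable M (\<lambda>x. G (f x))"
    and fn: "\<And>n. fn n \<in> borel_measurable M" "\<And>n. integrable M (\<lambda>x. G (fn n x))"
      "\<And>n. (LINT x|M. G (fn n x)) = (LINT x|M. G (f x))"
    and lim: "AE x in M. (\<lambda>n. fn n x) \<longlonglongrightarrow> f x" and e: "0 < e"
  shows "\<exists>n. (LINT x|M. G (fn n x - f x)) < e"
proof (rule ccontr)
  assume "\<not> ?thesis"
  then have ge: "e \<le> (LINT x|M. G (fn n x - f x))" for n by (simp add: not_less)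
  define X where "X = (LINT x|M. G (f x))"
  define F where "F n x = 2 powr q * (G (fn n x) + G (f x)) - G (fn n x - f x)" for n x
  have F_nonneg: "0 \<le> F n x" for n x using G_diff_le[of "fn n x" "f x"] by (simp add: F_def)
  have diff: "integrable M (\<lambda>x. G (fn n x - f x))" for n
  proof (rule Bochner_Integration.integrable_bound)
    show "integrable M (\<lambda>x. 2 powr q * (G (fn n x) + G (f x)))" using f fn by simp
    show "AE x in M. norm (G (fn n x - f x)) \<le> norm (2 powr q * (G (fn n x) + G (f x)))"
      using G_diff_le G_nonneg by (intro AE_I2) (simp add: abs_mult)
    show "(\<lambda>x. G (fn n x - f x)) \<in> borel_measurable M"
      using f(1) fn(1) by (intro measurable_compose[OF _ measurable_G] borel_measurable_diff)
  qed
  have F_int: "integrable M (F n)" for n unfolding F_def using f(2) fn(2) diff by simp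
  have F_le: "(LINT x|M. F n x) \<le> 2 * 2 powr q * X - e" for n
  proof -
    have "(LINT x|M. F n x) = 2 powr q * (X + X) - (LINT x|M. G (fn n x - f x))"
      unfolding F_def using f(2) fn(2,3) diff by (simp add: X_def)
    then show ?thesis using ge[of n] by simp
  qed
  have "0 \<le> (LINT x|M. F 0 x)" by (intro integral_nonneg_AE AE_I2 F_nonneg)
  then have e_le: "0 \<le> 2 * 2 powr q * X - e" using F_le[of 0] by linarith
  have cG: "isCont G t" for t using cont_G by (simp add: continuous_on_eq_continuous_at)
  have "(\<integral>\<^sup>+ x. ennreal (2 powr q * (G (f x) + G (f x))) \<partial>M) \<le> ennreal (2 * 2 powr q * X - e)"
  proof (rule nn_integral_Fatou_bound[where F = F and N = 0])
    show "F n \<in> borel_measurable M" for n using F_int by (rule borel_measurable_integrable)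
    show "AE x in M. (\<lambda>n. F n x) \<longlonglongrightarrow> 2 powr q * (G (f x) + G (f x))"
      using lim
    proof eventually_elim
      case (elim x)
      have "(\<lambda>n. F n x) \<longlonglongrightarrow> 2 powr q * (G (f x) + G (f x)) - G (f x - f x)"
        unfolding F_def by (intro tendsto_intros isCont_tendsto_compose[OF cG] elim)
      then show ?case by simp
    qed
    show "(\<integral>\<^sup>+ x. ennreal (F n x) \<partial>M) \<le> ennreal (2 * 2 powr q * X - e)" for n
      using nn_integral_eq_integral[OF F_int] F_nonneg F_le by (simp add: ennreal_leI)
  qed simp
  moreover have "(\<integral>\<^sup>+ x. ennreal (2 powr q * (G (f x) + G (f x))) \<partial>M) = ennreal (2 * 2 powr q * X)"
    using nn_integral_eq_integral[of M "\<lambda>x. 2 powr q * (G (f x) + G (f x))"] f(2)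
    by (simp add: G_nonneg X_def)
  ultimately show False using e e_le by (simp add: ennreal_le_iff)
qed

end

context fractional_Orlicz_Sobolev
begin

lemma rho_G_shift:
  fixes u :: "'a::euclidean_space \<Rightarrow> real"
  assumes u: "u \<in> borel_measurable borel" shows "rho_G G (\<lambda>x. u (a + x)) = rho_G G u"
  unfolding rho_G_alt nn_integral_completion
  using measurable_compose[OF measurable_compose[OF u measurable_G] measurable_ennreal]
  by (rule nn_integral_lborel_shift)

lemma rho_sG_shift:
  fixes u :: "'a::euclidean_space \<Rightarrow> real"
  assumes u: "u \<in> borel_measurable borel" shows "rho_sG s G (\<lambda>x. u (a + x)) = rho_sG s G u"
proof -
  have u': "(\<lambda>x. u (a + x)) \<in> borel_measurable borel" using u by simp
  define k where "k z = (case z of (x, y) \<Rightarrow> ennreal (1 / dist x y ^ DIM('a))) * ennreal (G (slope s u z))" for z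
  have "k \<in> borel_measurable borel"
    unfolding k_def
    by (intro borel_measurable_times_ennreal measurable_kernel measurable_compose[OF _ measurable_ennreal]
        measurable_compose[OF measurable_slope_borel[OF u] measurable_G])
  then have k: "k \<in> borel_measurable (lborel \<Otimes>\<^sub>M lborel)" by (simp add: lborel_prod)
  have "rho_sG s G (\<lambda>x. u (a + x)) = (\<integral>\<^sup>+ x. \<integral>\<^sup>+ y. k (a + x, a + y) \<partial>lborel \<partial>lborel)"
    unfolding rho_sG_iterated[OF u'] by (simp add: k_def slope_def dist_norm)
  also have "\<dots> = (\<integral>\<^sup>+ x. \<integral>\<^sup>+ y. k (a + x, y) \<partial>lborel \<partial>lborel)"
  proof (rule nn_integral_cong)
    fix x
    have "(\<lambda>y. k (a + x, y)) \<in> borel_measurable borel"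
      using measurable_compose[OF measurable_Pair1' k, of "a + x"] by simp
    then show "(\<integral>\<^sup>+ y. k (a + x, a + y) \<partial>lborel) = (\<integral>\<^sup>+ y. k (a + x, y) \<partial>lborel)"
      by (rule nn_integral_lborel_shift)
  qed
  also have "\<dots> = (\<integral>\<^sup>+ x. \<integral>\<^sup>+ y. k (x, y) \<partial>lborel \<partial>lborel)"
    using lborel.borel_measurable_nn_integral_fst[OF k] by (intro nn_integral_lborel_shift) simp
  also have "\<dots> = rho_sG s G u" unfolding rho_sG_iterated[OF u] by (simp add: k_def slope_def)
  finally show ?thesis .
qed

lemma W_shift:
  fixes u :: "'a::euclidean_space \<Rightarrow> real"
  assumes u: "u \<in> borel_measurable borel" "u \<in> W" shows "(\<lambda>x. u (a + x)) \<in> W"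
proof -
  have "(\<lambda>x. u (a + x)) \<in> borel_measurable borel" using u by simp
  then show ?thesis using u(2) by (simp add: W_space_def rho_G_shift rho_sG_shift u measurable_lebesgueI)
qed

text \<open>Translation preserves both modulars. If continuity failed along some sequence of shifts,
  a subsequence would converge almost everywhere with constant modulars, and
  \<open>equal_modular_limit\<close> would contradict the failure.\<close>

lemma translation_continuous:
  fixes w :: "'a::euclidean_space \<Rightarrow> real"
  assumes w: "w \<in> borel_measurable borel" "w \<in> W" "\<And>x. x \<notin> cball 0 R \<Longrightarrow> w x = 0" and e: "0 < e"
  obtains d where "0 < d" "\<And>a. norm a < d \<Longrightarrow> rho_G G (\<lambda>x. w (a + x) - w x) \<le> ennreal e"
    "\<And>a. norm a < d \<Longrightarrow> rho_sG s G (\<lambda>x. w (a + x) - w x) \<le> ennreal e"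
proof -
  have sW: "(\<lambda>x. w (a + x)) \<in> W" for a by (rule W_shift[OF w(1,2)])
  have dW: "(\<lambda>x. w (a + x) - w x) \<in> W" for a by (intro W_diff sW w(2))
  have eqG: "(LINT x|lebesgue. G (w (a + x))) = (LINT x|lebesgue. G (w x))" for a
  proof -
    have "ennreal (LINT x|lebesgue. G (w (a + x))) = ennreal (LINT x|lebesgue. G (w x))"
      using rho_G_shift[OF w(1)] by (simp add: rho_G_eq_integral[OF sW] rho_G_eq_integral[OF w(2)])
    then show ?thesis by (simp add: integral_nonneg_AE G_nonneg)
  qed
  have eqs: "modular (\<lambda>x. w (a + x)) = modular w" for a
  proof -
    have "ennreal (modular (\<lambda>x. w (a + x))) = ennreal (modular w)"
      using rho_sG_shift[OF w(1)] by (simp add: rho_sG_eq_modular[OF sW] rho_sG_eq_modular[OF w(2)])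
    then show ?thesis by (simp add: modular_nonneg)
  qed
  have "\<exists>d>0. \<forall>a. norm a < d \<longrightarrow> (LINT x|lebesgue. G (w (a + x) - w x)) < e"
  proof (rule ccontr)
    assume "\<not> ?thesis"
    then have "\<exists>a. norm a < inverse (real (Suc n)) \<and> e \<le> (LINT x|lebesgue. G (w (a + x) - w x))" for n
      by (metis inverse_positive_iff_positive not_le of_nat_0_less_iff zero_less_Suc)
    then obtain a where a: "\<And>n. norm (a n) < inverse (real (Suc n))"
      "\<And>n. e \<le> (LINT x|lebesgue. G (w (a n + x) - w x))" by metis
    have "a \<longlonglongrightarrow> 0"
      by (rule Lim_null_comparison[OF _ LIMSEQ_inverse_real_of_nat]) (use a(1) in \<open>auto intro!: always_eventually less_imp_le simp del: of_nat_Suc\<close>)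
    from AE_translation_subsequence[OF w(1,3) this]
    obtain r where r: "strict_mono r" "AE x in lborel. (\<lambda>n. w (a (r n) + x)) \<longlonglongrightarrow> w x" by metis
    have "\<exists>n. (LINT x|lebesgue. G (w (a (r n) + x) - w x)) < e"
      by (rule equal_modular_limit) (use r(2) w(2) sW e in \<open>auto simp: AE_completion_iff eqG dest: W_measurable W_integrable\<close>)
    then show False using a(2) by (meson not_le)
  qed
  moreover have "\<exists>d>0. \<forall>a. norm a < d \<longrightarrow> modular (\<lambda>x. w (a + x) - w x) < e"
  proof (rule ccontr)
    assume "\<not> ?thesis"
    then have "\<exists>a. norm a < inverse (real (Suc n)) \<and> e \<le> modular (\<lambda>x. w (a + x) - w x)" for n
      by (metis inverse_positive_iff_positive not_le of_nat_0_less_iff zero_less_Suc)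
    then obtain a where a: "\<And>n. norm (a n) < inverse (real (Suc n))"
      "\<And>n. e \<le> modular (\<lambda>x. w (a n + x) - w x)" by metis
    have "a \<longlonglongrightarrow> 0"
      by (rule Lim_null_comparison[OF _ LIMSEQ_inverse_real_of_nat]) (use a(1) in \<open>auto intro!: always_eventually less_imp_le simp del: of_nat_Suc\<close>)
    from AE_translation_subsequence[OF w(1,3) this]
    obtain r where r: "strict_mono r" "AE x in lborel. (\<lambda>n. w (a (r n) + x)) \<longlonglongrightarrow> w x" by metis
    then have "AE x in lebesgue. (\<lambda>n. w (a (r n) + x)) \<longlonglongrightarrow> w x" by (simp add: AE_completion_iff)
    from AE_mu_pair[OF this]
    have lim: "AE z in mu. (\<lambda>n. slope s (\<lambda>x. w (a (r n) + x)) z) \<longlonglongrightarrow> slope s w z"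
      unfolding slope_def split_beta divide_inverse by eventually_elim (intro tendsto_intros; simp)
    have "\<exists>n. (LINT z|mu. G (slope s (\<lambda>x. w (a (r n) + x)) z - slope s w z)) < e"
      by (rule equal_modular_limit)
         (use lim w(2) sW e eqs in \<open>auto dest: W_measurable W_integrable_slope intro: measurable_slope\<close>)
    then show False using a(2) unfolding slope_diff by (meson not_le)
  qed
  ultimately obtain d1 d2 where d: "0 < d1" "\<And>a. norm a < d1 \<Longrightarrow> (LINT x|lebesgue. G (w (a + x) - w x)) < e"
    "0 < d2" "\<And>a. norm a < d2 \<Longrightarrow> modular (\<lambda>x. w (a + x) - w x) < e" by metis
  show ?thesis
  proof (rule that[of "min d1 d2"])
    show "rho_G G (\<lambda>x. w (a + x) - w x) \<le> ennreal e" if "norm a < min d1 d2" for a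
      unfolding rho_G_eq_integral[OF dW] using d(2)[of a] that by (intro ennreal_leI) simp
    show "rho_sG s G (\<lambda>x. w (a + x) - w x) \<le> ennreal e" if "norm a < min d1 d2" for a
      unfolding rho_sG_eq_modular[OF dW] using d(4)[of a] that by (intro ennreal_leI) simp
  qed (use d in simp)
qed

end

section \<open>Mollification\<close>

lemma nn_integral_mu_density:
  fixes F :: "'a::euclidean_space \<times> 'a \<Rightarrow> ennreal"
  assumes F: "F \<in> borel_measurable borel"
  shows "(\<integral>\<^sup>+ z. F z \<partial>mu) = (\<integral>\<^sup>+ z. ennreal (1 / dist (fst z) (snd z) ^ DIM('a)) * F z \<partial>lborel)"
  unfolding mu_def using measurable_lebesgueI[OF F]
  by (subst nn_integral_density) (auto simp: nn_integral_completion split_beta)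

context N_growth
begin

text \<open>The tangent inequality at the mean \<open>m\<close>, integrated against
  \<open>\<psi>\<close>; the linear part cancels. An infinite right-hand side is harmless because it
  is an extended integral.\<close>

lemma Jensen:
  fixes \<psi> F :: "'b::euclidean_space \<Rightarrow> real"
  assumes \<psi>: "\<And>h. 0 \<le> \<psi> h" "integrable lborel \<psi>" "(LINT h|lborel. \<psi> h) = 1"
    and F: "F \<in> borel_measurable borel" "integrable lborel (\<lambda>h. \<psi> h * F h)"
  shows "ennreal (G (LINT h|lborel. \<psi> h * F h)) \<le> (\<integral>\<^sup>+ h. ennreal (\<psi> h) * ennreal (G (F h)) \<partial>lborel)"
proof (cases "(\<integral>\<^sup>+ h. ennreal (\<psi> h * G (F h)) \<partial>lborel) < \<infinity>")
  case True
  define m where "m = (LINT h|lborel. \<psi> h * F h)"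
  have int: "integrable lborel (\<lambda>h. \<psi> h * G (F h))"
  proof (rule integrableI_bounded)
    show "(\<lambda>h. \<psi> h * G (F h)) \<in> borel_measurable lborel"
      using \<psi>(2) F(1) measurable_compose[OF F(1) measurable_G] by (auto dest: borel_measurable_integrable)
    show "(\<integral>\<^sup>+ h. ennreal (norm (\<psi> h * G (F h))) \<partial>lborel) < \<infinity>"
      using True \<psi>(1) G_nonneg by (simp add: abs_mult)
  qed
  have "G m = (LINT h|lborel. \<psi> h * (G m - g m * m) + g m * (\<psi> h * F h))"
    using \<psi>(2,3) F(2) by (simp add: m_def[symmetric])
  also have "\<dots> \<le> (LINT h|lborel. \<psi> h * G (F h))"
  proof (rule integral_mono[OF _ int])
    show "integrable lborel (\<lambda>h. \<psi> h * (G m - g m * m) + g m * (\<psi> h * F h))"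
      using \<psi>(2) F(2) by simp
    fix h
    have "\<psi> h * (G m + g m * (F h - m)) \<le> \<psi> h * G (F h)" by (intro mult_left_mono tangent \<psi>(1))
    then show "\<psi> h * (G m - g m * m) + g m * (\<psi> h * F h) \<le> \<psi> h * G (F h)" by (simp add: algebra_simps)
  qed
  finally have "ennreal (G m) \<le> (\<integral>\<^sup>+ h. ennreal (\<psi> h * G (F h)) \<partial>lborel)"
    using nn_integral_eq_integral[OF int] \<psi>(1) G_nonneg by (simp add: ennreal_leI)
  then show ?thesis by (simp add: m_def ennreal_mult' \<psi>(1))
next
  case False
  then show ?thesis by (simp add: ennreal_mult' \<psi>(1) top.not_eq_extremum[symmetric])
qed

text \<open>After Jensen and Fubini, the weighted modular of an average is at most the average of
  the modulars. The weight \<open>k\<close> is 1 for \<open>rho_G\<close> and the singular kernel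
  for \<open>rho_sG\<close>.\<close>

lemma Jensen_iterated:
  fixes \<psi> :: "'b::euclidean_space \<Rightarrow> real" and \<Phi> :: "'c::euclidean_space \<times> 'b \<Rightarrow> real" and k :: "'c \<Rightarrow> ennreal"
  assumes \<psi>: "\<And>h. 0 \<le> \<psi> h" "integrable lborel \<psi>" "(LINT h|lborel. \<psi> h) = 1" "\<psi> \<in> borel_measurable borel"
    and k: "k \<in> borel_measurable borel"
    and \<Phi>: "\<Phi> \<in> borel_measurable borel" "\<And>z. integrable lborel (\<lambda>h. \<psi> h * \<Phi> (z, h))"
    and le: "\<And>h. \<psi> h \<noteq> 0 \<Longrightarrow> (\<integral>\<^sup>+ z. k z * ennreal (G (\<Phi> (z, h))) \<partial>lborel) \<le> e"
  shows "(\<integral>\<^sup>+ z. k z * ennreal (G (LINT h|lborel. \<psi> h * \<Phi> (z, h))) \<partial>lborel) \<le> e"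
proof -
  have slice1: "(\<lambda>h. \<Phi> (z, h)) \<in> borel_measurable borel" for z
    by (rule measurable_compose[OF _ \<Phi>(1)]) (intro borel_measurable_continuous_onI continuous_intros)
  have slice2: "(\<lambda>z. \<Phi> (z, h)) \<in> borel_measurable borel" for h
    by (rule measurable_compose[OF _ \<Phi>(1)]) (intro borel_measurable_continuous_onI continuous_intros)
  have "(\<lambda>x. k (fst x) * (ennreal (\<psi> (snd x)) * ennreal (G (\<Phi> x)))) \<in> borel_measurable (borel :: ('c \<times> 'b) measure)"
    by (intro borel_measurable_times_ennreal measurable_compose[OF measurable_fst_borel k]
        measurable_compose[OF _ measurable_ennreal] measurable_compose[OF measurable_snd_borel \<psi>(4)]
        measurable_compose[OF \<Phi>(1) measurable_G])
  then have joint: "(\<lambda>(z, h). k z * (ennreal (\<psi> h) * ennreal (G (\<Phi> (z, h))))) \<in> borel_measurable (lborel \<Otimes>\<^sub>M lborel)"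
    by (simp add: lborel_prod split_beta')
  have "(\<integral>\<^sup>+ z. k z * ennreal (G (LINT h|lborel. \<psi> h * \<Phi> (z, h))) \<partial>lborel)
      \<le> (\<integral>\<^sup>+ z. k z * (\<integral>\<^sup>+ h. ennreal (\<psi> h) * ennreal (G (\<Phi> (z, h))) \<partial>lborel) \<partial>lborel)"
    by (intro nn_integral_mono mult_left_mono Jensen \<psi> \<Phi>(2) slice1) auto
  also have "\<dots> = (\<integral>\<^sup>+ z. \<integral>\<^sup>+ h. k z * (ennreal (\<psi> h) * ennreal (G (\<Phi> (z, h)))) \<partial>lborel \<partial>lborel)"
    using measurable_compose[OF measurable_compose[OF slice1 measurable_G] measurable_ennreal]
      measurable_compose[OF \<psi>(4) measurable_ennreal]
    by (intro nn_integral_cong nn_integral_cmult[symmetric]) simp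
  also have "\<dots> = (\<integral>\<^sup>+ h. \<integral>\<^sup>+ z. k z * (ennreal (\<psi> h) * ennreal (G (\<Phi> (z, h)))) \<partial>lborel \<partial>lborel)"
    by (rule lborel_pair.Fubini'[OF joint, symmetric])
  also have "\<dots> = (\<integral>\<^sup>+ h. ennreal (\<psi> h) * (\<integral>\<^sup>+ z. k z * ennreal (G (\<Phi> (z, h))) \<partial>lborel) \<partial>lborel)"
  proof (rule nn_integral_cong)
    fix h
    have "(\<lambda>z. k z * ennreal (G (\<Phi> (z, h)))) \<in> borel_measurable lborel"
      using k measurable_compose[OF measurable_compose[OF slice2[of h] measurable_G] measurable_ennreal] by simp
    then show "(\<integral>\<^sup>+ z. k z * (ennreal (\<psi> h) * ennreal (G (\<Phi> (z, h)))) \<partial>lborel)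
        = ennreal (\<psi> h) * (\<integral>\<^sup>+ z. k z * ennreal (G (\<Phi> (z, h))) \<partial>lborel)"
      by (subst nn_integral_cmult[symmetric]) (simp_all add: mult.left_commute)
  qed
  also have "\<dots> \<le> (\<integral>\<^sup>+ h. ennreal (\<psi> h) * e \<partial>lborel)"
  proof (rule nn_integral_mono)
    fix h show "ennreal (\<psi> h) * (\<integral>\<^sup>+ z. k z * ennreal (G (\<Phi> (z, h))) \<partial>lborel) \<le> ennreal (\<psi> h) * e"
      using le[of h] by (cases "\<psi> h = 0") (auto intro: mult_left_mono)
  qed
  also have "\<dots> = (\<integral>\<^sup>+ h. ennreal (\<psi> h) \<partial>lborel) * e"
    using measurable_compose[OF \<psi>(4) measurable_ennreal] by (simp add: nn_integral_multc)
  also have "\<dots> = e" using nn_integral_eq_integral[OF \<psi>(2)] \<psi>(1,3) by simp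
  finally show ?thesis .
qed

end

context fractional_Orlicz_Sobolev
begin

text \<open>The error is the \<open>\<psi>\<close>-average of the differences
  \<open>w (h + x) - w x\<close>, and taking slopes commutes with averaging. So closeness of all
  translates in the support of \<open>\<psi>\<close> passes to the convolution.\<close>

lemma mollification_close:
  fixes w \<psi> :: "'a::euclidean_space \<Rightarrow> real"
  assumes w: "w \<in> borel_measurable borel" "integrable lborel w"
    and \<psi>: "\<And>h. 0 \<le> \<psi> h" "integrable lborel \<psi>" "(LINT h|lborel. \<psi> h) = 1" "continuous_on UNIV \<psi>"
      "\<And>h. h \<notin> cball c r \<Longrightarrow> \<psi> h = 0"
    and close: "\<And>h. \<psi> h \<noteq> 0 \<Longrightarrow> rho_G G (\<lambda>x. w (h + x) - w x) \<le> e"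
      "\<And>h. \<psi> h \<noteq> 0 \<Longrightarrow> rho_sG s G (\<lambda>x. w (h + x) - w x) \<le> e"
  defines "\<phi> \<equiv> \<lambda>x. LINT z|lborel. w z * \<psi> (z - x)"
  shows "rho_G G (\<lambda>x. \<phi> x - w x) \<le> e" and "rho_sG s G (\<lambda>x. \<phi> x - w x) \<le> e"
proof -
  have \<psi>m: "\<psi> \<in> borel_measurable borel" by (rule borel_measurable_continuous_onI[OF \<psi>(4)])
  have prod_int: "integrable lborel (\<lambda>z. w z * \<psi> (z - x))" for x
    by (rule integrable_mult_vanishing[OF w(2) \<psi>(4,5)])
  have pm: "(\<lambda>z. w z * \<psi> (z - x)) \<in> borel_measurable borel" for x
    using w(1) \<psi>m by simp
  have shift: "\<phi> x = (LINT h|lborel. \<psi> h * w (h + x))" "integrable lborel (\<lambda>h. \<psi> h * w (h + x))" for x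
  proof -
    show "\<phi> x = (LINT h|lborel. \<psi> h * w (h + x))"
      unfolding \<phi>_def using integral_lborel_shift(1)[OF pm[of x], of x] by (simp add: mult.commute add.commute)
    show "integrable lborel (\<lambda>h. \<psi> h * w (h + x))"
      using integral_lborel_shift(2)[OF pm[of x], of x] prod_int[of x] by (simp add: mult.commute add.commute)
  qed
  define \<Delta> where "\<Delta> h x = w (h + x) - w x" for h x
  have \<Delta>_int: "integrable lborel (\<lambda>h. \<psi> h * \<Delta> h x)" for x
    using shift(2)[of x] \<psi>(2) by (simp add: \<Delta>_def right_diff_distrib)
  have diff: "\<phi> x - w x = (LINT h|lborel. \<psi> h * \<Delta> h x)" for x
    using shift[of x] \<psi>(2,3) by (simp add: \<Delta>_def right_diff_distrib)
  have \<Delta>m: "(\<lambda>h. \<Delta> h x) \<in> borel_measurable borel" for x unfolding \<Delta>_def using w(1) by simp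
  have w_joint: "(\<lambda>x. w (snd x + fst x)) \<in> borel_measurable (borel :: ('a \<times> 'a) measure)"
    by (rule measurable_compose[OF _ w(1)]) (intro borel_measurable_continuous_onI continuous_intros)
  have "(\<integral>\<^sup>+ x. 1 * ennreal (G (LINT h|lborel. \<psi> h * (case (x, h) of (x, h) \<Rightarrow> \<Delta> h x))) \<partial>lborel) \<le> e"
  proof (rule Jensen_iterated)
    show "(\<lambda>(x, h). \<Delta> h x) \<in> borel_measurable borel"
      unfolding \<Delta>_def split_beta'
      by (intro borel_measurable_diff w_joint measurable_compose[OF measurable_fst_borel w(1)])
    show "(\<integral>\<^sup>+ z. 1 * ennreal (G (case (z, h) of (x, h) \<Rightarrow> \<Delta> h x)) \<partial>lborel) \<le> e" if "\<psi> h \<noteq> 0" for h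
      using close(1)[OF that] by (simp add: rho_G_alt nn_integral_completion \<Delta>_def)
  qed (use \<psi> \<psi>m \<Delta>_int in auto)
  then show "rho_G G (\<lambda>x. \<phi> x - w x) \<le> e" by (simp add: rho_G_alt nn_integral_completion diff)
  let ?k = "\<lambda>z :: 'a \<times> 'a. ennreal (1 / dist (fst z) (snd z) ^ DIM('a))"
  have k: "?k \<in> borel_measurable borel" using measurable_kernel[of "DIM('a)"] by (simp add: split_beta')
  define \<Phi> where "\<Phi> y = slope s (\<Delta> (snd y)) (fst y)" for y :: "('a \<times> 'a) \<times> 'a"
  have \<Phi>m: "\<Phi> \<in> borel_measurable borel"
  proof -
    have "(\<lambda>y :: ('a \<times> 'a) \<times> 'a. w (snd y + fst (fst y))) \<in> borel_measurable borel"
      "(\<lambda>y :: ('a \<times> 'a) \<times> 'a. w (snd y + snd (fst y))) \<in> borel_measurable borel"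
      "(\<lambda>y :: ('a \<times> 'a) \<times> 'a. w (fst (fst y))) \<in> borel_measurable borel"
      "(\<lambda>y :: ('a \<times> 'a) \<times> 'a. w (snd (fst y))) \<in> borel_measurable borel"
      by (rule measurable_compose[OF _ w(1)], intro borel_measurable_continuous_onI continuous_intros)+
    moreover have "(\<lambda>y :: ('a \<times> 'a) \<times> 'a. dist (fst (fst y)) (snd (fst y)) powr s) \<in> borel_measurable borel"
      by (rule measurable_compose[OF measurable_fst_borel measurable_dist_powr])
    ultimately show ?thesis
      unfolding \<Phi>_def slope_def \<Delta>_def split_beta by (intro borel_measurable_divide borel_measurable_diff)
  qed
  have \<Phi>_eq: "\<psi> h * \<Phi> (z, h) = (\<psi> h * \<Delta> h (fst z) - \<psi> h * \<Delta> h (snd z)) / dist (fst z) (snd z) powr s" for z h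
    by (simp add: \<Phi>_def slope_def split_beta right_diff_distrib)
  have \<Phi>_int: "integrable lborel (\<lambda>h. \<psi> h * \<Phi> (z, h))" for z
    unfolding \<Phi>_eq by (intro integrable_divide Bochner_Integration.integrable_diff \<Delta>_int) 
  have slope_diff_eq: "slope s (\<lambda>x. \<phi> x - w x) z = (LINT h|lborel. \<psi> h * \<Phi> (z, h))" for z
    unfolding \<Phi>_eq using \<Delta>_int by (simp add: slope_def split_beta diff)
  have \<Delta>xm: "\<Delta> h \<in> borel_measurable borel" for h unfolding \<Delta>_def using w(1) by simp
  have G_slope_m: "(\<lambda>z. ennreal (G (slope s u z))) \<in> borel_measurable borel" if "u \<in> borel_measurable borel" for u :: "'a \<Rightarrow> real"
    by (rule measurable_compose[OF measurable_compose[OF measurable_slope_borel[OF that] measurable_G] measurable_ennreal])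
  have "(\<integral>\<^sup>+ z. ?k z * ennreal (G (LINT h|lborel. \<psi> h * \<Phi> (z, h))) \<partial>lborel) \<le> e"
  proof (rule Jensen_iterated[OF \<psi>(1-3) \<psi>m k \<Phi>m \<Phi>_int])
    show "(\<integral>\<^sup>+ z. ?k z * ennreal (G (\<Phi> (z, h))) \<partial>lborel) \<le> e" if "\<psi> h \<noteq> 0" for h
      using close(2)[OF that] nn_integral_mu_density[OF G_slope_m[OF \<Delta>xm[of h]]]
      by (simp add: rho_sG_slope \<Phi>_def \<Delta>_def[abs_def])
  qed
  moreover have "(\<lambda>x. \<phi> x - w x) \<in> borel_measurable borel"
  proof -
    have "(\<lambda>y :: 'a \<times> 'a. w (snd y) * \<psi> (snd y - fst y)) \<in> borel_measurable borel"
      by (intro borel_measurable_times measurable_compose[OF measurable_snd_borel w(1)]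
          measurable_compose[OF _ \<psi>m] borel_measurable_continuous_onI continuous_intros)
    then have "(\<lambda>(x, z). w z * \<psi> (z - x)) \<in> borel_measurable (lborel \<Otimes>\<^sub>M lborel)"
      by (simp add: lborel_prod split_beta')
    then have "\<phi> \<in> borel_measurable lborel"
      unfolding \<phi>_def by (rule lborel.borel_measurable_lebesgue_integral)
    then show ?thesis using w(1) by simp
  qed
  ultimately show "rho_sG s G (\<lambda>x. \<phi> x - w x) \<le> e"
    using nn_integral_mu_density[OF G_slope_m[of "\<lambda>x. \<phi> x - w x"]] by (simp add: rho_sG_slope slope_diff_eq)
qed

end

section \<open>Density of test functions\<close>

lemma Cc_infinityI:
  assumes "smooth \<phi>" "compact Q" "Q \<subseteq> \<Omega>" "\<And>x. \<phi> x \<noteq> 0 \<Longrightarrow> x \<in> Q"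
  shows "\<phi> \<in> Cc_infinity \<Omega>"
proof -
  have "closure {x. \<phi> x \<noteq> 0} \<subseteq> Q"
    using assms(2,4) by (intro closure_minimal compact_imp_closed) auto
  moreover from this have "compact (closure {x. \<phi> x \<noteq> 0})"
    using compact_Int_closed[OF assms(2) closed_closure, of "{x. \<phi> x \<noteq> 0}"] by (simp only: Int_absorb1)
  ultimately show ?thesis using assms by (simp add: Cc_infinity_def)
qed

lemma Cc_infinity_add:
  assumes "\<phi> \<in> Cc_infinity \<Omega>" "\<psi> \<in> Cc_infinity \<Omega>"
  shows "(\<lambda>x. \<phi> x + \<psi> x) \<in> Cc_infinity \<Omega>"
proof (rule Cc_infinityI[where Q = "closure {x. \<phi> x \<noteq> 0} \<union> closure {x. \<psi> x \<noteq> 0}"])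
  show "smooth (\<lambda>x. \<phi> x + \<psi> x)" using assms by (auto simp: Cc_infinity_def smooth_def intro: Ck_add)
  show "x \<in> closure {x. \<phi> x \<noteq> 0} \<union> closure {x. \<psi> x \<noteq> 0}" if "\<phi> x + \<psi> x \<noteq> 0" for x
    using that closure_subset[of "{x. \<phi> x \<noteq> 0}"] closure_subset[of "{x. \<psi> x \<noteq> 0}"] by force
qed (use assms in \<open>auto simp: Cc_infinity_def\<close>)

lemma Cc_infinity_0: "(\<lambda>x. 0) \<in> Cc_infinity \<Omega>"
  by (rule Cc_infinityI[where Q = "{}"]) (auto simp: smooth_def Ck_const)

text \<open>In an interior ball the zero vector serves as direction \<open>e\<close>.\<close>

lemma smooth_domain_push:
  fixes \<Omega> :: "'a::euclidean_space set"
  assumes \<Omega>: "smooth_bounded_domain \<Omega>" and p: "p \<in> closure \<Omega>"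
  obtains r t0 e where "0 < r" "0 < t0" "norm e \<le> 1"
    "\<And>t x. 0 < t \<Longrightarrow> t < t0 \<Longrightarrow> x \<in> closure \<Omega> \<inter> cball p r \<Longrightarrow> x + t *\<^sub>R e \<in> \<Omega>"
proof (cases "p \<in> \<Omega>")
  case True
  have "open \<Omega>" using \<Omega> by (simp add: smooth_bounded_domain_def)
  then obtain r where "r > 0" "cball p r \<subseteq> \<Omega>" using True open_contains_cball by blast
  then show ?thesis by (intro that[of r 1 0]) auto
next
  case False
  have "open \<Omega>" using \<Omega> by (simp add: smooth_bounded_domain_def)
  then have "p \<in> frontier \<Omega>" using p False by (simp add: frontier_def interior_open)
  then obtain r e \<gamma> where r: "r > 0" and e: "norm e = 1" and \<gamma>: "smooth \<gamma>" "\<And>x t. \<gamma> (x + t *\<^sub>R e) = \<gamma> x"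
    and graph: "\<Omega> \<inter> ball p r = {x \<in> ball p r. x \<bullet> e > \<gamma> x}"
    using \<Omega> unfolding smooth_bounded_domain_def by blast
  have \<gamma>_cont: "continuous_on UNIV \<gamma>" by (rule smooth_continuous[OF \<gamma>(1)])
  show ?thesis
  proof (rule that[of "r / 2" "r / 2" e])
    fix t x assume t: "0 < t" "t < r / 2" and x: "x \<in> closure \<Omega> \<inter> cball p (r / 2)"
    have xb: "x \<in> ball p r" using x r by auto
    \<comment> \<open>The points strictly below the graph form an open set that misses \<Omega>
      inside the ball, hence they miss the closure. A positive step along \<open>e\<close> then
      raises \<open>x \<bullet> e\<close> strictly and leaves \<open>\<gamma>\<close>
      unchanged.\<close>
    have "\<gamma> x \<le> x \<bullet> e"
    proof (rule ccontr)
      assume "\<not> \<gamma> x \<le> x \<bullet> e"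
      define S where "S = {y. y \<bullet> e < \<gamma> y} \<inter> ball p r"
      have "open {y. y \<bullet> e < \<gamma> y}" by (intro open_Collect_less \<gamma>_cont continuous_intros)
      then have "open S" by (auto simp: S_def)
      moreover have "x \<in> S" using \<open>\<not> \<gamma> x \<le> x \<bullet> e\<close> xb by (simp add: S_def)
      ultimately obtain y where "y \<in> \<Omega>" "y \<in> S" using x by (metis Int_iff closure_iff_nhds_not_empty disjoint_iff order_refl)
      then have "y \<in> \<Omega> \<inter> ball p r" "y \<bullet> e < \<gamma> y" by (auto simp: S_def)
      then show False unfolding graph by simp
    qed
    moreover have "e \<bullet> e = 1" using e by (simp add: norm_eq_sqrt_inner)
    ultimately have "\<gamma> (x + t *\<^sub>R e) < (x + t *\<^sub>R e) \<bullet> e" using t \<gamma>(2) by (simp add: inner_add_left)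
    moreover have "x + t *\<^sub>R e \<in> ball p r"
    proof -
      have "dist p (x + t *\<^sub>R e) \<le> dist p x + dist x (x + t *\<^sub>R e)" by (rule dist_triangle)
      also have "dist x (x + t *\<^sub>R e) = t" using t e by (simp add: dist_norm)
      finally show ?thesis using x t by auto
    qed
    ultimately have "x + t *\<^sub>R e \<in> \<Omega> \<inter> ball p r" unfolding graph by simp
    then show "x + t *\<^sub>R e \<in> \<Omega>" by simp
  qed (use r e in auto)
qed

section \<open>Approximation by test functions in modular\<close>

context fractional_Orlicz_Sobolev
begin

text \<open>Closeness is measured by modulars instead of \<open>W_norm\<close>, since the estimates
  for translation and mollification are estimates of modulars.\<close>

definition approximable :: "'a::euclidean_space set \<Rightarrow> ('a \<Rightarrow> real) \<Rightarrow> bool" where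
  "approximable \<Omega> v \<longleftrightarrow> v \<in> W \<and> (\<forall>\<epsilon>>0. \<exists>\<phi>\<in>Cc_infinity \<Omega>.
     rho_G G (\<lambda>x. \<phi> x - v x) \<le> ennreal \<epsilon> \<and> rho_sG s G (\<lambda>x. \<phi> x - v x) \<le> ennreal \<epsilon>)"

lemma rho_add_le:
  assumes u: "u \<in> W" and v: "v \<in> W" and le: "rho_G G u \<le> ennreal a" "rho_sG s G u \<le> ennreal a"
    "rho_G G v \<le> ennreal a" "rho_sG s G v \<le> ennreal a" and a: "0 \<le> a"
  shows "rho_G G (\<lambda>x. u x + v x) \<le> ennreal (2 powr q * (2 * a))"
    and "rho_sG s G (\<lambda>x. u x + v x) \<le> ennreal (2 powr q * (2 * a))"
proof -
  have pw: "ennreal (G (x + y)) \<le> ennreal (2 powr q) * (ennreal (G x) + ennreal (G y))" for x y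
    using G_add[of x y] by (simp add: ennreal_plus[symmetric] ennreal_mult'[symmetric] G_nonneg ennreal_leI del: ennreal_plus)
  have const: "ennreal (2 powr q) * (ennreal a + ennreal a) = ennreal (2 powr q * (2 * a))"
    using a by (simp add: ennreal_plus[symmetric] ennreal_mult'[symmetric] del: ennreal_plus)
  have "rho_G G (\<lambda>x. u x + v x) \<le> (\<integral>\<^sup>+ x. ennreal (2 powr q) * (ennreal (G (u x)) + ennreal (G (v x))) \<partial>lebesgue)"
    unfolding rho_G_alt by (intro nn_integral_mono pw)
  also have "\<dots> = ennreal (2 powr q) * (rho_G G u + rho_G G v)"
    using W_measurable[OF u] W_measurable[OF v] unfolding rho_G_alt
    by (subst nn_integral_cmult) (auto simp: nn_integral_add)
  also have "\<dots> \<le> ennreal (2 powr q) * (ennreal a + ennreal a)" by (intro mult_left_mono add_mono le) auto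
  finally show "rho_G G (\<lambda>x. u x + v x) \<le> ennreal (2 powr q * (2 * a))" unfolding const .
  have m: "(\<lambda>z. ennreal (G (slope s f z))) \<in> borel_measurable mu" if "f \<in> W" for f :: "'a \<Rightarrow> real"
    using measurable_compose[OF measurable_G_slope(1)[OF W_measurable[OF that]] measurable_ennreal] by simp
  have "rho_sG s G (\<lambda>x. u x + v x) \<le> (\<integral>\<^sup>+ z. ennreal (2 powr q) * (ennreal (G (slope s u z)) + ennreal (G (slope s v z))) \<partial>mu)"
    unfolding rho_sG_slope slope_add by (intro nn_integral_mono pw)
  also have "\<dots> = ennreal (2 powr q) * (rho_sG s G u + rho_sG s G v)"
    using m[OF u] m[OF v] unfolding rho_sG_slope
    by (subst nn_integral_cmult) (auto simp: nn_integral_add)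
  also have "\<dots> \<le> ennreal (2 powr q) * (ennreal a + ennreal a)" by (intro mult_left_mono add_mono le) auto
  finally show "rho_sG s G (\<lambda>x. u x + v x) \<le> ennreal (2 powr q * (2 * a))" unfolding const .
qed

lemma approximable_add:
  assumes u: "approximable \<Omega> u" and v: "approximable \<Omega> v"
  shows "approximable \<Omega> (\<lambda>x. u x + v x)"
  unfolding approximable_def
proof (intro conjI allI impI)
  have W: "u \<in> W" "v \<in> W" using u v by (auto simp: approximable_def)
  then show "(\<lambda>x. u x + v x) \<in> W" by (rule W_add)
  fix \<epsilon> :: real assume \<epsilon>: "0 < \<epsilon>"
  define a where "a = \<epsilon> / (2 * 2 powr q)"
  have a: "0 < a" "2 powr q * (2 * a) = \<epsilon>" using \<epsilon> by (auto simp: a_def)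
  obtain \<phi> where \<phi>: "\<phi> \<in> Cc_infinity \<Omega>" "rho_G G (\<lambda>x. \<phi> x - u x) \<le> ennreal a" "rho_sG s G (\<lambda>x. \<phi> x - u x) \<le> ennreal a"
    using u a(1) unfolding approximable_def by blast
  obtain \<psi> where \<psi>: "\<psi> \<in> Cc_infinity \<Omega>" "rho_G G (\<lambda>x. \<psi> x - v x) \<le> ennreal a" "rho_sG s G (\<lambda>x. \<psi> x - v x) \<le> ennreal a"
    using v a(1) unfolding approximable_def by blast
  have "(\<lambda>x. \<phi> x - u x) \<in> W" "(\<lambda>x. \<psi> x - v x) \<in> W"
    using \<phi>(1) \<psi>(1) W by (auto intro: W_diff Cc_infinity_in_W)
  from rho_add_le[OF this \<phi>(2,3) \<psi>(2,3)] a
  have "rho_G G (\<lambda>x. (\<phi> x + \<psi> x) - (u x + v x)) \<le> ennreal \<epsilon> \<and> rho_sG s G (\<lambda>x. (\<phi> x + \<psi> x) - (u x + v x)) \<le> ennreal \<epsilon>"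
    by (simp_all add: add_diff_add)
  then show "\<exists>\<phi>\<in>Cc_infinity \<Omega>. rho_G G (\<lambda>x. \<phi> x - (u x + v x)) \<le> ennreal \<epsilon> \<and> rho_sG s G (\<lambda>x. \<phi> x - (u x + v x)) \<le> ennreal \<epsilon>"
    by (rule bexI[OF _ Cc_infinity_add[OF \<phi>(1) \<psi>(1)]])
qed

text \<open>The bump is centred at \<open>- (t *\<^sub>R e)\<close> instead of 0, so a single
  convolution both smooths \<open>w\<close> and pushes its support into \<Omega>.\<close>

lemma approximable_local:
  fixes w :: "'a::euclidean_space \<Rightarrow> real"
  assumes \<Omega>: "open \<Omega>" and w: "w \<in> borel_measurable borel" "w \<in> W"
    and K: "compact K" "\<And>x. x \<notin> K \<Longrightarrow> w x = 0"
    and push: "0 < t0" "norm e \<le> 1" "\<And>t x. 0 < t \<Longrightarrow> t < t0 \<Longrightarrow> x \<in> K \<Longrightarrow> x + t *\<^sub>R e \<in> \<Omega>"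
  shows "approximable \<Omega> w"
  unfolding approximable_def
proof (intro conjI w(2) allI impI)
  fix \<epsilon> :: real assume \<epsilon>: "0 < \<epsilon>"
  obtain R where "K \<subseteq> ball 0 R" using compact_imp_bounded[OF K(1)] bounded_subset_ballD by metis
  then have out: "w x = 0" if "x \<notin> cball 0 R" for x
    using that ball_subset_cball[of 0 R] by (intro K(2)) blast
  obtain d where d: "0 < d" "\<And>a. norm a < d \<Longrightarrow> rho_G G (\<lambda>x. w (a + x) - w x) \<le> ennreal \<epsilon>"
    "\<And>a. norm a < d \<Longrightarrow> rho_sG s G (\<lambda>x. w (a + x) - w x) \<le> ennreal \<epsilon>"
    using translation_continuous[OF w out \<epsilon>] by metis
  \<comment> \<open>Below \<open>t0\<close> for the push, and at most \<open>d / 2\<close>, so that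
    together with the bump radius \<open>r \<le> d / 2\<close> every shift in the support of the
    bump is shorter than \<open>d\<close>.\<close>
  define t where "t = min (t0 / 2) (d / 2)"
  have t: "0 < t" "t < t0" "t \<le> d / 2" using push(1) d(1) by (auto simp: t_def)
  define K' where "K' = (+) (t *\<^sub>R e) ` K"
  have K': "compact K'" "K' \<subseteq> \<Omega>"
    using push(3)[OF t(1,2)] compact_translation[OF K(1), of "t *\<^sub>R e"] by (auto simp: K'_def add.commute)
  then obtain r0 where r0: "0 < r0" "(\<Union>x\<in>K'. cball x r0) \<subseteq> \<Omega>"
    using compact_subset_open_imp_cball_epsilon_subset[OF K'(1) \<Omega> K'(2)] by blast
  define r where "r = min r0 (d / 2)"
  have r: "0 < r" "r \<le> r0" "r \<le> d / 2" using r0(1) d(1) by (auto simp: r_def)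
  define c where "c = - (t *\<^sub>R e)"
  obtain \<psi> where \<psi>: "smooth \<psi>" "\<And>x. 0 \<le> \<psi> x" "\<And>x. x \<notin> ball c r \<Longrightarrow> \<psi> x = 0"
    "integrable lborel \<psi>" "(LINT x|lborel. \<psi> x) = 1"
    using exists_bump[OF r(1)] by metis
  have \<psi>_out: "\<psi> x = 0" if "x \<notin> cball c r" for x using that by (intro \<psi>(3)) auto
  have small: "norm h < d" if "\<psi> h \<noteq> 0" for h
  proof -
    have "h \<in> ball c r" using \<psi>(3) that by blast
    then have "norm (h - c) < r" by (simp add: dist_norm norm_minus_commute)
    moreover have "norm c \<le> t" using t(1) push(2) by (simp add: c_def mult_left_le)
    moreover have "norm h \<le> norm (h - c) + norm c" using norm_triangle_ineq[of "h - c" c] by simp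
    ultimately show ?thesis using r(3) t(3) by linarith
  qed
  have w_int: "integrable lborel w"
  proof (rule integrableI_bounded)
    \<comment> \<open>Where \<open>\<bar>w x\<bar>\<close> exceeds 1, convexity bounds it by
      \<open>G (w x) / G 1\<close>; elsewhere the indicator of a ball containing the support
      suffices.\<close>
    have "\<bar>w x\<bar> \<le> indicator (cball 0 R) x + G (w x) / G 1" for x
    proof (cases "\<bar>w x\<bar> \<le> 1")
      case True
      then show ?thesis using out[of x] G_nonneg by (cases "x \<in> cball 0 R") (auto simp: add_increasing2)
    next
      case False
      then have "G (1 / \<bar>w x\<bar> * \<bar>w x\<bar>) \<le> 1 / \<bar>w x\<bar> * G \<bar>w x\<bar>" by (intro G_scale_le) auto
      moreover have "w x \<noteq> 0" using False by auto
      ultimately have "\<bar>w x\<bar> * G 1 \<le> G (w x)" using False by (simp add: field_simps)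
      then have "\<bar>w x\<bar> \<le> G (w x) / G 1" using G_pos[of 1] by (simp add: field_simps)
      then show ?thesis by (simp add: add_increasing)
    qed
    then have "(\<integral>\<^sup>+ x. ennreal (norm (w x)) \<partial>lborel) \<le> (\<integral>\<^sup>+ x. ennreal (indicator (cball 0 R) x + G (w x) / G 1) \<partial>lborel)"
      by (intro nn_integral_mono ennreal_leI) simp
    also have "\<dots> < \<infinity>"
    proof -
      have "integrable lborel (\<lambda>x. G (w x))"
        using W_integrable[OF w(2)] measurable_compose[OF w(1) measurable_G] by (simp add: integrable_completion)
      then have "integrable lborel (\<lambda>x. indicator (cball 0 R) x + G (w x) / G 1)"
        by (intro Bochner_Integration.integrable_add integrable_divide integrable_real_indicator emeasure_bounded_finite) auto
      then show ?thesis by (simp add: integrable_iff_bounded G_nonneg)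
    qed
    finally show "(\<integral>\<^sup>+ x. ennreal (norm (w x)) \<partial>lborel) < \<infinity>" .
  qed (use w(1) in simp)
  define \<phi> where "\<phi> x = (LINT z|lborel. w z * \<psi> (z - x))" for x
  have "\<phi> \<in> Cc_infinity \<Omega>"
  proof (rule Cc_infinityI)
    show "smooth \<phi>" unfolding \<phi>_def by (rule smooth_convolution[OF w_int \<psi>(1) \<psi>_out])
    show "compact {x + y |x y. x \<in> K' \<and> y \<in> cball 0 r}" by (intro compact_sums K') auto
    show "{x + y |x y. x \<in> K' \<and> y \<in> cball 0 r} \<subseteq> \<Omega>"
    proof safe
      fix x y :: 'a assume "x \<in> K'" "y \<in> cball 0 r"
      then have "x + y \<in> cball x r0" using r(2) by (simp add: dist_norm)
      then show "x + y \<in> \<Omega>" using r0(2) \<open>x \<in> K'\<close> by blast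
    qed
    fix x assume "\<phi> x \<noteq> 0"
    have "\<exists>z. w z * \<psi> (z - x) \<noteq> 0"
    proof (rule ccontr)
      assume "\<not> ?thesis"
      then have "(\<lambda>z. w z * \<psi> (z - x)) = (\<lambda>z. 0)" by (auto simp: fun_eq_iff)
      then show False using \<open>\<phi> x \<noteq> 0\<close> by (simp add: \<phi>_def)
    qed
    then obtain z where z: "w z \<noteq> 0" "\<psi> (z - x) \<noteq> 0" by auto
    then have "z \<in> K" "z - x \<in> ball c r" using K(2) \<psi>(3) by blast+
    then have "t *\<^sub>R e + z \<in> K'" "norm (c - (z - x)) < r" by (auto simp: K'_def dist_norm)
    moreover have "x = (t *\<^sub>R e + z) + (c - (z - x))" by (simp add: c_def)
    ultimately show "x \<in> {x + y |x y. x \<in> K' \<and> y \<in> cball 0 r}"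
      by (smt (verit) mem_Collect_eq mem_cball_0)
  qed
  moreover have "rho_G G (\<lambda>x. \<phi> x - w x) \<le> ennreal \<epsilon>" "rho_sG s G (\<lambda>x. \<phi> x - w x) \<le> ennreal \<epsilon>"
    unfolding \<phi>_def using d(2,3) small
    by (intro mollification_close[OF w(1) w_int \<psi>(2,4,5) smooth_continuous[OF \<psi>(1)] \<psi>_out]; blast)+
  ultimately show "\<exists>\<phi>\<in>Cc_infinity \<Omega>. rho_G G (\<lambda>x. \<phi> x - w x) \<le> ennreal \<epsilon> \<and> rho_sG s G (\<lambda>x. \<phi> x - w x) \<le> ennreal \<epsilon>"
    by blast
qed

text \<open>Induction over a finite cover takes the place of a partition of unity: \<open>u\<close>
  is split into \<open>\<eta> * u\<close>, supported where a single push direction works, and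
  \<open>(1 - \<eta>) * u\<close>, which vanishes on the half ball of \<open>p\<close> and therefore
  needs only the remaining balls.\<close>

lemma approximable_W0:
  fixes \<Omega> :: "'a::euclidean_space set"
  assumes \<Omega>: "smooth_bounded_domain \<Omega>"
    and v: "v \<in> borel_measurable borel" "v \<in> W" "\<And>x. x \<notin> \<Omega> \<Longrightarrow> v x = 0"
  shows "approximable \<Omega> v"
proof -
  have \<Omega>': "open \<Omega>" "bounded \<Omega>" using \<Omega> by (auto simp: smooth_bounded_domain_def)
  have "\<forall>p\<in>closure \<Omega>. \<exists>r. 0 < r \<and> (\<exists>t0 e. 0 < t0 \<and> norm e \<le> 1 \<and>
      (\<forall>t x. 0 < t \<longrightarrow> t < t0 \<longrightarrow> x \<in> closure \<Omega> \<inter> cball p r \<longrightarrow> x + t *\<^sub>R e \<in> \<Omega>))"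
    using smooth_domain_push[OF \<Omega>] by metis
  then obtain r where r: "\<And>p. p \<in> closure \<Omega> \<Longrightarrow> 0 < r p"
    and push: "\<And>p. p \<in> closure \<Omega> \<Longrightarrow> \<exists>t0 e. 0 < t0 \<and> norm e \<le> 1 \<and>
      (\<forall>t x. 0 < t \<longrightarrow> t < t0 \<longrightarrow> x \<in> closure \<Omega> \<inter> cball p (r p) \<longrightarrow> x + t *\<^sub>R e \<in> \<Omega>)" by metis
  have step: "approximable \<Omega> u"
    if "finite F" "F \<subseteq> closure \<Omega>" "u \<in> borel_measurable borel" "u \<in> W" "\<And>x. x \<notin> \<Omega> \<Longrightarrow> u x = 0"
      "\<And>x. x \<notin> (\<Union>p\<in>F. ball p (r p / 2)) \<Longrightarrow> u x = 0" for F u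
    using that
  proof (induction F arbitrary: u rule: finite_induct)
    case empty
    then have "u = (\<lambda>x. 0)" by auto
    then show ?case using empty Cc_infinity_0[of \<Omega>] unfolding approximable_def
      by (auto intro!: bexI[of _ "\<lambda>x. 0"] simp: rho_G_alt rho_sG_slope slope_def split_beta)
  next
    case (insert p F)
    have p: "p \<in> closure \<Omega>" and rp: "0 < r p" using insert r by auto
    \<comment> \<open>Equal to 1 up to distance \<open>r p / 2\<close> from \<open>p\<close>, zero
      from distance \<open>r p\<close> on, with Lipschitz constant \<open>2 / r p\<close> in
      between.\<close>
    define \<eta> where "\<eta> x = max 0 (min 1 (2 - 2 / r p * dist p x))" for x
    have \<eta>m: "\<eta> \<in> borel_measurable borel"
      unfolding \<eta>_def by (intro borel_measurable_continuous_onI continuous_intros)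
    have \<eta>_bounds: "0 \<le> \<eta> x" "\<eta> x \<le> 1" for x by (auto simp: \<eta>_def)
    define M where "M = max 1 (2 / r p)"
    have \<eta>_lip: "\<bar>\<eta> x - \<eta> y\<bar> \<le> M * min 1 (dist x y)" for x y
    proof -
      have "\<bar>\<eta> x - \<eta> y\<bar> \<le> \<bar>2 / r p * dist p x - 2 / r p * dist p y\<bar>" unfolding \<eta>_def by linarith
      also have "\<dots> = 2 / r p * \<bar>dist p x - dist p y\<bar>"
        unfolding right_diff_distrib[symmetric] abs_mult using rp by simp
      also have "\<dots> \<le> 2 / r p * dist x y"
        using rp abs_dist_diff_le[of x p y] by (intro mult_left_mono) (auto simp: dist_commute)
      also have "\<dots> \<le> M * dist x y" by (intro mult_right_mono) (auto simp: M_def)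
      finally have 1: "\<bar>\<eta> x - \<eta> y\<bar> \<le> M * dist x y" .
      have "\<bar>\<eta> x - \<eta> y\<bar> \<le> 1" using \<eta>_bounds[of x] \<eta>_bounds[of y] by linarith
      then have 2: "\<bar>\<eta> x - \<eta> y\<bar> \<le> M * 1" by (simp add: M_def)
      show ?thesis using 1 2 by (simp add: min_def)
    qed
    have "approximable \<Omega> (\<lambda>x. \<eta> x * u x)"
    proof -
      obtain t0 e where te: "0 < t0" "norm e \<le> 1"
        "\<And>t x. 0 < t \<Longrightarrow> t < t0 \<Longrightarrow> x \<in> closure \<Omega> \<inter> cball p (r p) \<Longrightarrow> x + t *\<^sub>R e \<in> \<Omega>"
        using push[OF p] by blast
      show ?thesis
      proof (rule approximable_local[OF \<Omega>'(1) _ _ _ _ te])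
        show "(\<lambda>x. \<eta> x * u x) \<in> borel_measurable borel" using \<eta>m insert.prems(2) by simp
        show "(\<lambda>x. \<eta> x * u x) \<in> W"
          using \<eta>_bounds by (intro W_cutoff[OF insert.prems(3) \<eta>m _ \<eta>_lip]) (simp add: abs_le_iff order_trans[OF _ \<eta>_bounds(1)])
        show "compact (closure \<Omega> \<inter> cball p (r p))"
          using \<Omega>'(2) by (intro compact_Int) (auto simp: compact_closure)
        show "\<eta> x * u x = 0" if "x \<notin> closure \<Omega> \<inter> cball p (r p)" for x
        proof (cases "x \<in> closure \<Omega>")
          case True
          then have "r p < dist p x" using that by simp
          then have "2 < 2 / r p * dist p x" using rp by (simp add: field_simps)
          then have "\<eta> x = 0" by (simp add: \<eta>_def)
          then show ?thesis by simp
        next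
          case False
          then show ?thesis using insert.prems(4) closure_subset[of \<Omega>] by auto
        qed
      qed
    qed
    moreover have "approximable \<Omega> (\<lambda>x. (1 - \<eta> x) * u x)"
    proof (rule insert.IH)
      show "F \<subseteq> closure \<Omega>" using insert.prems by simp
      show "(\<lambda>x. (1 - \<eta> x) * u x) \<in> borel_measurable borel" using \<eta>m insert.prems(2) by simp
      show "(\<lambda>x. (1 - \<eta> x) * u x) \<in> W"
      proof (rule W_cutoff[OF insert.prems(3)])
        show "\<bar>(1 - \<eta> x) - (1 - \<eta> y)\<bar> \<le> M * min 1 (dist x y)" for x y using \<eta>_lip[of y x] by (simp add: dist_commute)
        show "\<bar>1 - \<eta> x\<bar> \<le> 1" for x using \<eta>_bounds[of x] by linarith
      qed (use \<eta>m in simp)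
      show "(1 - \<eta> x) * u x = 0" if "x \<notin> \<Omega>" for x using insert.prems(4)[OF that] by simp
      show "(1 - \<eta> x) * u x = 0" if x: "x \<notin> (\<Union>p\<in>F. ball p (r p / 2))" for x
      proof (cases "x \<in> ball p (r p / 2)")
        case True
        then have "2 / r p * dist p x \<le> 1" using rp by (simp add: field_simps)
        then have "\<eta> x = 1" by (simp add: \<eta>_def)
        then show ?thesis by simp
      next
        case False
        then show ?thesis using insert.prems(5)[of x] x by auto
      qed
    qed
    ultimately have "approximable \<Omega> (\<lambda>x. \<eta> x * u x + (1 - \<eta> x) * u x)" by (rule approximable_add)
    then show ?case by (simp add: algebra_simps)
  qed
  have "compact (closure \<Omega>)" using \<Omega>'(2) by (simp add: compact_closure)
  moreover have "closure \<Omega> \<subseteq> (\<Union>p\<in>closure \<Omega>. ball p (r p / 2))" using r by auto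
  ultimately obtain F where F: "F \<subseteq> closure \<Omega>" "finite F" "closure \<Omega> \<subseteq> (\<Union>p\<in>F. ball p (r p / 2))"
    using compactE_image[of "closure \<Omega>" "closure \<Omega>" "\<lambda>p. ball p (r p / 2)"] by auto
  have "v x = 0" if "x \<notin> (\<Union>p\<in>F. ball p (r p / 2))" for x
    using that F(3) closure_subset[of \<Omega>] by (intro v(3)) blast
  then show ?thesis by (intro step[OF F(2,1) v])
qed

section \<open>From modular approximation to the norm closure\<close>

lemma rho_scale_large:
  assumes u: "u \<in> W" and c: "1 \<le> c" and \<delta>: "rho_G G u \<le> ennreal \<delta>" "rho_sG s G u \<le> ennreal \<delta>" "c powr q * \<delta> \<le> 1"
  shows "rho_G G (\<lambda>x. c * u x) \<le> 1" and "rho_sG s G (\<lambda>x. c * u x) \<le> 1"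
proof -
  have pw: "ennreal (G (c * t)) \<le> ennreal (c powr q) * ennreal (G t)" for t
    using G_scale_powr_large[OF c] by (simp add: ennreal_mult'[symmetric] ennreal_leI)
  have const: "ennreal (c powr q) * ennreal \<delta> \<le> 1"
    using \<delta>(3) by (simp add: ennreal_mult'[symmetric] ennreal_le_1)
  have "rho_G G (\<lambda>x. c * u x) \<le> ennreal (c powr q) * rho_G G u"
    unfolding rho_G_alt using W_measurable[OF u]
    by (subst nn_integral_cmult[symmetric]) (auto intro!: nn_integral_mono pw)
  also have "\<dots> \<le> ennreal (c powr q) * ennreal \<delta>" by (intro mult_left_mono \<delta>) auto
  finally show "rho_G G (\<lambda>x. c * u x) \<le> 1" using const by (rule order_trans)
  have m: "(\<lambda>z. ennreal (G (slope s u z))) \<in> borel_measurable mu"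
    using measurable_compose[OF measurable_G_slope(1)[OF W_measurable[OF u]] measurable_ennreal] by simp
  have "rho_sG s G (\<lambda>x. c * u x) \<le> ennreal (c powr q) * rho_sG s G u"
    unfolding rho_sG_slope slope_cmult using m
    by (subst nn_integral_cmult[symmetric]) (auto intro!: nn_integral_mono pw)
  also have "\<dots> \<le> ennreal (c powr q) * ennreal \<delta>" by (intro mult_left_mono \<delta>) auto
  finally show "rho_sG s G (\<lambda>x. c * u x) \<le> 1" using const by (rule order_trans)
qed

text \<open>Controlled growth makes the Luxemburg norm small once the modular is: dividing by
  \<open>l\<close> multiplies the modular by at most \<open>(1 / l) powr q\<close>, and the modular
  can be taken smaller than the inverse of this factor.\<close>

lemma W0_subset_E:
  fixes v :: "'a::euclidean_space \<Rightarrow> real"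
  assumes \<Omega>: "smooth_bounded_domain \<Omega>" and v: "v \<in> W0 \<Omega>"
  shows "v \<in> E_space s G \<Omega>"
proof -
  have "open \<Omega>" using \<Omega> by (simp add: smooth_bounded_domain_def)
  then obtain v' where v': "v' \<in> borel_measurable borel" "AE x in lebesgue. v x = v' x"
    "\<And>x. x \<notin> \<Omega> \<Longrightarrow> v' x = 0" "v' \<in> W0 \<Omega>" using W0_borel_representative[OF v] by metis
  have app: "approximable \<Omega> v'" by (rule approximable_W0[OF \<Omega> v'(1) W0_W[OF v'(4)] v'(3)])
  have "\<exists>\<phi>\<in>Cc_infinity \<Omega>. W_norm s G (\<lambda>x. v x - \<phi> x) < \<epsilon>" if \<epsilon>: "\<epsilon> > 0" for \<epsilon>
  proof -
    \<comment> \<open>A common candidate for both infima of \<open>W_norm\<close>: their sum is then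
      at most \<open>2 * l\<close>, hence below \<epsilon>, and \<open>l \<le> 1\<close> makes
      \<open>1 / l\<close> a large factor.\<close>
    define l where "l = min 1 (\<epsilon> / 4)"
    have l: "0 < l" "l \<le> 1" "l \<le> \<epsilon> / 4" using \<epsilon> by (auto simp: l_def)
    define \<delta> where "\<delta> = 1 / (1 / l) powr q"
    have \<delta>: "0 < \<delta>" "(1 / l) powr q * \<delta> \<le> 1" using l by (auto simp: \<delta>_def)
    obtain \<phi> where \<phi>: "\<phi> \<in> Cc_infinity \<Omega>" "rho_G G (\<lambda>x. \<phi> x - v' x) \<le> ennreal \<delta>" "rho_sG s G (\<lambda>x. \<phi> x - v' x) \<le> ennreal \<delta>"
      using app \<delta>(1) unfolding approximable_def by blast
    have "(\<lambda>x. \<phi> x - v' x) \<in> W" by (intro W_diff Cc_infinity_in_W[OF \<phi>(1)] W0_W[OF v'(4)])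
    from rho_scale_large[OF this _ \<phi>(2,3) \<delta>(2)]
    have 1: "rho_G G (\<lambda>x. 1 / l * (\<phi> x - v' x)) \<le> 1" "rho_sG s G (\<lambda>x. 1 / l * (\<phi> x - v' x)) \<le> 1"
      using l by auto
    have eq: "AE x in lebesgue. (v x - \<phi> x) / l = - 1 * (1 / l * (\<phi> x - v' x))"
      using v'(2) by eventually_elim (simp add: field_simps)
    have "rho_G G (\<lambda>x. (v x - \<phi> x) / l) = rho_G G (\<lambda>x. 1 / l * (\<phi> x - v' x))"
      unfolding rho_G_alt by (rule nn_integral_cong_AE) (use eq in \<open>eventually_elim, simp only: mult_minus1 G_even\<close>)
    moreover have "rho_sG s G (\<lambda>x. (v x - \<phi> x) / l) = rho_sG s G (\<lambda>x. 1 / l * (\<phi> x - v' x))"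
      unfolding rho_sG_cong_AE[OF eq] unfolding mult_minus1 rho_sG_slope slope_minus G_even ..
    ultimately have in_sets: "l \<in> {l. l > 0 \<and> rho_G G (\<lambda>x. (v x - \<phi> x) / l) \<le> 1}"
      "l \<in> {l. l > 0 \<and> rho_sG s G (\<lambda>x. (v x - \<phi> x) / l) \<le> 1}" using 1 l by auto
    have "Inf {l. l > 0 \<and> rho_G G (\<lambda>x. (v x - \<phi> x) / l) \<le> 1} \<le> l"
      "Inf {l. l > 0 \<and> rho_sG s G (\<lambda>x. (v x - \<phi> x) / l) \<le> 1} \<le> l"
      by (intro cInf_lower in_sets bdd_belowI[of _ 0]; auto)+
    then have "W_norm s G (\<lambda>x. v x - \<phi> x) \<le> l + l" unfolding W_norm_def by (rule add_mono)
    also have "\<dots> < \<epsilon>" using l \<epsilon> by linarith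
    finally show ?thesis using \<phi>(1) by blast
  qed
  then show ?thesis using W0_W[OF v] by (simp add: E_space_def)
qed

text \<open>The infimum of an empty set of reals carries no information, so a small
  \<open>W_norm\<close> yields an actual scaling \<open>l\<close> only when the sets in its
  definition are inhabited.\<close>

lemma Luxemburg_sets_nonempty:
  assumes f: "f \<in> W"
  shows "\<exists>l>0. rho_G G (\<lambda>x. f x / l) \<le> 1" and "\<exists>l>0. rho_sG s G (\<lambda>x. f x / l) \<le> 1"
proof -
  define l where "l = max 1 (max (LINT x|lebesgue. G (f x)) (modular f))"
  have l: "1 \<le> l" "(LINT x|lebesgue. G (f x)) \<le> l" "modular f \<le> l" by (auto simp: l_def)
  have pw: "ennreal (G (t / l)) \<le> ennreal (1 / l) * ennreal (G t)" for t
    using G_scale_le[of "1 / l" t] l(1) by (simp add: ennreal_mult'[symmetric] ennreal_leI)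
  have "rho_G G (\<lambda>x. f x / l) \<le> ennreal (1 / l) * rho_G G f"
    unfolding rho_G_alt using W_measurable[OF f]
    by (subst nn_integral_cmult[symmetric]) (auto intro!: nn_integral_mono pw)
  also have "\<dots> \<le> 1" using l by (simp add: rho_G_eq_integral[OF f] ennreal_mult'[symmetric] ennreal_le_1)
  finally show "\<exists>l>0. rho_G G (\<lambda>x. f x / l) \<le> 1" using l(1) by (intro exI[of _ l]) auto
  have m: "(\<lambda>z. ennreal (G (slope s f z))) \<in> borel_measurable mu"
    using measurable_compose[OF measurable_G_slope(1)[OF W_measurable[OF f]] measurable_ennreal] by simp
  have sl: "slope s (\<lambda>x. f x / l) z = slope s f z / l" for z using slope_cmult[of s "1 / l" f z] by simp
  have "rho_sG s G (\<lambda>x. f x / l) \<le> ennreal (1 / l) * rho_sG s G f"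
    unfolding rho_sG_slope sl using m
    by (subst nn_integral_cmult[symmetric]) (auto intro!: nn_integral_mono pw)
  also have "\<dots> \<le> 1" using l by (simp add: rho_sG_eq_modular[OF f] ennreal_mult'[symmetric] ennreal_le_1)
  finally show "\<exists>l>0. rho_sG s G (\<lambda>x. f x / l) \<le> 1" using l(1) by (intro exI[of _ l]) auto
qed

text \<open>Test functions vanish outside \<Omega>, so there \<open>v\<close> equals its
  approximation error. A small norm gives a small scaling \<open>l\<close>, and convexity bounds the
  integral of \<open>G (v x)\<close> over the complement by \<open>l\<close>.\<close>

lemma E_subset_W0:
  fixes v :: "'a::euclidean_space \<Rightarrow> real"
  assumes \<Omega>: "open \<Omega>" and v: "v \<in> E_space s G \<Omega>"
  shows "v \<in> W0 \<Omega>"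
proof -
  have vW: "v \<in> W" using v by (simp add: E_space_def)
  have "- \<Omega> \<in> sets lebesgue" using sets.compl_sets[of \<Omega> lebesgue] \<Omega> by (simp add: Compl_eq_Diff_UNIV)
  then have vm: "(\<lambda>x. ennreal (G (v x)) * indicator (- \<Omega>) x) \<in> borel_measurable lebesgue"
    using W_measurable[OF vW] by (intro borel_measurable_times_ennreal borel_measurable_indicator) auto
  have "(\<integral>\<^sup>+ x. ennreal (G (v x)) * indicator (- \<Omega>) x \<partial>lebesgue) \<le> ennreal \<epsilon>" if \<epsilon>: "0 < \<epsilon>" "\<epsilon> \<le> 1" for \<epsilon>
  proof -
    obtain \<phi> where \<phi>: "\<phi> \<in> Cc_infinity \<Omega>" "W_norm s G (\<lambda>x. v x - \<phi> x) < \<epsilon>"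
      using v \<epsilon>(1) unfolding E_space_def by blast
    define f where "f = (\<lambda>x. v x - \<phi> x)"
    have f: "f \<in> W" unfolding f_def by (intro W_diff vW Cc_infinity_in_W[OF \<phi>(1)])
    define A where "A = {l. l > 0 \<and> rho_G G (\<lambda>x. f x / l) \<le> 1}"
    define B where "B = {l. l > 0 \<and> rho_sG s G (\<lambda>x. f x / l) \<le> 1}"
    have "A \<noteq> {}" "B \<noteq> {}" using Luxemburg_sets_nonempty[OF f] by (auto simp: A_def B_def)
    then have "0 \<le> Inf B" by (intro cInf_greatest) (auto simp: B_def)
    moreover have "Inf A + Inf B < \<epsilon>" using \<phi>(2) by (simp add: W_norm_def A_def B_def f_def)
    ultimately have "Inf A < \<epsilon>" by linarith
    then obtain l where l: "l \<in> A" "l < \<epsilon>" using cInf_lessD[OF \<open>A \<noteq> {}\<close>] by blast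
    then have l': "0 < l" "rho_G G (\<lambda>x. f x / l) \<le> 1" by (auto simp: A_def)
    have "(\<integral>\<^sup>+ x. ennreal (G (v x)) * indicator (- \<Omega>) x \<partial>lebesgue) \<le> (\<integral>\<^sup>+ x. ennreal l * ennreal (G (f x / l)) \<partial>lebesgue)"
    proof (rule nn_integral_mono)
      fix x
      have "G (f x) \<le> l * G (f x / l)" using G_scale_le[of l "f x / l"] l' l(2) \<epsilon> by simp
      moreover have "\<phi> x = 0" if "x \<notin> \<Omega>"
      proof (rule ccontr)
        assume "\<phi> x \<noteq> 0"
        then have "x \<in> closure {x. \<phi> x \<noteq> 0}" by (intro closure_subset[THEN subsetD]) simp
        then show False using \<phi>(1) that unfolding Cc_infinity_def by blast
      qed
      ultimately show "ennreal (G (v x)) * indicator (- \<Omega>) x \<le> ennreal l * ennreal (G (f x / l))"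
        using l' by (cases "x \<in> \<Omega>") (auto simp: f_def ennreal_mult'[symmetric] ennreal_leI)
    qed
    also have "\<dots> = ennreal l * rho_G G (\<lambda>x. f x / l)"
      unfolding rho_G_alt using W_measurable[OF f] by (intro nn_integral_cmult) simp
    also have "\<dots> \<le> ennreal l * 1" by (intro mult_left_mono l') auto
    also have "\<dots> \<le> ennreal \<epsilon>" using l by (simp add: ennreal_leI)
    finally show ?thesis .
  qed
  note small = this
  have "(\<integral>\<^sup>+ x. ennreal (G (v x)) * indicator (- \<Omega>) x \<partial>lebesgue) \<le> 0 + ennreal \<epsilon>" if "0 < \<epsilon>" for \<epsilon>
    using order_trans[OF small[of "min \<epsilon> 1"] ennreal_leI, of \<epsilon>] that by simp
  then have "(\<integral>\<^sup>+ x. ennreal (G (v x)) * indicator (- \<Omega>) x \<partial>lebesgue) \<le> 0"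
    by (rule ennreal_le_epsilon)
  then have "(\<integral>\<^sup>+ x. ennreal (G (v x)) * indicator (- \<Omega>) x \<partial>lebesgue) = 0" by simp
  then have "AE x in lebesgue. ennreal (G (v x)) * indicator (- \<Omega>) x = 0"
    by (subst (asm) nn_integral_0_iff_AE[OF vm])
  then have "AE x in lebesgue. x \<notin> \<Omega> \<longrightarrow> v x = 0"
  proof eventually_elim
    case (elim x)
    show ?case
    proof
      assume "x \<notin> \<Omega>"
      then have "G (v x) \<le> 0" using elim by (simp add: ennreal_eq_0_iff)
      then show "v x = 0" using G_pos[of "v x"] by fastforce
    qed
  qed
  then show ?thesis using vW by (simp add: W0_iff)
qed

theorem E_eq_W0:
  assumes "smooth_bounded_domain \<Omega>" shows "E_space s G \<Omega> = W0 \<Omega>"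
  using W0_subset_E[OF assms] E_subset_W0[of \<Omega>] assms by (auto simp: smooth_bounded_domain_def)

end

section \<open>Extremal solutions\<close>

locale semilinear_problem = fractional_Orlicz_Sobolev G g p q s + B: N_growth B b qm qp
  for G g :: "real \<Rightarrow> real" and p q s :: real and B b :: "real \<Rightarrow> real" and qm qp :: real +
  fixes \<Omega> :: "'a::euclidean_space set"
  assumes \<Omega>: "smooth_bounded_domain \<Omega>"
    and conj: "Sobolev_conjugate G g p q DIM('a) s"
    and slower: "B \<lless> sobolev_conj DIM('a) s G"
begin

lemma \<Omega>_open: "open \<Omega>" and \<Omega>_bounded: "bounded \<Omega>"
  using \<Omega> by (auto simp: smooth_bounded_domain_def)

lemma \<Omega>_lebesgue [measurable]: "\<Omega> \<in> sets lebesgue"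
  using \<Omega>_open by simp

lemma B_integrable: "u \<in> W \<Longrightarrow> integrable lebesgue (\<lambda>x. indicator \<Omega> x * B (u x))"
  by (rule Orlicz_Sobolev_embedding[OF B.N_growth_axioms conj slower _ \<Omega>_open \<Omega>_bounded])

definition source :: "('a \<Rightarrow> real) \<Rightarrow> ('a \<Rightarrow> real) \<Rightarrow> real" where
  "source w v = (LINT x:\<Omega>|lebesgue. b (w x) * v x)"

lemma source_minus: "source (\<lambda>x. - w x) v = - source w v"
  unfolding source_def set_lebesgue_integral_def by (simp add: B.g_odd)

lemma source_cong_AE:
  assumes "AE x in lebesgue. x \<in> \<Omega> \<longrightarrow> w x = w' x"
    "w \<in> borel_measurable lebesgue" "w' \<in> borel_measurable lebesgue" "v \<in> borel_measurable lebesgue"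
  shows "source w v = source w' v"
  unfolding source_def set_lebesgue_integral_def
proof (rule integral_cong_AE)
  show "AE x in lebesgue. indicator \<Omega> x *\<^sub>R (b (w x) * v x) = indicator \<Omega> x *\<^sub>R (b (w' x) * v x)"
    using assms(1) by eventually_elim (auto simp: indicator_def)
qed (use assms in \<open>measurable\<close>)

text \<open>Because \<open>E_space\<close> equals \<open>W0\<close>, a test function needs only
  finite modulars and zero values outside \<Omega>; positive parts of differences of solutions
  qualify.\<close>

lemma weak_solution_iff:
  "weak_solution s G g b \<Omega> u \<longleftrightarrow> u \<in> W0 \<Omega> \<and> (\<forall>v\<in>W0 \<Omega>. frac_g_Laplacian s g u v = source u v)"
  by (simp add: weak_solution_def E_eq_W0[OF \<Omega>] source_def)

lemma subsolution_iff:
  "subsolution s G g b \<Omega> u \<longleftrightarrow> u \<in> W \<and>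
    (\<forall>v\<in>W0 \<Omega>. (AE x in lebesgue. 0 \<le> v x) \<longrightarrow> frac_g_Laplacian s g u v \<le> source u v) \<and>
    (AE x in lebesgue. x \<notin> \<Omega> \<longrightarrow> u x \<le> 0)"
  by (auto simp: subsolution_def E_plus_def E_eq_W0[OF \<Omega>] source_def)

lemma supersolution_iff:
  "supersolution s G g b \<Omega> u \<longleftrightarrow> u \<in> W \<and>
    (\<forall>v\<in>W0 \<Omega>. (AE x in lebesgue. 0 \<le> v x) \<longrightarrow> source u v \<le> frac_g_Laplacian s g u v) \<and>
    (AE x in lebesgue. x \<notin> \<Omega> \<longrightarrow> 0 \<le> u x)"
  by (auto simp: supersolution_def E_plus_def E_eq_W0[OF \<Omega>] source_def)

lemma solution_set_uminus:
  assumes u: "u \<in> solution_set s G g b \<Omega> ul uu"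
  shows "(\<lambda>x. - u x) \<in> solution_set s G g b \<Omega> (\<lambda>x. - uu x) (\<lambda>x. - ul x)"
  using u by (auto simp: solution_set_def weak_solution_iff W0_minus frac_g_Laplacian_minus source_minus elim: eventually_mono)

lemma sub_super_pair_uminus:
  assumes "sub_super_pair s G g b \<Omega> ul uu"
  shows "sub_super_pair s G g b \<Omega> (\<lambda>x. - uu x) (\<lambda>x. - ul x)"
  using assms by (auto simp: sub_super_pair_def subsolution_iff supersolution_iff W_minus frac_g_Laplacian_minus source_minus elim: eventually_mono)

end

section \<open>The order preserving solution operator between \<open>ul\<close> and
  \<open>uu\<close>\<close>

locale sub_super_problem = semilinear_problem G g p q s B b qm qp \<Omega>
  for G g :: "real \<Rightarrow> real" and p q s :: real and B b :: "real \<Rightarrow> real" and qm qp :: real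
    and \<Omega> :: "'a::euclidean_space set" +
  fixes ul uu :: "'a \<Rightarrow> real"
  assumes pair: "sub_super_pair s G g b \<Omega> ul uu"
begin

lemma ul_W: "ul \<in> W" and uu_W: "uu \<in> W"
  and sub: "\<And>v. v \<in> W0 \<Omega> \<Longrightarrow> (AE x in lebesgue. 0 \<le> v x) \<Longrightarrow> frac_g_Laplacian s g ul v \<le> source ul v"
  and super: "\<And>v. v \<in> W0 \<Omega> \<Longrightarrow> (AE x in lebesgue. 0 \<le> v x) \<Longrightarrow> source uu v \<le> frac_g_Laplacian s g uu v"
  and ul_out: "AE x in lebesgue. x \<notin> \<Omega> \<longrightarrow> ul x \<le> 0"
  and uu_out: "AE x in lebesgue. x \<notin> \<Omega> \<longrightarrow> 0 \<le> uu x"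
  and ul_le_uu: "AE x in lebesgue. x \<in> \<Omega> \<longrightarrow> ul x \<le> uu x"
  using pair by (auto simp: sub_super_pair_def subsolution_iff supersolution_iff)

text \<open>The bounds are imposed in \<Omega> only, where the source term sees \<open>w\<close>.
  Asking for measurability instead of membership in \<open>W\<close> keeps the class closed under
  pointwise limits.\<close>

definition admissible :: "('a \<Rightarrow> real) \<Rightarrow> bool" where
  "admissible w \<longleftrightarrow> w \<in> borel_measurable lebesgue \<and> (AE x in lebesgue. x \<in> \<Omega> \<longrightarrow> ul x \<le> w x \<and> w x \<le> uu x)"

lemma admissible_ul: "admissible ul" and admissible_uu: "admissible uu"
  using ul_le_uu by (auto simp: admissible_def W_measurable[OF ul_W] W_measurable[OF uu_W] elim: eventually_mono)

text \<open>Monotonicity places \<open>b (w x)\<close> between \<open>b (ul x)\<close> and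
  \<open>b (uu x)\<close>; the Young inequality for \<open>B\<close> and the embedding applied to
  \<open>ul\<close>, \<open>uu\<close> and \<open>v\<close> then give an integrable
  majorant.\<close>

lemma source_integrable:
  assumes w: "admissible w" and v: "v \<in> W0 \<Omega>"
  shows "integrable lebesgue (\<lambda>x. indicator \<Omega> x *\<^sub>R (b (w x) * v x))"
proof (rule Bochner_Integration.integrable_bound)
  define M where "M x = qp * (indicator \<Omega> x * B (ul x) + indicator \<Omega> x * B (v x)) +
    qp * (indicator \<Omega> x * B (uu x) + indicator \<Omega> x * B (v x))" for x
  show "integrable lebesgue M"
    unfolding M_def using B_integrable[OF ul_W] B_integrable[OF uu_W] B_integrable[OF W0_W[OF v]] by simp
  show "(\<lambda>x. indicator \<Omega> x *\<^sub>R (b (w x) * v x)) \<in> borel_measurable lebesgue"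
  proof -
    have [measurable]: "w \<in> borel_measurable lebesgue" using w by (simp add: admissible_def)
    have [measurable]: "v \<in> borel_measurable lebesgue" by (rule W_measurable[OF W0_W[OF v]])
    show ?thesis by measurable
  qed
  have "AE x in lebesgue. x \<in> \<Omega> \<longrightarrow> ul x \<le> w x \<and> w x \<le> uu x" using w by (simp add: admissible_def)
  then show "AE x in lebesgue. norm (indicator \<Omega> x *\<^sub>R (b (w x) * v x)) \<le> norm (M x)"
  proof eventually_elim
    case (elim x)
    show ?case
    proof (cases "x \<in> \<Omega>")
      case True
      then have "b (ul x) \<le> b (w x)" "b (w x) \<le> b (uu x)" using elim by (auto intro: B.g_mono)
      then have "\<bar>b (w x)\<bar> \<le> \<bar>b (ul x)\<bar> + \<bar>b (uu x)\<bar>" by linarith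
      then have "\<bar>b (w x)\<bar> * \<bar>v x\<bar> \<le> (\<bar>b (ul x)\<bar> + \<bar>b (uu x)\<bar>) * \<bar>v x\<bar>" by (rule mult_right_mono) simp
      also have "\<dots> = \<bar>b (ul x) * v x\<bar> + \<bar>b (uu x) * v x\<bar>" by (simp add: abs_mult distrib_right)
      also have "\<dots> \<le> qp * (B (ul x) + B (v x)) + qp * (B (uu x) + B (v x))" by (intro add_mono B.young)
      also have "\<dots> = M x" using True by (simp add: M_def)
      finally show ?thesis using True by (simp add: abs_mult)
    next
      case False then show ?thesis by simp
    qed
  qed
qed

lemma source_add:
  assumes "admissible w" "u \<in> W0 \<Omega>" "v \<in> W0 \<Omega>"
  shows "source w (\<lambda>x. u x + v x) = source w u + source w v"
  using source_integrable[OF assms(1,2)] source_integrable[OF assms(1,3)]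
  unfolding source_def set_lebesgue_integral_def by (simp add: distrib_left)

lemma source_cmult: "source w (\<lambda>x. c * v x) = c * source w v"
proof -
  have "(\<lambda>x. indicator \<Omega> x *\<^sub>R (b (w x) * (c * v x))) = (\<lambda>x. c * (indicator \<Omega> x *\<^sub>R (b (w x) * v x)))"
    by (simp add: mult_ac)
  then show ?thesis unfolding source_def set_lebesgue_integral_def by simp
qed

lemma source_mono:
  assumes w: "admissible w" "admissible w'" and le: "AE x in lebesgue. x \<in> \<Omega> \<longrightarrow> w x \<le> w' x"
    and v: "v \<in> W0 \<Omega>" "AE x in lebesgue. 0 \<le> v x"
  shows "source w v \<le> source w' v"
  unfolding source_def set_lebesgue_integral_def
proof (rule integral_mono_AE[OF source_integrable[OF w(1) v(1)] source_integrable[OF w(2) v(1)]])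
  show "AE x in lebesgue. indicator \<Omega> x *\<^sub>R (b (w x) * v x) \<le> indicator \<Omega> x *\<^sub>R (b (w' x) * v x)"
    using le v(2) by eventually_elim (auto simp: indicator_def intro!: mult_right_mono B.g_mono)
qed

lemma modular_max_0_le:
  assumes v: "v \<in> W" shows "modular (\<lambda>x. max 0 (v x)) \<le> modular v"
proof (rule integral_mono[OF W_integrable_slope W_integrable_slope[OF v]])
  show "(\<lambda>x. max 0 (v x)) \<in> W" by (intro W_max W_0 v)
  show "G (slope s (\<lambda>x. max 0 (v x)) z) \<le> G (slope s v z)" for z
    by (intro G_mono abs_slope_mono) (auto simp: max_def)
qed

text \<open>Testing the two differential inequalities bounds the source term by the energy, so no
  quantitative embedding is needed.\<close>

lemma source_bound:
  assumes w: "admissible w" and v: "v \<in> W0 \<Omega>"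
  shows "\<bar>source w v\<bar> \<le> (2 * q * (modular ul + modular uu) + 4 * q) * (1 + modular v)"
proof -
  have pos: "\<bar>source w u\<bar> \<le> q * (modular ul + modular uu + 2 * modular u)"
    if u: "u \<in> W0 \<Omega>" "AE x in lebesgue. 0 \<le> u x" for u
  proof -
    have "AE x in lebesgue. x \<in> \<Omega> \<longrightarrow> ul x \<le> w x" "AE x in lebesgue. x \<in> \<Omega> \<longrightarrow> w x \<le> uu x"
      using w by (auto simp: admissible_def elim: eventually_mono)
    then have "source ul u \<le> source w u" "source w u \<le> source uu u"
      using source_mono[OF admissible_ul w _ u] source_mono[OF w admissible_uu _ u] by auto
    then have "frac_g_Laplacian s g ul u \<le> source w u" "source w u \<le> frac_g_Laplacian s g uu u"
      using sub[OF u] super[OF u] by linarith+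
    moreover have "\<bar>frac_g_Laplacian s g ul u\<bar> \<le> q * (modular ul + modular u)"
      "\<bar>frac_g_Laplacian s g uu u\<bar> \<le> q * (modular uu + modular u)"
      by (intro abs_frac_g_Laplacian_le ul_W uu_W W0_W[OF u(1)])+
    moreover have "q * (modular ul + modular u) \<le> q * (modular ul + modular uu + 2 * modular u)"
      "q * (modular uu + modular u) \<le> q * (modular ul + modular uu + 2 * modular u)"
      using q_gt_1 modular_nonneg[of ul] modular_nonneg[of uu] modular_nonneg[of u] by (intro mult_left_mono; linarith)+
    ultimately show ?thesis by linarith
  qed
  \<comment> \<open>The two differential inequalities admit nonnegative test functions only, so
    \<open>v\<close> is split into its positive and negative parts, whose energies do not exceed
    that of \<open>v\<close>.\<close>
  define vp where "vp = (\<lambda>x. max 0 (v x))"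
  define vm where "vm = (\<lambda>x. max 0 (- v x))"
  have vp: "vp \<in> W0 \<Omega>" and vm: "vm \<in> W0 \<Omega>" unfolding vp_def vm_def by (intro W0_max W0_0 W0_minus v)+
  have "modular (\<lambda>x. - v x) = modular v" by (simp add: slope_minus G_even)
  then have mod: "modular vp \<le> modular v" "modular vm \<le> modular v"
    using modular_max_0_le[OF W0_W[OF v]] modular_max_0_le[OF W_minus[OF W0_W[OF v]]] by (simp_all add: vp_def vm_def)
  have "v = (\<lambda>x. vp x + (-1) * vm x)" by (auto simp: vp_def vm_def max_def)
  then have "source w v = source w vp + (-1) * source w vm"
    using source_add[OF w vp W0_cmult[OF vm, of "-1"]] source_cmult[of w "-1" vm] by simp
  then have "\<bar>source w v\<bar> \<le> \<bar>source w vp\<bar> + \<bar>source w vm\<bar>" by linarith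
  also have "\<dots> \<le> q * (modular ul + modular uu + 2 * modular v) + q * (modular ul + modular uu + 2 * modular v)"
  proof (intro add_mono)
    show "\<bar>source w vp\<bar> \<le> q * (modular ul + modular uu + 2 * modular v)"
      using pos[OF vp] mod(1) q_gt_1
      by (intro order_trans[OF pos[OF vp]] mult_left_mono) (auto simp: vp_def)
    show "\<bar>source w vm\<bar> \<le> q * (modular ul + modular uu + 2 * modular v)"
      using mod(2) q_gt_1
      by (intro order_trans[OF pos[OF vm]] mult_left_mono) (auto simp: vm_def)
  qed
  also have "\<dots> \<le> (2 * q * (modular ul + modular uu) + 4 * q) * (1 + modular v)"
  proof -
    have "0 \<le> (2 * q * (modular ul + modular uu)) * modular v" "0 \<le> 4 * q"
      using q_gt_1 modular_nonneg[of ul] modular_nonneg[of uu] modular_nonneg[of v] by (intro mult_nonneg_nonneg; simp)+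
    then show ?thesis by (simp add: algebra_simps)
  qed
  finally show ?thesis .
qed

definition solves :: "('a \<Rightarrow> real) \<Rightarrow> ('a \<Rightarrow> real) \<Rightarrow> bool" where
  "solves w u \<longleftrightarrow> u \<in> W0 \<Omega> \<and> (\<forall>v\<in>W0 \<Omega>. frac_g_Laplacian s g u v = source w v)"

lemma exists_solves:
  assumes w: "admissible w" obtains u where "solves w u"
proof -
  show ?thesis
  proof (rule exists_dual_solution[OF \<Omega>_open \<Omega>_bounded source_add[OF w] source_cmult source_bound[OF w]])
    fix u assume "u \<in> W0 \<Omega>" "\<And>v. v \<in> W0 \<Omega> \<Longrightarrow> frac_g_Laplacian s g u v = source w v"
    then have "solves w u" unfolding solves_def by blast
    then show ?thesis by (rule that)
  qed
qed

lemma solves_measurable: "solves w u \<Longrightarrow> u \<in> borel_measurable lebesgue"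
  unfolding solves_def by (blast intro: W_measurable W0_W)

lemma solves_mono:
  assumes w: "admissible w" "admissible w'" and le: "AE x in lebesgue. x \<in> \<Omega> \<longrightarrow> w x \<le> w' x"
    and u: "solves w u" "solves w' u'"
  shows "AE x in lebesgue. u x \<le> u' x"
proof -
  have W0: "u \<in> W0 \<Omega>" "u' \<in> W0 \<Omega>" using u by (auto simp: solves_def)
  have \<phi>: "(\<lambda>x. max 0 (u x - u' x)) \<in> W0 \<Omega>" by (intro W0_max W0_0 W0_diff W0)
  show ?thesis
  proof (rule comparison[OF W0_W[OF W0(1)] W0_W[OF W0(2)] \<Omega>_bounded])
    have "AE x in lebesgue. x \<notin> \<Omega> \<longrightarrow> u x = 0" "AE x in lebesgue. x \<notin> \<Omega> \<longrightarrow> u' x = 0"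
      using W0 by (auto simp: W0_iff)
    then show "AE x in lebesgue. x \<notin> \<Omega> \<longrightarrow> u x \<le> u' x" by eventually_elim auto
    show "frac_g_Laplacian s g u (\<lambda>x. max 0 (u x - u' x)) \<le> frac_g_Laplacian s g u' (\<lambda>x. max 0 (u x - u' x))"
      using u \<phi> source_mono[OF w le \<phi>] by (simp add: solves_def)
  qed
qed

text \<open>Comparison of \<open>u\<close> with \<open>ul\<close> and with \<open>uu\<close>.
  Neither needs to vanish outside \<Omega>, but their signs there make the positive parts of
  \<open>ul - u\<close> and \<open>u - uu\<close> vanish, so both are legitimate test
  functions.\<close>

lemma solves_bounds:
  assumes w: "admissible w" and u: "solves w u"
  shows "AE x in lebesgue. ul x \<le> u x \<and> u x \<le> uu x"
proof -
  have W0: "u \<in> W0 \<Omega>" using u by (simp add: solves_def)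
  have out: "AE x in lebesgue. x \<notin> \<Omega> \<longrightarrow> u x = 0" using W0 by (simp add: W0_iff)
  have le1: "AE x in lebesgue. x \<in> \<Omega> \<longrightarrow> ul x \<le> w x" and le2: "AE x in lebesgue. x \<in> \<Omega> \<longrightarrow> w x \<le> uu x"
    using w by (auto simp: admissible_def elim: eventually_mono)
  have out1: "AE x in lebesgue. x \<notin> \<Omega> \<longrightarrow> ul x \<le> u x" using out ul_out by eventually_elim auto
  have out2: "AE x in lebesgue. x \<notin> \<Omega> \<longrightarrow> u x \<le> uu x" using out uu_out by eventually_elim auto
  have "AE x in lebesgue. ul x \<le> u x"
  proof (rule comparison[OF ul_W W0_W[OF W0] \<Omega>_bounded out1])
    have \<phi>: "(\<lambda>x. max 0 (ul x - u x)) \<in> W0 \<Omega>"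
      using out1 by (auto simp: W0_iff intro!: W_max W_0 W_diff ul_W W0_W[OF W0] elim: eventually_mono)
    have "frac_g_Laplacian s g ul (\<lambda>x. max 0 (ul x - u x)) \<le> source ul (\<lambda>x. max 0 (ul x - u x))"
      by (rule sub[OF \<phi>]) simp
    also have "\<dots> \<le> source w (\<lambda>x. max 0 (ul x - u x))" by (rule source_mono[OF admissible_ul w le1 \<phi>]) simp
    finally show "frac_g_Laplacian s g ul (\<lambda>x. max 0 (ul x - u x)) \<le> frac_g_Laplacian s g u (\<lambda>x. max 0 (ul x - u x))"
      using u \<phi> by (simp add: solves_def)
  qed
  moreover have "AE x in lebesgue. u x \<le> uu x"
  proof (rule comparison[OF W0_W[OF W0] uu_W \<Omega>_bounded out2])
    have \<phi>: "(\<lambda>x. max 0 (u x - uu x)) \<in> W0 \<Omega>"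
      using out2 by (auto simp: W0_iff intro!: W_max W_0 W_diff uu_W W0_W[OF W0] elim: eventually_mono)
    have "source w (\<lambda>x. max 0 (u x - uu x)) \<le> source uu (\<lambda>x. max 0 (u x - uu x))"
      by (rule source_mono[OF w admissible_uu le2 \<phi>]) simp
    also have "\<dots> \<le> frac_g_Laplacian s g uu (\<lambda>x. max 0 (u x - uu x))" by (rule super[OF \<phi>]) simp
    finally show "frac_g_Laplacian s g u (\<lambda>x. max 0 (u x - uu x)) \<le> frac_g_Laplacian s g uu (\<lambda>x. max 0 (u x - uu x))"
      using u \<phi> by (simp add: solves_def)
  qed
  ultimately show ?thesis by eventually_elim simp
qed

lemma solves_admissible: "admissible w \<Longrightarrow> solves w u \<Longrightarrow> admissible u"
  using solves_bounds[of w u] solves_measurable[of w u] by (auto simp: admissible_def elim: eventually_mono)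

text \<open>The existential is as good as a function value: by \<open>solves_mono\<close> applied in
  both directions, the solution for a given \<open>w\<close> is unique up to a null set.\<close>

definition contracting :: "('a \<Rightarrow> real) \<Rightarrow> bool" where
  "contracting w \<longleftrightarrow> admissible w \<and> (\<exists>u. solves w u \<and> (AE x in lebesgue. x \<in> \<Omega> \<longrightarrow> u x \<le> w x))"

lemma contracting_uu: "contracting uu"
proof -
  obtain u where u: "solves uu u" using exists_solves[OF admissible_uu] by blast
  then show ?thesis
    using admissible_uu solves_bounds[OF admissible_uu u] unfolding contracting_def
    by (auto elim: eventually_mono)
qed

text \<open>By monotonicity the image of the minimum lies below both images, hence below both
  functions.\<close>

lemma contracting_min:
  assumes w: "contracting w" and w': "contracting w'"
  shows "contracting (\<lambda>x. min (w x) (w' x))"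
proof -
  obtain u where ad: "admissible w" and u: "solves w u" "AE x in lebesgue. x \<in> \<Omega> \<longrightarrow> u x \<le> w x"
    using w by (auto simp: contracting_def)
  obtain u' where ad': "admissible w'" and u': "solves w' u'" "AE x in lebesgue. x \<in> \<Omega> \<longrightarrow> u' x \<le> w' x"
    using w' by (auto simp: contracting_def)
  have adm: "admissible (\<lambda>x. min (w x) (w' x))"
    using ad ad' unfolding admissible_def by (auto elim!: eventually_elim2)
  obtain y where y: "solves (\<lambda>x. min (w x) (w' x)) y" using exists_solves[OF adm] by blast
  have "AE x in lebesgue. y x \<le> u x" by (rule solves_mono[OF adm ad _ y u(1)]) simp
  moreover have "AE x in lebesgue. y x \<le> u' x" by (rule solves_mono[OF adm ad' _ y u'(1)]) simp
  ultimately have "AE x in lebesgue. x \<in> \<Omega> \<longrightarrow> y x \<le> min (w x) (w' x)"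
    using u(2) u'(2) by eventually_elim auto
  then show ?thesis using adm y by (auto simp: contracting_def)
qed

text \<open>\<open>arctan\<close> is bounded, so the integral over the bounded set \<Omega> exists
  without integrability of \<open>w\<close>; it is strictly increasing, so ordered functions of
  equal size agree almost everywhere in \<Omega>.\<close>

definition size_of :: "('a \<Rightarrow> real) \<Rightarrow> real" where
  "size_of w = (LINT x|lebesgue. indicator \<Omega> x * arctan (w x))"

lemma size_of_integrable:
  assumes "w \<in> borel_measurable lebesgue"
  shows "integrable lebesgue (\<lambda>x. indicator \<Omega> x * arctan (w x))"
proof (rule Bochner_Integration.integrable_bound)
  have "emeasure lebesgue \<Omega> < \<infinity>"
    using emeasure_bounded_finite[OF \<Omega>_bounded] \<Omega>_open by (simp add: emeasure_completion)
  then show "integrable lebesgue (\<lambda>x. indicator \<Omega> x * (pi / 2))"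
    by (intro integrable_mult_left integrable_real_indicator \<Omega>_lebesgue)
  show "AE x in lebesgue. norm (indicator \<Omega> x * arctan (w x)) \<le> norm (indicator \<Omega> x * (pi / 2))"
  proof (rule AE_I2)
    fix x
    have "\<bar>arctan (w x)\<bar> \<le> pi / 2" using arctan_bounded[of "w x"] by (auto simp: abs_if)
    then show "norm (indicator \<Omega> x * arctan (w x)) \<le> norm (indicator \<Omega> x * (pi / 2))"
      by (cases "x \<in> \<Omega>") simp_all
  qed
  show "(\<lambda>x. indicator \<Omega> x * arctan (w x)) \<in> borel_measurable lebesgue"
    using assms \<Omega>_lebesgue by measurable
qed

lemma size_of_mono:
  assumes "w \<in> borel_measurable lebesgue" "w' \<in> borel_measurable lebesgue"
    "AE x in lebesgue. x \<in> \<Omega> \<longrightarrow> w x \<le> w' x"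
  shows "size_of w \<le> size_of w'"
  unfolding size_of_def
proof (rule integral_mono_AE[OF size_of_integrable[OF assms(1)] size_of_integrable[OF assms(2)]])
  show "AE x in lebesgue. indicator \<Omega> x * arctan (w x) \<le> indicator \<Omega> x * arctan (w' x)"
    using assms(3) by eventually_elim (auto simp: indicator_def arctan_monotone')
qed

lemma size_of_eq_imp:
  assumes w: "w \<in> borel_measurable lebesgue" "w' \<in> borel_measurable lebesgue"
    "AE x in lebesgue. x \<in> \<Omega> \<longrightarrow> w x \<le> w' x" and eq: "size_of w' \<le> size_of w"
  shows "AE x in lebesgue. x \<in> \<Omega> \<longrightarrow> w x = w' x"
proof -
  let ?d = "\<lambda>x. indicator \<Omega> x * arctan (w' x) - indicator \<Omega> x * arctan (w x)"
  have int: "integrable lebesgue ?d"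
    by (intro Bochner_Integration.integrable_diff size_of_integrable w)
  have nn: "AE x in lebesgue. 0 \<le> ?d x"
    using w(3) by eventually_elim (auto simp: indicator_def arctan_monotone')
  have "(LINT x|lebesgue. ?d x) = size_of w' - size_of w"
    unfolding size_of_def using size_of_integrable w by simp
  then have "(LINT x|lebesgue. ?d x) = 0" using eq integral_nonneg_AE[OF nn] by linarith
  then have "AE x in lebesgue. ?d x = 0" using integral_nonneg_eq_0_iff_AE[OF int nn] by simp
  then show ?thesis by eventually_elim (auto simp: indicator_def arctan_eq_iff)
qed

text \<open>A minimising sequence, made decreasing by successive minima, converges in \<Omega>
  because it stays above \<open>ul\<close>. The image of the limit lies below every term by
  monotonicity, hence below the limit; no continuity of the solution operator is involved.\<close>

lemma contracting_minimal:
  obtains w where "contracting w" "\<And>y. contracting y \<Longrightarrow> size_of w \<le> size_of y"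
proof -
  define \<alpha> where "\<alpha> = Inf (size_of ` Collect contracting)"
  have bdd: "bdd_below (size_of ` Collect contracting)"
  proof (rule bdd_belowI2)
    show "size_of ul \<le> size_of w" if "w \<in> Collect contracting" for w
      using that W_measurable[OF ul_W]
      by (intro size_of_mono) (auto simp: contracting_def admissible_def elim: eventually_mono)
  qed
  have \<alpha>_le: "\<alpha> \<le> size_of w" if "contracting w" for w
    unfolding \<alpha>_def using that by (intro cInf_lower bdd) auto
  have "\<exists>w. contracting w \<and> size_of w < \<alpha> + inverse (real (Suc n))" for n
    using cInf_lessD[of "size_of ` Collect contracting" "\<alpha> + inverse (real (Suc n))"] contracting_uu
    by (auto simp: \<alpha>_def)
  then obtain f where f: "\<And>n. contracting (f n)" "\<And>n. size_of (f n) < \<alpha> + inverse (real (Suc n))" by metis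
  \<comment> \<open>Running minima of \<open>f\<close>: contracting by
    \<open>contracting_min\<close>, decreasing, and below \<open>f n\<close> at stage
    \<open>n\<close>.\<close>
  define v where "v = rec_nat (f 0) (\<lambda>n u x. min (u x) (f (Suc n) x))"
  have v_simps: "v 0 = f 0" "v (Suc n) = (\<lambda>x. min (v n x) (f (Suc n) x))" for n by (simp_all add: v_def)
  have v: "contracting (v n)" for n
    by (induction n) (simp_all add: v_simps f contracting_min)
  have v_meas: "v n \<in> borel_measurable lebesgue" for n using v[of n] by (simp add: contracting_def admissible_def)
  have v_le: "v n x \<le> f n x" for n x by (cases n) (simp_all add: v_simps)
  have v_dec: "decseq (\<lambda>n. v n x)" for x by (rule decseq_SucI) (simp add: v_simps)
  have bounds: "AE x in lebesgue. \<forall>n. x \<in> \<Omega> \<longrightarrow> ul x \<le> v n x \<and> v n x \<le> uu x"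
    unfolding AE_all_countable using v by (simp add: contracting_def admissible_def)
  define w where "w x = lim (\<lambda>n. v n x)" for x
  have w_meas: "w \<in> borel_measurable lebesgue" unfolding w_def by (intro borel_measurable_lim_metric v_meas)
  have lim: "AE x in lebesgue. x \<in> \<Omega> \<longrightarrow> (\<lambda>n. v n x) \<longlonglongrightarrow> w x"
    using bounds
  proof eventually_elim
    case (elim x)
    show ?case
    proof
      assume "x \<in> \<Omega>"
      then have "\<And>n. ul x \<le> v n x" using elim by blast
      from decseq_convergent[OF v_dec allI[OF this]] obtain l where "(\<lambda>n. v n x) \<longlonglongrightarrow> l" by metis
      then show "(\<lambda>n. v n x) \<longlonglongrightarrow> w x" unfolding w_def by (simp add: limI)
    qed
  qed
  have w_le: "AE x in lebesgue. x \<in> \<Omega> \<longrightarrow> (\<forall>n. w x \<le> v n x)"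
    using lim by eventually_elim (auto intro: decseq_ge[OF v_dec])
  have w_ge: "AE x in lebesgue. x \<in> \<Omega> \<longrightarrow> ul x \<le> w x"
    using lim bounds
  proof eventually_elim
    case (elim x)
    show ?case
    proof
      assume "x \<in> \<Omega>"
      then have "(\<lambda>n. v n x) \<longlonglongrightarrow> w x" "\<And>n. ul x \<le> v n x" using elim by auto
      then show "ul x \<le> w x" by (intro LIMSEQ_le_const) auto
    qed
  qed
  have adm: "admissible w"
    unfolding admissible_def
  proof (intro conjI w_meas)
    show "AE x in lebesgue. x \<in> \<Omega> \<longrightarrow> ul x \<le> w x \<and> w x \<le> uu x"
      using w_le w_ge bounds by eventually_elim (meson order_trans)
  qed
  obtain u where u: "solves w u" using exists_solves[OF adm] by blast
  \<comment> \<open>The image \<open>y\<close> of \<open>v n\<close> separates the two: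
    \<open>u\<close> is below \<open>y\<close> because \<open>w\<close> is below \<open>v n\<close>,
    and \<open>y\<close> is below \<open>v n\<close> because \<open>v n\<close> is
    contracting.\<close>
  have "AE x in lebesgue. x \<in> \<Omega> \<longrightarrow> u x \<le> v n x" for n
  proof -
    obtain y where y: "solves (v n) y" "AE x in lebesgue. x \<in> \<Omega> \<longrightarrow> y x \<le> v n x" and vn: "admissible (v n)"
      using v[of n] by (auto simp: contracting_def)
    have "AE x in lebesgue. x \<in> \<Omega> \<longrightarrow> w x \<le> v n x" using w_le by eventually_elim auto
    from solves_mono[OF adm vn this u y(1)] y(2) show ?thesis by eventually_elim auto
  qed
  then have "AE x in lebesgue. \<forall>n. x \<in> \<Omega> \<longrightarrow> u x \<le> v n x" unfolding AE_all_countable by blast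
  with lim have "AE x in lebesgue. x \<in> \<Omega> \<longrightarrow> u x \<le> w x"
  proof eventually_elim
    case (elim x)
    show ?case
    proof
      assume "x \<in> \<Omega>"
      then have "(\<lambda>n. v n x) \<longlonglongrightarrow> w x" "\<And>n. u x \<le> v n x" using elim by auto
      then show "u x \<le> w x" by (intro LIMSEQ_le_const) auto
    qed
  qed
  then have "contracting w" using adm u by (auto simp: contracting_def)
  moreover have "size_of w \<le> \<alpha>"
  proof (rule LIMSEQ_le_const)
    show "(\<lambda>n. \<alpha> + inverse (real (Suc n))) \<longlonglongrightarrow> \<alpha>"
      using tendsto_add[OF tendsto_const LIMSEQ_inverse_real_of_nat, of \<alpha>] by simp
    have "size_of w \<le> \<alpha> + inverse (real (Suc n))" for n
    proof -
      have "size_of w \<le> size_of (f n)"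
      proof (rule size_of_mono[OF w_meas])
        show "f n \<in> borel_measurable lebesgue" using f(1)[of n] by (simp add: contracting_def admissible_def)
        show "AE x in lebesgue. x \<in> \<Omega> \<longrightarrow> w x \<le> f n x"
          using w_le by eventually_elim (meson v_le order_trans)
      qed
      then show ?thesis using f(2)[of n] by linarith
    qed
    then show "\<exists>N. \<forall>n\<ge>N. size_of w \<le> \<alpha> + inverse (real (Suc n))" by blast
  qed
  ultimately show ?thesis using that[of w] \<alpha>_le by (meson order_trans)
qed

text \<open>The image \<open>u\<close> of the minimal \<open>w\<close> is again contracting, so
  minimality forces equality in \<Omega> and \<open>u\<close> is a fixed point. Any solution
  \<open>y\<close> is contracting, hence so is its minimum with \<open>w\<close>; minimality makes
  this minimum equal to \<open>w\<close> in \<Omega>, so \<open>w\<close> is below \<open>y\<close>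
  there.\<close>

theorem smallest_solution:
  "\<exists>u\<^sub>1\<in>solution_set s G g b \<Omega> ul uu. \<forall>u\<in>solution_set s G g b \<Omega> ul uu. AE x in lebesgue. u\<^sub>1 x \<le> u x"
proof -
  obtain w where w: "contracting w" "\<And>y. contracting y \<Longrightarrow> size_of w \<le> size_of y"
    using contracting_minimal by metis
  obtain u where adm: "admissible w" and u: "solves w u" "AE x in lebesgue. x \<in> \<Omega> \<longrightarrow> u x \<le> w x"
    using w(1) by (auto simp: contracting_def)
  have w_meas: "w \<in> borel_measurable lebesgue" using adm by (simp add: admissible_def)
  have u_meas: "u \<in> borel_measurable lebesgue" by (rule solves_measurable[OF u(1)])
  have minimal: "AE x in lebesgue. x \<in> \<Omega> \<longrightarrow> y x = w x"
    if y: "contracting y" "AE x in lebesgue. x \<in> \<Omega> \<longrightarrow> y x \<le> w x" for y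
    using y w_meas by (intro size_of_eq_imp w(2)) (auto simp: contracting_def admissible_def)
  have adm_u: "admissible u" by (rule solves_admissible[OF adm u(1)])
  have "contracting u"
  proof -
    obtain u' where u': "solves u u'" using exists_solves[OF adm_u] by blast
    have "AE x in lebesgue. u' x \<le> u x" by (rule solves_mono[OF adm_u adm u(2) u' u(1)])
    then show ?thesis using adm_u u' by (auto simp: contracting_def elim: eventually_mono)
  qed
  then have u_eq: "AE x in lebesgue. x \<in> \<Omega> \<longrightarrow> u x = w x" using u(2) by (rule minimal)
  have "u \<in> solution_set s G g b \<Omega> ul uu"
  proof -
    \<comment> \<open>\<open>u\<close> and \<open>w\<close> are known to agree in \<Omega> only, but
      the source term depends on nothing else, so \<open>u\<close> solves the equation with its own
      right-hand side.\<close>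
    have "source w v = source u v" if "v \<in> W0 \<Omega>" for v
      using u_eq w_meas u_meas W_measurable[OF W0_W[OF that]]
      by (intro source_cong_AE) (auto elim: eventually_mono)
    then have "weak_solution s G g b \<Omega> u" using u(1) by (simp add: weak_solution_iff solves_def)
    then show ?thesis using solves_bounds[OF adm u(1)] by (simp add: solution_set_def)
  qed
  moreover have "AE x in lebesgue. u x \<le> y x" if y: "y \<in> solution_set s G g b \<Omega> ul uu" for y
  proof -
    have yW: "y \<in> W0 \<Omega>" using y by (simp add: solution_set_def weak_solution_iff)
    have adm_y: "admissible y"
      using y W_measurable[OF W0_W[OF yW]] by (auto simp: admissible_def solution_set_def elim: eventually_mono)
    have "solves y y" using y by (simp add: solves_def solution_set_def weak_solution_iff)
    then have "contracting y" using adm_y by (auto simp: contracting_def)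
    then have "contracting (\<lambda>x. min (y x) (w x))" using w(1) by (rule contracting_min)
    then have "AE x in lebesgue. x \<in> \<Omega> \<longrightarrow> min (y x) (w x) = w x" by (rule minimal) simp
    moreover have "AE x in lebesgue. x \<notin> \<Omega> \<longrightarrow> u x = 0" "AE x in lebesgue. x \<notin> \<Omega> \<longrightarrow> y x = 0"
      using yW u(1) by (auto simp: solves_def W0_iff)
    ultimately show ?thesis using u_eq by eventually_elim (auto simp: min_def split: if_splits)
  qed
  ultimately show ?thesis by blast
qed

end

section \<open>From quotient bounds and differentiability to the locale assumptions\<close>

lemma N_growthI:
  assumes N: "N_function G g" and cont: "continuous_on UNIV g" and p: "1 < p"
    and growth: "\<forall>t>0. p \<le> t * g t / G t \<and> t * g t / G t \<le> q"
  shows "N_growth G g p q"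
proof
  fix t :: real assume t: "0 < t"
  have "G t = integral {0..t} g" using N t by (simp add: N_function_def)
  moreover have "0 \<le> integral {0..t} g"
  proof (rule integral_nonneg)
    show "g integrable_on {0..t}" by (intro integrable_continuous_real continuous_on_subset[OF cont]) auto
    show "0 \<le> g x" if "x \<in> {0..t}" for x
      using N that unfolding N_function_def by (cases "x = 0") (auto intro: less_imp_le)
  qed
  \<comment> \<open>If \<open>G t\<close> were 0, the quotient would be 0 by the convention for
    division, against the lower bound \<open>p > 1\<close>.\<close>
  moreover have "G t \<noteq> 0" using growth t p by force
  ultimately have "0 < G t" by linarith
  moreover have "p \<le> t * g t / G t" "t * g t / G t \<le> q" using growth t by auto
  ultimately show "p * G t \<le> t * g t \<and> t * g t \<le> q * G t" by (simp add: field_simps)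
qed (rule N cont p)+

text \<open>Differentiability settles \<open>t > 0\<close> and oddness carries this to
  \<open>t < 0\<close>; at 0, right-continuity is part of \<open>N_function\<close>, and oddness
  supplies the left limit.\<close>

lemma N_function_continuous:
  assumes N: "N_function G g" and diff: "\<forall>t>0. g differentiable (at t)"
  shows "continuous_on UNIV g"
proof -
  have odd: "g (- t) = - g t" for t using N by (simp add: N_function_def)
  have pos: "isCont g t" if "t > 0" for t
    using diff that by (simp add: differentiable_imp_continuous_within)
  have neg: "isCont g t" if "t < 0" for t
  proof -
    have "isCont (\<lambda>x. g (- x)) t"
      by (rule isCont_o2[where f = uminus and g = g]) (use pos[of "- t"] that in auto)
    then have "isCont (\<lambda>x. - g (- x)) t" by (rule continuous_minus)
    then show ?thesis by (simp add: odd)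
  qed
  have "isCont g 0"
  proof -
    have "continuous (at_right 0) g" using N unfolding N_function_def by blast
    then have r: "(g \<longlongrightarrow> g 0) (at_right 0)" unfolding continuous_within .
    have "((\<lambda>x. - g (- x)) \<longlongrightarrow> - g 0) (at_left 0)"
      using r by (intro tendsto_minus) (simp add: filterlim_at_left_to_right)
    then have "(g \<longlongrightarrow> g 0) (at_left 0)" using N by (simp add: odd N_function_def)
    then show ?thesis using r by (simp add: isCont_def filterlim_at_split)
  qed
  then have "isCont g t" for t using pos neg by (cases t "0::real" rule: linorder_cases) auto
  then show ?thesis by (simp add: continuous_at_imp_continuous_on)
qed

theorem theorem23:
  fixes \<Omega> :: "'a::euclidean_space set"
    and s p\<^sub>m p\<^sub>p q\<^sub>m q\<^sub>p :: real
    and G g B b :: "real \<Rightarrow> real"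
    and ul uu :: "'a \<Rightarrow> real"
  assumes "0 < s" "s < 1"
    and "smooth_bounded_domain \<Omega>"
    and "N_function G g"
    and "1 < p\<^sub>m" "p\<^sub>m \<le> p\<^sub>p"
    and "\<forall>t>0. p\<^sub>m \<le> t * g t / G t \<and> t * g t / G t \<le> p\<^sub>p"
    and "\<forall>t>0. g differentiable (at t)"
    and "mono_on {0<..} (deriv g)"
    and "\<exists>M>0. (\<integral>\<^sup>+t\<in>{M..}. ennreal (conj_integrand DIM('a) s G t) \<partial>lborel) = \<infinity>"
    and "\<exists>\<delta>>0. (\<integral>\<^sup>+t\<in>{0..\<delta>}. ennreal (conj_integrand DIM('a) s G t) \<partial>lborel) < \<infinity>"
    and "N_function B b"
    and "b 0 = 0"
    and "continuous_on UNIV b"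
    and "G \<lless> B" "B \<lless> sobolev_conj DIM('a) s G"
    and "1 < q\<^sub>m" "q\<^sub>m \<le> q\<^sub>p"
    and "\<forall>t>0. q\<^sub>m \<le> t * b t / B t \<and> t * b t / B t \<le> q\<^sub>p"
    and "\<forall>t>0. p\<^sub>m - 1 \<le> t * deriv g t / g t \<and> t * deriv g t / g t \<le> p\<^sub>p - 1"
    and "p\<^sub>m > 2"
    and "convex_on {0<..} g"
    and "sub_super_pair s G g b \<Omega> ul uu"
    and "\<forall>u\<in>solution_set s G g b \<Omega> ul uu. 0 < (LINT x:\<Omega>|lebesgue. G (u x))"
  shows "(\<exists>u\<^sub>1\<in>solution_set s G g b \<Omega> ul uu.
            \<forall>u\<in>solution_set s G g b \<Omega> ul uu. AE x in lebesgue. u\<^sub>1 x \<le> u x) \<and>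
         (\<exists>u\<^sub>2\<in>solution_set s G g b \<Omega> ul uu.
            \<forall>u\<in>solution_set s G g b \<Omega> ul uu. AE x in lebesgue. u x \<le> u\<^sub>2 x)"
proof -
  interpret G: N_growth G g p\<^sub>m p\<^sub>p
    by (rule N_growthI[OF assms(4) N_function_continuous[OF assms(4,8)] assms(5,7)])
  interpret B: N_growth B b q\<^sub>m q\<^sub>p
    by (rule N_growthI[OF assms(12,14,17,19)])
  have s_less: "s < real DIM('a)" using assms(2) DIM_positive[where 'a = 'a] by linarith
  interpret C: Sobolev_conjugate G g p\<^sub>m p\<^sub>p "DIM('a)" s
    by unfold_locales (rule assms s_less)+
  interpret P: semilinear_problem G g p\<^sub>m p\<^sub>p s B b q\<^sub>m q\<^sub>p \<Omega>
    by unfold_locales (rule assms C.Sobolev_conjugate_axioms)+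
  interpret S: sub_super_problem G g p\<^sub>m p\<^sub>p s B b q\<^sub>m q\<^sub>p \<Omega> ul uu
    by unfold_locales (rule assms)
  interpret R: sub_super_problem G g p\<^sub>m p\<^sub>p s B b q\<^sub>m q\<^sub>p \<Omega> "\<lambda>x. - uu x" "\<lambda>x. - ul x"
    by unfold_locales (rule P.sub_super_pair_uminus[OF assms(23)])
  obtain v where v: "v \<in> solution_set s G g b \<Omega> (\<lambda>x. - uu x) (\<lambda>x. - ul x)"
    "\<And>u. u \<in> solution_set s G g b \<Omega> (\<lambda>x. - uu x) (\<lambda>x. - ul x) \<Longrightarrow> AE x in lebesgue. v x \<le> u x"
    using R.smallest_solution by blast
  have "(\<lambda>x. - v x) \<in> solution_set s G g b \<Omega> ul uu"
    using P.solution_set_uminus[OF v(1)] by simp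
  moreover have "AE x in lebesgue. u x \<le> - v x" if "u \<in> solution_set s G g b \<Omega> ul uu" for u
    using v(2)[OF P.solution_set_uminus[OF that]] by eventually_elim simp
  ultimately show ?thesis by (intro conjI S.smallest_solution bexI[of _ "\<lambda>x. - v x"] ballI)
qed

end
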